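(* Let $N\ge 2$, $0\le\beta<N$, $q\ge 1$, $0\le\lambda<\lambda_N$, and let $F$ be as in the context. Then $$\mathrm{ATMSC}(N,q,\lambda,\beta):=\sup_{u\in D^{N,q}(\mathbb{R}^N)\setminus\{0\},\ \|F(\nabla u)\|_N\le 1}\frac{1}{\|u\|_q^{q\left(1-\frac{\beta}{N}\right)}}\int_{\mathbb{R}^N}\frac{\Phi_{N,q,\beta}\left(\lambda\left(1-\frac{\beta}{N}\right)|u|^{\frac{N}{N-1}}\right)}{F^0(x)^\beta}\,dx<\infty,$$ and the constant $\lambda_N$ is sharp, in the sense that the same supremum is infinite if $\lambda\ge\lambda_N$.
   Context: $F:\mathbb{R}^N\to[0,+\infty)$ is a convex function of class $C^2(\mathbb{R}^N\setminus\{0\})$, even and positively homogeneous of degree $1$ (so $F(t\xi)=|t|F(\xi)$ for $t\in\mathbb{R}$, $\xi\in\mathbb{R}^N$), with $F(\xi)>0$ for $\xi\ne0$ and $\mathrm{Hess}(F^2)$ positive definite on $\mathbb{R}^N\setminus\{0\}$. Its polar is $F^0(x)=\sup\{\langle x,\xi\rangle: F(\xi)\le 1\}$. The number $\kappa_N$ is the Lebesgue measure of $W_1=\{x\in\mathbb{R}^N: F^0(x)\le1\}$, and $\lambda_N=N^{\frac{N}{N-1}}\kappa_N^{\frac{1}{N-1}}$. The space $D^{N,q}(\mathbb{R}^N)$ is the completion of $C_0^\infty(\mathbb{R}^N)$ under the norm $\|\nabla u\|_N+\|u\|_q$, where $\|\cdot\|_s$ denotes the $L^s(\mathbb{R}^N)$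 norm; $\|F(\nabla u)\|_N=\left(\int_{\mathbb{R}^N}F^N(\nabla u)\,dx\right)^{1/N}$. For $t\ge 0$, $$\Phi_{N,q,\beta}(t)=\sum_{j\in\mathbb{N},\ j>\frac{q(N-1)}{N}(1-\frac{\beta}{N})}\frac{t^j}{j!}\ \text{ if }\beta>0,\qquad \Phi_{N,q,0}(t)=\sum_{j\in\mathbb{N},\ j\ge\frac{q(N-1)}{N}}\frac{t^j}{j!}.$$ *)

theory Defs
  imports "HOL-Analysis.Analysis"
begin

section \<open>Classical differentiability\<close>

definition partial_deriv :: "'n \<Rightarrow> (real^'n \<Rightarrow> real) \<Rightarrow> real^'n \<Rightarrow> real" where
  "partial_deriv i f x = frechet_derivative f (at x) (axis i 1)"

definition grad :: "(real^'n \<Rightarrow> real) \<Rightarrow> real^'n \<Rightarrow> real^'n" where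
  "grad f x = (\<chi> i. partial_deriv i f x)"

definition Hess :: "(real^'n \<Rightarrow> real) \<Rightarrow> real^'n \<Rightarrow> real^'n^'n" where
  "Hess f x = (\<chi> i j. partial_deriv i (partial_deriv j f) x)"

definition positive_definite :: "real^'n^'n \<Rightarrow> bool" where
  "positive_definite A \<longleftrightarrow> transpose A = A \<and> (\<forall>v. v \<noteq> 0 \<longrightarrow> v \<bullet> (A *v v) > 0)"

text \<open>The class \<open>C\<^sup>k(S)\<close>; meant for open \<open>S\<close>, because derivatives are taken in the full space.\<close>

fun C_k_on :: "nat \<Rightarrow> (real^'n) set \<Rightarrow> (real^'n \<Rightarrow> real) \<Rightarrow> bool" where
  "C_k_on 0 S f \<longleftrightarrow> continuous_on S f"
| "C_k_on (Suc k) S f \<longleftrightarrow>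
     (\<forall>x\<in>S. f differentiable (at x)) \<and> (\<forall>i. C_k_on k S (partial_deriv i f))"

definition test_function :: "(real^'n \<Rightarrow> real) \<Rightarrow> bool" where
  "test_function \<phi> \<longleftrightarrow> (\<forall>k. C_k_on k UNIV \<phi>) \<and> compact (closure {x. \<phi> x \<noteq> 0})"


section \<open>The anisotropic norm, its polar, and the critical constant\<close>

definition anisotropic_norm :: "(real^'n \<Rightarrow> real) \<Rightarrow> bool" where
  "anisotropic_norm F \<longleftrightarrow>
     (\<forall>\<xi>. F \<xi> \<ge> 0) \<and>
     convex_on UNIV F \<and>
     C_k_on 2 (UNIV - {0}) F \<and>
     (\<forall>t \<xi>. F (t *\<^sub>R \<xi>) = \<bar>t\<bar> * F \<xi>) \<and>
     (\<forall>\<xi>. \<xi> \<noteq> 0 \<longrightarrow> F \<xi> > 0) \<and>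
     (\<forall>\<xi>. \<xi> \<noteq> 0 \<longrightarrow> positive_definite (Hess (\<lambda>\<eta>. (F \<eta>)\<^sup>2) \<xi>))"

definition polar :: "(real^'n \<Rightarrow> real) \<Rightarrow> real^'n \<Rightarrow> real" where
  "polar F x = (SUP \<xi>\<in>{\<xi>. F \<xi> \<le> 1}. x \<bullet> \<xi>)"

definition kappa :: "(real^'n \<Rightarrow> real) \<Rightarrow> real" where
  "kappa F = measure lebesgue {x. polar F x \<le> 1}"

definition lambda_crit :: "(real^'n \<Rightarrow> real) \<Rightarrow> real" where
  "lambda_crit F =
     (let N = real CARD('n) in N powr (N / (N - 1)) * kappa F powr (1 / (N - 1)))"


section \<open>Lebesgue norms and the space \<open>D\<^sup>N\<^sup>,\<^sup>q\<close>\<close>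

definition Lp :: "real \<Rightarrow> (real^'n \<Rightarrow> 'b::euclidean_space) set" where
  "Lp p = {f. f \<in> borel_measurable lebesgue \<and> integrable lebesgue (\<lambda>x. norm (f x) powr p)}"

text \<open>Only meaningful on \<^term>\<open>Lp p\<close>: the Bochner integral of a non-integrable function is \<open>0\<close>.\<close>

definition Lp_norm :: "real \<Rightarrow> (real^'n \<Rightarrow> 'b::euclidean_space) \<Rightarrow> real" where
  "Lp_norm p f = (LINT x|lebesgue. norm (f x) powr p) powr (1 / p)"

text \<open>
  The completion of the test functions under \<open>\<parallel>\<nabla>u\<parallel>\<^sub>N + \<parallel>u\<parallel>\<^sub>q\<close>, realised inside \<open>L\<^sup>q\<close>: a Cauchy
  sequence \<open>\<phi>\<^sub>k\<close> has limits \<open>\<phi>\<^sub>k \<rightarrow> u\<close> in \<open>L\<^sup>q\<close> and \<open>\<nabla>\<phi>\<^sub>k \<rightarrow> g\<close> in \<open>L\<^sup>N\<close>. Integration by parts shows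
  that \<open>g\<close> is the distributional gradient of \<open>u\<close>; hence \<open>g\<close> is determined by \<open>u\<close> up to a null set,
  and the element of the completion is determined by \<open>u\<close>. Functions here are representatives, so
  equality in the space is equality almost everywhere.
\<close>

definition has_D_gradient ::
    "real \<Rightarrow> (real^'n \<Rightarrow> real) \<Rightarrow> (real^'n \<Rightarrow> real^'n) \<Rightarrow> bool" where
  "has_D_gradient q u g \<longleftrightarrow>
     u \<in> Lp q \<and> g \<in> Lp (real CARD('n)) \<and>
     (\<exists>\<phi>. (\<forall>k::nat. test_function (\<phi> k)) \<and>
          (\<lambda>k. Lp_norm q (\<lambda>x. \<phi> k x - u x)) \<longlonglongrightarrow> 0 \<and>
          (\<lambda>k. Lp_norm (real CARD('n)) (\<lambda>x. grad (\<phi> k) x - g x)) \<longlonglongrightarrow> 0)"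

definition D_space :: "real \<Rightarrow> (real^'n \<Rightarrow> real) set" where
  "D_space q = {u. \<exists>g. has_D_gradient q u g}"


section \<open>The Trudinger--Moser supremum\<close>

definition Phi :: "real \<Rightarrow> real \<Rightarrow> real \<Rightarrow> real \<Rightarrow> real" where
  "Phi N q \<beta> t =
     (if \<beta> > 0 then \<Sum>\<^sub>\<infinity>j\<in>{j::nat. real j > q * (N - 1) / N * (1 - \<beta> / N)}. t ^ j / fact j
      else \<Sum>\<^sub>\<infinity>j\<in>{j::nat. real j \<ge> q * (N - 1) / N}. t ^ j / fact j)"

text \<open>The supremum is taken in \<^typ>\<open>ennreal\<close>, so that it exists whether or not it is finite.
  At \<open>x = 0\<close> the quotient is a division by zero; this single point does not affect the integral.\<close>

definition ATMSC :: "(real^'n \<Rightarrow> real) \<Rightarrow> real \<Rightarrow> real \<Rightarrow> real \<Rightarrow> ennreal" where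
  "ATMSC F q \<Lambda> \<beta> =
     (let N = real CARD('n) in
      SUP u\<in>{u \<in> D_space q. \<not> (AE x in lebesgue. u x = 0) \<and>
               (\<exists>g. has_D_gradient q u g \<and> Lp_norm N (\<lambda>x. F (g x)) \<le> 1)}.
        ennreal (1 / Lp_norm q u powr (q * (1 - \<beta> / N))) *
        (\<integral>\<^sup>+ x. ennreal (Phi N q \<beta> (\<Lambda> * (1 - \<beta> / N) * \<bar>u x\<bar> powr (N / (N - 1)))
                        / polar F x powr \<beta>) \<partial>lebesgue))"

end

theory Submission imports Defs
begin

text \<open>
  Write \<open>P = F\<^sup>0\<close>. No rearrangement is used. For a test function \<open>\<phi>\<close> and \<open>\<bar>\<phi>(x)\<bar> > 1\<close>, integrating
  \<open>\<nabla>\<phi>\<close> along rays from \<open>x\<close> up to the exit from \<open>\<Omega> = {\<bar>\<phi>\<bar> > 1}\<close> and averaging over directions gives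
  \<open>\<bar>\<phi>(x)\<bar> - 1 \<le> \<integral> K(z) F(\<nabla>\<phi>(x+z)) 1\<^sub>\<Omega>(x+z) dz\<close> with \<open>K = P\<^sup>1\<^sup>-\<^sup>N / (N \<kappa>\<^sub>N)\<close>. On \<open>{P > \<delta>}\<close>,
  Hoelder's inequality bounds the potential with the sharp constant \<open>\<lambda>\<^sub>N\<close>; on \<open>{P \<le> \<delta>}\<close> its
  \<open>L\<^sup>N\<close> norm is \<open>O(\<delta>)\<close>. Choosing \<open>\<delta>\<close> in terms of the level yields
  \<open>\<bar>{\<bar>\<phi>\<bar> > 1 + \<tau>}\<bar> \<le> C \<bar>\<Omega>\<bar> exp(-\<nu> \<tau>\<^bsup>N/(N-1)\<^esup>)\<close> for every \<open>\<nu> < \<lambda>\<^sub>N\<close>, hence the exponential integral.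
  The singular weight is removed by Young's inequality, and Fatou's lemma passes from test functions
  to \<open>D\<^sup>N\<^sup>,\<^sup>q\<close>.

  For \<open>\<Lambda> \<ge> \<lambda>\<^sub>N\<close>, mollified Moser functions \<open>max 0 (min L (- ln P))\<close> have energy \<open>N \<kappa>\<^sub>N L + O(1)\<close> and
  bounded \<open>L\<^sup>q\<close> norm, so after normalisation the integral stays bounded below while the \<open>L\<^sup>q\<close> norm
  tends to \<open>0\<close> as \<open>L \<rightarrow> \<infinity>\<close>.
\<close>

section \<open>The polar norm\<close>

text \<open>Origin of the constant: with p = N/(N-1), the p-th power of the kernel integrates over d
  < P < R to (N \<kappa>)^(-1/(N-1)) ln(R/d). Take R^N = m, a bound for the measure of Omega, and
  let d^N = m exp(-\<nu> \<tau>^p) be the target measure. Then ln(R/d) = \<nu> \<tau>^p / N, and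
  Hoelder bounds the far potential by about (\<nu>/crit)^(1/p) \<tau>, strictly less than \<tau>.
  Only the near potential can then lift the function above the level, and Markov's inequality makes
  that set of measure O(d^N), the target. Two obstacles shape the statements. The kernel is not
  p-integrable at infinity; cutting at level 1 leaves a set Omega whose measure Chebyshev bounds by
  the q-th power of the L^q norm, and estimates that scale correctly in m match the normalisation of
  the quotient. Moreover, approximating test functions may have energy slightly above 1, so their
  estimates carry an energy budget B > 1, paid for by the gap below the critical constant.\<close>

lemma nn_integral_lborel_affine:
  fixes f :: "'a::euclidean_space \<Rightarrow> ennreal"
  assumes [measurable]: "f \<in> borel_measurable borel" and "c \<noteq> 0"
  shows "(\<integral>\<^sup>+x. f x \<partial>lborel) = ennreal (\<bar>c\<bar> ^ DIM('a)) * (\<integral>\<^sup>+x. f (t + c *\<^sub>R x) \<partial>lborel)"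
  by (subst lborel_affine[OF \<open>c \<noteq> 0\<close>, of t])
     (simp add: nn_integral_density nn_integral_distr nn_integral_cmult)

lemma nn_integral_lborel_translate:
  fixes f :: "'a::euclidean_space \<Rightarrow> ennreal"
  assumes "f \<in> borel_measurable borel"
  shows "(\<integral>\<^sup>+x. f (t + x) \<partial>lborel) = (\<integral>\<^sup>+x. f x \<partial>lborel)"
  using nn_integral_lborel_affine[OF assms, of 1 t] by simp

locale anisotropic =
  fixes F :: "real^'n \<Rightarrow> real" and N :: real
  assumes aniso: "anisotropic_norm F"
    and N_eq: "N = real CARD('n)"
    and card_ge_2: "CARD('n) \<ge> 2"
begin

abbreviation P :: "real^'n \<Rightarrow> real" where "P \<equiv> polar F"
abbreviation superlevel :: "(real^'n \<Rightarrow> real) \<Rightarrow> (real^'n) set" where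
  "superlevel \<phi> \<equiv> {x. \<bar>\<phi> x\<bar> > 1}"
abbreviation \<kappa> :: real where "\<kappa> \<equiv> kappa F"

lemma N_ge_2: "N \<ge> 2"
  using card_ge_2 by (simp add: N_eq)

lemma F_nonneg [simp]: "F \<xi> \<ge> 0"
  and F_scaleR: "F (t *\<^sub>R \<xi>) = \<bar>t\<bar> * F \<xi>"
  and F_pos: "\<xi> \<noteq> 0 \<Longrightarrow> F \<xi> > 0"
  and F_convex: "convex_on UNIV F"
  using aniso by (auto simp: anisotropic_norm_def)

lemma F_0 [simp]: "F 0 = 0"
  using F_scaleR[of 0 0] by simp

lemma F_minus [simp]: "F (- \<xi>) = F \<xi>"
  using F_scaleR[of "-1" \<xi>] by simp

lemma F_triangle: "F (x + y) \<le> F x + F y"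
proof -
  have "F ((1/2) *\<^sub>R (2 *\<^sub>R x) + (1/2) *\<^sub>R (2 *\<^sub>R y)) \<le> (1/2) * F (2 *\<^sub>R x) + (1/2) * F (2 *\<^sub>R y)"
    using convex_onD[OF F_convex, of "1/2" "2 *\<^sub>R x" "2 *\<^sub>R y"] by simp
  then show ?thesis by (simp add: F_scaleR)
qed

lemma F_continuous: "continuous_on S F"
  using convex_on_continuous[OF open_UNIV F_convex] continuous_on_subset by blast

lemma F_measurable [measurable]: "F \<in> borel_measurable borel"
  using F_continuous by (rule borel_measurable_continuous_onI)

lemma F_bounds: obtains c C where "c > 0" "C > 0" "\<And>\<xi>. c * norm \<xi> \<le> F \<xi>" "\<And>\<xi>. F \<xi> \<le> C * norm \<xi>"
proof -
  have S: "compact (sphere (0::real^'n) 1)" "sphere (0::real^'n) 1 \<noteq> {}" by auto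
  obtain y where y: "y \<in> sphere 0 1" "\<And>x. x \<in> sphere 0 1 \<Longrightarrow> F y \<le> F x"
    using continuous_attains_inf[OF S F_continuous] by blast
  obtain z where z: "z \<in> sphere 0 1" "\<And>x. x \<in> sphere 0 1 \<Longrightarrow> F x \<le> F z"
    using continuous_attains_sup[OF S F_continuous] by blast
  have "F y * norm \<xi> \<le> F \<xi> \<and> F \<xi> \<le> F z * norm \<xi>" for \<xi>
  proof (cases "\<xi> = 0")
    case False
    then have "(1 / norm \<xi>) *\<^sub>R \<xi> \<in> sphere 0 1" by simp
    from y(2)[OF this] z(2)[OF this] show ?thesis using False by (simp add: F_scaleR field_simps)
  qed simp
  moreover have "F y > 0" "F z > 0" using y(1) z(1) by (auto intro!: F_pos)
  ultimately show ?thesis using that by blast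
qed

text \<open>A \<open>SUP\<close> of reals carries information only over a bounded set. The lower
  bound \<open>c * norm \<xi> \<le> F \<xi>\<close> confines the unit ball of \<open>F\<close>, and
  Cauchy-Schwarz does the rest.\<close>

lemma polar_bdd: "bdd_above ((\<lambda>\<xi>. x \<bullet> \<xi>) ` {\<xi>. F \<xi> \<le> 1})"
proof -
  obtain c where c: "c > 0" "\<And>\<xi>. c * norm \<xi> \<le> F \<xi>" using F_bounds by metis
  have "x \<bullet> \<xi> \<le> norm x * (1 / c)" if "F \<xi> \<le> 1" for \<xi>
  proof -
    have "norm \<xi> \<le> 1 / c" using c(2)[of \<xi>] that c(1) by (simp add: field_simps)
    then show ?thesis using norm_cauchy_schwarz[of x \<xi>] mult_left_mono[of "norm \<xi>" "1/c" "norm x"] by simp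
  qed
  then show ?thesis by (intro bdd_aboveI2) auto
qed

lemma polar_leI: "(\<And>\<xi>. F \<xi> \<le> 1 \<Longrightarrow> x \<bullet> \<xi> \<le> c) \<Longrightarrow> P x \<le> c"
  unfolding polar_def by (rule cSUP_least) (auto intro: exI[of _ 0])

lemma polar_ge: "F \<xi> \<le> 1 \<Longrightarrow> x \<bullet> \<xi> \<le> P x"
  unfolding polar_def by (rule cSUP_upper[OF _ polar_bdd]) auto

lemma polar_nonneg [simp]: "P x \<ge> 0"
  using polar_ge[of 0 x] by simp

lemma inner_le_polar: "x \<bullet> \<xi> \<le> P x * F \<xi>"
proof (cases "\<xi> = 0")
  case False
  then have "F \<xi> > 0" by (rule F_pos)
  then have "x \<bullet> ((1 / F \<xi>) *\<^sub>R \<xi>) \<le> P x" by (intro polar_ge) (simp add: F_scaleR)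
  with \<open>F \<xi> > 0\<close> show ?thesis by (simp add: field_simps)
qed simp

lemma abs_inner_le_polar: "\<bar>x \<bullet> \<xi>\<bar> \<le> P x * F \<xi>"
  using inner_le_polar[of x \<xi>] inner_le_polar[of x "- \<xi>"] by simp

lemma polar_0 [simp]: "P 0 = 0"
  by (intro antisym polar_leI) auto

lemma polar_minus [simp]: "P (- x) = P x"
proof -
  have "P (- x) \<le> P x" for x
    by (rule polar_leI) (use polar_ge[of "- _" x] in force)
  from this[of x] this[of "- x"] show ?thesis by simp
qed

lemma polar_scaleR: "P (t *\<^sub>R x) = \<bar>t\<bar> * P x"
proof -
  have *: "P (t *\<^sub>R x) \<le> t * P x" if "t \<ge> 0" for t x
    by (rule polar_leI) (use that polar_ge in \<open>auto intro: mult_left_mono\<close>)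
  have pos: "P (t *\<^sub>R x) = t * P x" if "t > 0" for t x
    using *[of t x] *[of "1 / t" "t *\<^sub>R x"] that by (simp add: field_simps)
  show ?thesis
    using pos[of t x] pos[of "- t" x] polar_minus[of "t *\<^sub>R x"] by (cases t "0::real" rule: linorder_cases) auto
qed

lemma polar_triangle: "P (x + y) \<le> P x + P y"
  by (rule polar_leI) (auto simp: inner_add_left intro!: add_mono polar_ge)

lemma polar_minus_commute: "P (x - y) = P (y - x)"
  using polar_minus[of "x - y"] by simp

lemma polar_upper: obtains C where "C > 0" "\<And>x. P x \<le> C * norm x"
proof -
  obtain c where c: "c > 0" "\<And>\<xi>. c * norm \<xi> \<le> F \<xi>" using F_bounds by metis
  have "P x \<le> (1 / c) * norm x" for x
  proof (rule polar_leI)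
    fix \<xi> assume "F \<xi> \<le> 1"
    then have "norm \<xi> \<le> 1 / c" using c(2)[of \<xi>] c(1) by (simp add: field_simps)
    then show "x \<bullet> \<xi> \<le> 1 / c * norm x"
      using norm_cauchy_schwarz[of x \<xi>] mult_left_mono[of "norm \<xi>" "1/c" "norm x"] by simp
  qed
  then show ?thesis using c(1) that[of "1/c"] by simp
qed

lemma polar_lower: obtains c where "c > 0" "\<And>x. c * norm x \<le> P x"
proof -
  obtain C where C: "C > 0" "\<And>\<xi>. F \<xi> \<le> C * norm \<xi>" using F_bounds by metis
  have "(1 / C) * norm x \<le> P x" for x
  proof (cases "x = 0")
    case False
    have "x \<bullet> x \<le> P x * (C * norm x)"
      using inner_le_polar[of x x] mult_left_mono[OF C(2)[of x], of "P x"] by simp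
    then have "norm x * norm x \<le> (P x * C) * norm x"
      by (simp add: power2_norm_eq_inner[symmetric] power2_eq_square)
    then have "norm x \<le> P x * C" using False by simp
    then show ?thesis using C(1) by (simp add: field_simps)
  qed simp
  then show ?thesis using C(1) that[of "1/C"] by simp
qed

lemma polar_eq_0_iff [simp]: "P x = 0 \<longleftrightarrow> x = 0"
  using polar_lower by (metis mult_pos_pos norm_le_zero_iff polar_0 not_le zero_less_norm_iff)

lemma polar_pos: "x \<noteq> 0 \<Longrightarrow> P x > 0"
  using polar_eq_0_iff[of x] polar_nonneg[of x] by linarith

lemma polar_convex: "convex_on UNIV P"
proof (rule convex_onI)
  fix t x y assume "0 < t" "t < (1::real)"
  then show "P ((1 - t) *\<^sub>R x + t *\<^sub>R y) \<le> (1 - t) * P x + t * P y"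
    using polar_triangle[of "(1 - t) *\<^sub>R x" "t *\<^sub>R y"] by (simp add: polar_scaleR)
qed simp

lemma polar_continuous: "continuous_on S P"
  using convex_on_continuous[OF open_UNIV polar_convex] continuous_on_subset by blast

lemma polar_measurable [measurable]: "P \<in> borel_measurable borel"
  using polar_continuous by (rule borel_measurable_continuous_onI)

text \<open>The inequality \<open>F \<le> F\<^sup>0\<^sup>0\<close> of the bipolar theorem.\<close>

lemma F_leI:
  assumes "\<And>y. P y \<le> 1 \<Longrightarrow> y \<bullet> \<xi> \<le> c"
  shows "F \<xi> \<le> c"
proof (rule ccontr)
  assume "\<not> F \<xi> \<le> c"
  have "c \<ge> 0" using assms[of 0] by simp
  \<comment> \<open>Strictly between \<open>c\<close> and \<open>F \<xi>\<close>: positive even when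
    \<open>c = 0\<close>, and \<xi> / d still lies outside the unit ball of
    \<open>F\<close>.\<close>
  define d where "d = (c + F \<xi>) / 2"
  have d: "d > c" "d < F \<xi>" "d > 0" using \<open>\<not> F \<xi> \<le> c\<close> \<open>c \<ge> 0\<close> by (auto simp: d_def)
  let ?K = "{\<eta>. F \<eta> \<le> 1}"
  have "convex ?K"
  proof (rule convexI)
    fix x y :: "real^'n" and u v :: real
    assume *: "x \<in> ?K" "y \<in> ?K" "0 \<le> u" "0 \<le> v" "u + v = 1"
    have "F (u *\<^sub>R x + v *\<^sub>R y) \<le> u * F x + v * F y"
      using F_triangle[of "u *\<^sub>R x" "v *\<^sub>R y"] * by (simp add: F_scaleR)
    also have "\<dots> \<le> u * 1 + v * 1" using * by (intro add_mono mult_left_mono) auto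
    finally show "u *\<^sub>R x + v *\<^sub>R y \<in> ?K" using * by simp
  qed
  moreover have "closed ?K"
    by (intro closed_Collect_le continuous_on_const F_continuous)
  moreover have "(1 / d) *\<^sub>R \<xi> \<notin> ?K"
    using d by (simp add: F_scaleR field_simps)
  ultimately obtain a b where ab: "a \<bullet> ((1 / d) *\<^sub>R \<xi>) < b" "\<forall>x\<in>?K. a \<bullet> x > b"
    using separating_hyperplane_closed_point by blast
  have "b < 0" using ab(2)[rule_format, of 0] by simp
  \<comment> \<open>Dividing the separating functional by its negative level \<open>b\<close>
    reverses the inequalities and puts it into the polar unit ball.\<close>
  define y where "y = (1 / b) *\<^sub>R a"
  have "P y \<le> 1"
  proof (rule polar_leI)
    fix x assume "F x \<le> 1"
    then have "a \<bullet> x > b" using ab(2) by simp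
    then show "y \<bullet> x \<le> 1" using \<open>b < 0\<close> by (simp add: y_def field_simps)
  qed
  then have "y \<bullet> \<xi> \<le> c" by (rule assms)
  moreover have "y \<bullet> \<xi> > d"
    using ab(1) \<open>b < 0\<close> d by (simp add: y_def field_simps)
  ultimately show False using d by simp
qed

lemma compact_polar_ball: "compact {x. P x \<le> r}"
proof -
  obtain c where c: "c > 0" "\<And>x. c * norm x \<le> P x" using polar_lower by blast
  have "bounded {x. P x \<le> r}"
    unfolding bounded_iff using c
    by (intro exI[of _ "r / c"]) (auto simp: field_simps intro: order_trans)
  moreover have "closed {x. P x \<le> r}"
    by (intro closed_Collect_le continuous_on_const polar_continuous)
  ultimately show ?thesis by (simp add: compact_eq_bounded_closed)
qed

lemma emeasure_polar_ball_1: "emeasure lborel {x. P x \<le> 1} = ennreal \<kappa>"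
proof -
  have "{x. P x \<le> 1} \<in> sets lborel" by measurable
  moreover have "emeasure lborel {x. P x \<le> 1} < \<infinity>"
    by (rule emeasure_compact_finite[OF compact_polar_ball])
  ultimately show ?thesis
    unfolding kappa_def by (simp add: emeasure_eq_ennreal_measure measure_completion)
qed

lemma kappa_pos: "\<kappa> > 0"
proof -
  obtain C where C: "C > 0" "\<And>x. P x \<le> C * norm x" using polar_upper by blast
  have "ball 0 (1 / C) \<subseteq> {x. P x \<le> 1}"
  proof
    fix x :: "real^'n" assume "x \<in> ball 0 (1 / C)"
    then have "C * norm x < 1" using C(1) by (simp add: field_simps)
    then show "x \<in> {x. P x \<le> 1}" using C(2)[of x] by simp
  qed
  then have "emeasure lborel (ball (0::real^'n) (1 / C)) \<le> ennreal \<kappa>"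
    unfolding emeasure_polar_ball_1[symmetric] by (intro emeasure_mono) auto
  moreover have "emeasure lborel (ball (0::real^'n) (1 / C)) \<noteq> 0"
    using C(1) content_ball_pos[of "1/C" "0::real^'n"] by (auto simp: measure_def)
  ultimately show ?thesis
    by (metis ennreal_neg not_le le_zero_eq)
qed

lemma emeasure_polar_ball:
  assumes "r \<ge> 0"
  shows "emeasure lborel {x. P x \<le> r} = ennreal (\<kappa> * r ^ CARD('n))"
proof (cases "r = 0")
  case True
  have "{x. P x \<le> r} = {0}" using True by (auto simp: antisym[OF _ polar_nonneg] simp flip: polar_eq_0_iff)
  then show ?thesis using True by (simp add: power_0_left)
next
  case False
  have "emeasure lborel {x. P x \<le> r} = (\<integral>\<^sup>+x. indicator {x. P x \<le> r} x \<partial>lborel)" by simp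
  also have "\<dots> = ennreal (\<bar>r\<bar> ^ DIM(real^'n)) * (\<integral>\<^sup>+x. indicator {x. P x \<le> r} (0 + r *\<^sub>R x) \<partial>lborel)"
    using False by (intro nn_integral_lborel_affine) auto
  also have "(\<lambda>x. indicator {x. P x \<le> r} (0 + r *\<^sub>R x) :: ennreal) = indicator {x. P x \<le> 1}"
    using False assms by (auto simp: indicator_def polar_scaleR fun_eq_iff)
  finally show ?thesis using assms kappa_pos
    by (simp add: emeasure_polar_ball_1 ennreal_mult' mult.commute)
qed

lemma emeasure_polar_ball_powr:
  assumes "r > 0"
  shows "emeasure lborel {x. P x \<le> r} = ennreal (\<kappa> * r powr N)"
  using emeasure_polar_ball[of r] assms by (simp add: N_eq powr_realpow)

end

section \<open>Integrals of powers of the polar, from the volumes of its balls\<close>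

lemma nn_integral_powr_atLeastAtMost_0:
  assumes "e > -1" "c \<ge> 0" "R > 0"
  shows "(\<integral>\<^sup>+t. ennreal (c * t powr e) * indicator {0..R} t \<partial>lborel) = ennreal (c * R powr (e + 1) / (e + 1))"
proof -
  have "((\<lambda>t. c * t powr e) has_integral c * (R powr (e+1) / (e+1))) {0..R}"
    by (intro has_integral_mult_right has_integral_powr_from_0) (use assms in auto)
  from nn_integral_has_integral_lebesgue[OF _ this] show ?thesis
    using assms by (simp add: ennreal_mult' ennreal_indicator mult_ac)
qed

lemma nn_integral_powr_atLeast:
  assumes "e < -1" "c \<ge> 0" "R > 0"
  shows "(\<integral>\<^sup>+t. ennreal (c * t powr e) * indicator {R..} t \<partial>lborel) = ennreal (c * R powr (e + 1) / (- e - 1))"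
proof -
  have "((\<lambda>t. c * t powr e) has_integral c * (- (R powr (e+1)) / (e+1))) {R..}"
    by (intro has_integral_mult_right has_integral_powr_to_inf) (use assms in auto)
  moreover have "c * (- (R powr (e+1)) / (e+1)) = c * R powr (e + 1) / (- e - 1)"
    using assms by (simp add: field_simps)
  ultimately have "((\<lambda>t. c * t powr e) has_integral c * R powr (e + 1) / (- e - 1)) {R..}"
    by simp
  from nn_integral_has_integral_lebesgue[OF _ this] show ?thesis
    using assms by (simp add: ennreal_mult' ennreal_indicator mult_ac)
qed

lemma nn_integral_inverse_atLeastAtMost:
  assumes "c \<ge> 0" "0 < d" "d \<le> R"
  shows "(\<integral>\<^sup>+t. ennreal (c * t powr (-1)) * indicator {d..R} t \<partial>lborel) = ennreal (c * ln (R / d))"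
proof -
  have "(\<integral>\<^sup>+t. ennreal (c * t powr (-1)) * indicator {d..R} t \<partial>lborel) = ennreal (c * ln R - c * ln d)"
    by (rule nn_integral_FTC_Icc)
       (use assms in \<open>auto intro!: derivative_eq_intros simp: powr_minus field_simps\<close>)
  then show ?thesis using assms by (simp add: ln_div algebra_simps)
qed

context anisotropic
begin

text \<open>Layer-cake substitute for polar coordinates: P z powr (-a) is the integral of a t powr
  (-a-1) over t \<ge> P z, and Tonelli exchanges the order. Only volumes of polar balls enter, no
  surface measure.\<close>

lemma nn_integral_polar_powr:
  assumes "a > 0" and [measurable]: "A \<in> sets borel"
  shows "(\<integral>\<^sup>+z. ennreal (P z powr (- a)) * indicator A z \<partial>lborel) =
    (\<integral>\<^sup>+t. ennreal (a * t powr (- a - 1)) * indicator {0<..} t * emeasure lborel (A \<inter> {z. P z \<le> t}) \<partial>lborel)"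
proof -
  let ?k = "\<lambda>z t. ennreal (a * t powr (- a - 1)) * indicator {0<..} t * indicator (A \<inter> {z. P z \<le> t}) z"
  have [measurable]: "Measurable.pred (borel \<Otimes>\<^sub>M borel) (\<lambda>x. P (fst x) \<le> snd x)" by measurable
  \<comment> \<open>The origin is left out: \<open>0 powr (- a)\<close> is 0 by convention, while
    the integral over t diverges there if the origin belongs to \<open>A\<close>.\<close>
  have *: "ennreal (P z powr (- a)) * indicator A z = (\<integral>\<^sup>+t. ?k z t \<partial>lborel)" if "z \<noteq> 0" for z
  proof -
    have "ennreal (P z powr (- a)) = (\<integral>\<^sup>+t. ennreal (a * t powr (- a - 1)) * indicator {P z..} t \<partial>lborel)"
      using \<open>a > 0\<close> polar_pos[OF that] by (subst nn_integral_powr_atLeast) auto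
    then have "ennreal (P z powr (- a)) * indicator A z =
        (\<integral>\<^sup>+t. ennreal (a * t powr (- a - 1)) * indicator {P z..} t * indicator A z \<partial>lborel)"
      by (subst nn_integral_multc) auto
    also have "\<dots> = (\<integral>\<^sup>+t. ?k z t \<partial>lborel)"
      using polar_pos[OF that] by (intro nn_integral_cong) (auto simp: indicator_def)
    finally show ?thesis .
  qed
  have "(\<integral>\<^sup>+z. ennreal (P z powr (- a)) * indicator A z \<partial>lborel) = (\<integral>\<^sup>+z. \<integral>\<^sup>+t. ?k z t \<partial>lborel \<partial>lborel)"
    by (intro nn_integral_cong_AE eventually_mono[OF AE_lborel_singleton[of 0]]) (rule *)
  also have "\<dots> = (\<integral>\<^sup>+t. \<integral>\<^sup>+z. ?k z t \<partial>lborel \<partial>lborel)"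
    by (rule lborel_pair.Fubini'[symmetric])
       (simp add: indicator_def case_prod_unfold of_bool_def cong: measurable_cong_sets)
  also have "\<dots> = (\<integral>\<^sup>+t. ennreal (a * t powr (- a - 1)) * indicator {0<..} t * emeasure lborel (A \<inter> {z. P z \<le> t}) \<partial>lborel)"
    by (intro nn_integral_cong) (simp add: nn_integral_cmult)
  finally show ?thesis .
qed

text \<open>A layer t \<le> R sees the full ball of radius t, a later one only the ball of radius R.
  The two ranges contribute a / (N - a) and 1, which add up to N / (N - a).\<close>

lemma nn_integral_polar_powr_ball:
  assumes "0 < a" "a < N" "R > 0"
  shows "(\<integral>\<^sup>+z. ennreal (P z powr (- a)) * indicator {z. P z \<le> R} z \<partial>lborel)
      \<le> ennreal (\<kappa> * N / (N - a) * R powr (N - a))"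
proof -
  have "(\<integral>\<^sup>+z. ennreal (P z powr (- a)) * indicator {z. P z \<le> R} z \<partial>lborel)
    \<le> (\<integral>\<^sup>+t. ennreal (a * \<kappa> * t powr (N - a - 1)) * indicator {0..R} t
         + ennreal (a * \<kappa> * R powr N * t powr (- a - 1)) * indicator {R..} t \<partial>lborel)"
    unfolding nn_integral_polar_powr[OF \<open>0 < a\<close>, of "{z. P z \<le> R}", simplified]
  proof (rule nn_integral_mono)
    fix t :: real
    show "ennreal (a * t powr (- a - 1)) * indicator {0<..} t * emeasure lborel ({z. P z \<le> R} \<inter> {z. P z \<le> t})
      \<le> ennreal (a * \<kappa> * t powr (N - a - 1)) * indicator {0..R} t
         + ennreal (a * \<kappa> * R powr N * t powr (- a - 1)) * indicator {R..} t"
    proof (cases "t > 0")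
      case True
      have eq: "{z. P z \<le> R} \<inter> {z. P z \<le> t} = {z. P z \<le> min t R}" by auto
      have "emeasure lborel ({z. P z \<le> R} \<inter> {z. P z \<le> t}) = ennreal (\<kappa> * min t R powr N)"
        unfolding eq using True assms by (intro emeasure_polar_ball_powr) simp
      then have "ennreal (a * t powr (- a - 1)) * emeasure lborel ({z. P z \<le> R} \<inter> {z. P z \<le> t})
          = ennreal (a * \<kappa> * (t powr (- a - 1) * min t R powr N))"
        using \<open>a > 0\<close> by (simp add: mult_ac flip: ennreal_mult')
      moreover have "t powr (- a - 1) * t powr N = t powr (N - a - 1)"
        using True by (simp add: algebra_simps flip: powr_add)
      ultimately show ?thesis
        using True by (cases "t \<le> R") (simp_all add: add_increasing2 mult_ac)
    qed simp
  qed
  also have "\<dots> = ennreal (a * \<kappa> * R powr (N - a - 1 + 1) / (N - a - 1 + 1)) +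
      ennreal (a * \<kappa> * R powr N * R powr (- a - 1 + 1) / (- (- a - 1) - 1))"
    using assms kappa_pos
    by (subst nn_integral_add)
       (auto simp: nn_integral_powr_atLeastAtMost_0 nn_integral_powr_atLeast)
  also have "\<dots> = ennreal (a * \<kappa> * R powr (N - a) / (N - a) + \<kappa> * R powr (N - a))"
    using assms kappa_pos by (subst ennreal_plus[symmetric]) (auto simp: powr_add powr_diff powr_minus field_simps)
  also have "a * \<kappa> * R powr (N - a) / (N - a) + \<kappa> * R powr (N - a) = \<kappa> * N / (N - a) * R powr (N - a)"
    using assms by (simp add: field_simps)
  finally show ?thesis .
qed

lemma layer_le:
  assumes "t > 0" "a \<ge> 0"
  shows "ennreal (a * t powr (- a - 1)) * emeasure lborel (A \<inter> {z. P z \<le> t})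
    \<le> ennreal (a * \<kappa> * t powr (N - a - 1))"
proof -
  have "emeasure lborel (A \<inter> {z. P z \<le> t}) \<le> emeasure lborel {z. P z \<le> t}"
    by (intro emeasure_mono) auto
  also have "\<dots> = ennreal (\<kappa> * t powr N)" by (rule emeasure_polar_ball_powr[OF assms(1)])
  finally have "ennreal (a * t powr (- a - 1)) * emeasure lborel (A \<inter> {z. P z \<le> t})
      \<le> ennreal (a * t powr (- a - 1)) * ennreal (\<kappa> * t powr N)"
    by (rule mult_left_mono) simp
  also have "\<dots> = ennreal (a * \<kappa> * (t powr (- a - 1) * t powr N))"
    using assms by (subst ennreal_mult'[symmetric]) (auto simp: mult_ac)
  also have "t powr (- a - 1) * t powr N = t powr (N - a - 1)"
    using assms by (simp add: algebra_simps flip: powr_add)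
  finally show ?thesis .
qed

text \<open>Only layers t \<ge> R meet the set, and each shell is enlarged to a full ball. This
  gives the factor a where the exact value has N; only the decay in R matters later.\<close>

lemma nn_integral_polar_powr_exterior:
  assumes "N < a" "R > 0"
  shows "(\<integral>\<^sup>+z. ennreal (P z powr (- a)) * indicator {z. P z > R} z \<partial>lborel)
      \<le> ennreal (\<kappa> * a / (a - N) * R powr (N - a))"
proof -
  have "a > 0" using assms N_ge_2 by simp
  have "(\<integral>\<^sup>+z. ennreal (P z powr (- a)) * indicator {z. P z > R} z \<partial>lborel)
    \<le> (\<integral>\<^sup>+t. ennreal (a * \<kappa> * t powr (N - a - 1)) * indicator {R..} t \<partial>lborel)"
    unfolding nn_integral_polar_powr[OF \<open>0 < a\<close>, of "{z. P z > R}", simplified]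
  proof (rule nn_integral_mono)
    fix t :: real
    show "ennreal (a * t powr (- a - 1)) * indicator {0<..} t * emeasure lborel ({z. R < P z} \<inter> {z. P z \<le> t})
      \<le> ennreal (a * \<kappa> * t powr (N - a - 1)) * indicator {R..} t"
    proof (cases "t \<ge> R")
      case True
      then show ?thesis
        using layer_le[of t a "{z. R < P z}"] \<open>a > 0\<close> assms by simp
    next
      case False
      then have "{z. R < P z} \<inter> {z. P z \<le> t} = {}" by auto
      then show ?thesis by simp
    qed
  qed
  also have "\<dots> = ennreal (a * \<kappa> * R powr (N - a - 1 + 1) / (- (N - a - 1) - 1))"
    using assms kappa_pos \<open>a > 0\<close> by (intro nn_integral_powr_atLeast) auto
  also have "a * \<kappa> * R powr (N - a - 1 + 1) / (- (N - a - 1) - 1) = \<kappa> * a / (a - N) * R powr (N - a)"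
    by simp
  finally show ?thesis .
qed

text \<open>At the exponent N the layers between d and R each contribute about N \<kappa> / t,
  whence the logarithm; beyond R the volume bound m keeps the tail finite. The coefficient N
  \<kappa> of the logarithm is sharp and produces the critical constant.\<close>

lemma nn_integral_polar_powr_critical:
  assumes [measurable]: "A \<in> sets borel" and "0 < d" "d \<le> R"
    and "\<And>z. z \<in> A \<Longrightarrow> P z \<ge> d" and A: "emeasure lborel A \<le> ennreal m" "m \<ge> 0"
  shows "(\<integral>\<^sup>+z. ennreal (P z powr (- N)) * indicator A z \<partial>lborel)
      \<le> ennreal (N * \<kappa> * ln (R / d) + m * R powr (- N))"
proof -
  have N: "N > 0" using N_ge_2 by simp
  have "(\<integral>\<^sup>+z. ennreal (P z powr (- N)) * indicator A z \<partial>lborel)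
    \<le> (\<integral>\<^sup>+t. ennreal (N * \<kappa> * t powr (- 1)) * indicator {d..R} t
         + ennreal (N * m * t powr (- N - 1)) * indicator {R..} t \<partial>lborel)"
    unfolding nn_integral_polar_powr[OF N assms(1)]
  proof (rule nn_integral_mono)
    fix t :: real
    show "ennreal (N * t powr (- N - 1)) * indicator {0<..} t * emeasure lborel (A \<inter> {z. P z \<le> t})
      \<le> ennreal (N * \<kappa> * t powr (- 1)) * indicator {d..R} t
         + ennreal (N * m * t powr (- N - 1)) * indicator {R..} t"
    proof (cases "t < d")
      case True
      then have "A \<inter> {z. P z \<le> t} = {}" using assms(4) by force
      then show ?thesis by simp
    next
      case False
      show ?thesis
      proof (cases "t \<le> R")
        case True
        then show ?thesis
          using layer_le[of t N A] N False assms by (simp add: add_increasing2)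
      next
        case False
        have "emeasure lborel (A \<inter> {z. P z \<le> t}) \<le> ennreal m"
          using A(1) by (auto intro: order_trans[OF emeasure_mono])
        then have "ennreal (N * t powr (- N - 1)) * emeasure lborel (A \<inter> {z. P z \<le> t})
            \<le> ennreal (N * t powr (- N - 1)) * ennreal m"
          by (rule mult_left_mono) simp
        also have "\<dots> = ennreal (N * m * t powr (- N - 1))"
          using N by (subst ennreal_mult'[symmetric]) (auto simp: mult_ac)
        finally show ?thesis using False assms by auto
      qed
    qed
  qed
  also have "\<dots> = ennreal (N * \<kappa> * ln (R / d)) + ennreal (N * m * R powr (- N - 1 + 1) / (- (- N - 1) - 1))"
  proof (subst nn_integral_add)
    show "(\<integral>\<^sup>+t. ennreal (N * \<kappa> * t powr (- 1)) * indicator {d..R} t \<partial>lborel)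
        + (\<integral>\<^sup>+t. ennreal (N * m * t powr (- N - 1)) * indicator {R..} t \<partial>lborel)
      = ennreal (N * \<kappa> * ln (R / d)) + ennreal (N * m * R powr (- N - 1 + 1) / (- (- N - 1) - 1))"
      using assms N kappa_pos
      by (intro arg_cong2[where f = "(+)"] nn_integral_inverse_atLeastAtMost nn_integral_powr_atLeast) auto
  qed measurable
  also have "\<dots> = ennreal (N * \<kappa> * ln (R / d) + m * R powr (- N))"
    using assms kappa_pos N by (subst ennreal_plus[symmetric]) auto
  finally show ?thesis .
qed

end

section \<open>The Riesz potential bound\<close>

lemma grad_has_derivative:
  assumes "f differentiable (at x)"
  shows "(f has_derivative (\<lambda>v. grad f x \<bullet> v)) (at x)"
proof -
  let ?D = "frechet_derivative f (at x)"
  have D: "(f has_derivative ?D) (at x)"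
    using assms by (simp add: frechet_derivative_works)
  have lin: "linear ?D" using D has_derivative_linear by blast
  have "?D v = grad f x \<bullet> v" for v
  proof -
    have "?D v = ?D (\<Sum>i\<in>UNIV. v $ i *\<^sub>R axis i 1)" 
      using basis_expansion[of v] by (simp add: scalar_mult_eq_scaleR)
    also have "\<dots> = (\<Sum>i\<in>UNIV. v $ i *\<^sub>R ?D (axis i 1))"
      by (simp add: linear_sum[OF lin] linear_scale[OF lin])
    also have "\<dots> = grad f x \<bullet> v"
      by (simp add: grad_def partial_deriv_def inner_vec_def mult.commute)
    finally show ?thesis .
  qed
  then have "?D = (\<lambda>v. grad f x \<bullet> v)" by blast
  with D show ?thesis by simp
qed

lemma grad_eqI:
  assumes "(f has_derivative (\<lambda>v. g \<bullet> v)) (at x)"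
  shows "grad f x = g"
proof -
  have "frechet_derivative f (at x) = (\<lambda>v. g \<bullet> v)"
    using frechet_derivative_at[OF assms] by simp
  then show ?thesis by (simp add: grad_def partial_deriv_def vec_eq_iff inner_axis)
qed

lemma test_function_differentiable:
  assumes "test_function \<phi>"
  shows "\<phi> differentiable (at x)"
proof -
  have "C_k_on (Suc 0) UNIV \<phi>" using assms by (simp only: test_function_def)
  then show ?thesis by simp
qed

lemma test_function_continuous:
  assumes "test_function \<phi>"
  shows "continuous_on S \<phi>"
proof -
  have "C_k_on 0 UNIV \<phi>" using assms by (simp only: test_function_def)
  then show ?thesis using continuous_on_subset by auto
qed

lemma test_function_grad_continuous:
  assumes "test_function \<phi>"
  shows "continuous_on S (grad \<phi>)"
proof -
  have "C_k_on (Suc 0) UNIV \<phi>" using assms by (simp only: test_function_def)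
  then have "continuous_on UNIV (grad \<phi>)"
    unfolding grad_def by (intro continuous_on_vec_lambda) simp
  then show ?thesis using continuous_on_subset by blast
qed

lemma test_function_measurable:
  assumes "test_function \<phi>"
  shows "\<phi> \<in> borel_measurable borel" "grad \<phi> \<in> borel_measurable borel"
  using test_function_continuous[OF assms] test_function_grad_continuous[OF assms]
  by (auto intro: borel_measurable_continuous_onI)

lemma test_function_bounded_support:
  assumes "test_function \<phi>"
  obtains r where "r > 0" "\<And>x. norm x > r \<Longrightarrow> \<phi> x = 0"
proof -
  have "bounded (closure {x. \<phi> x \<noteq> 0})"
    using assms compact_imp_bounded by (auto simp: test_function_def)
  then obtain r where r: "\<And>x. x \<in> closure {x. \<phi> x \<noteq> 0} \<Longrightarrow> norm x \<le> r"
    unfolding bounded_iff by blast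
  show ?thesis
  proof (rule that[of "max r 1"])
    fix x :: "real^'a" assume *: "norm x > max r 1"
    show "\<phi> x = 0"
    proof (rule ccontr)
      assume "\<phi> x \<noteq> 0"
      then have "x \<in> closure {x. \<phi> x \<noteq> 0}" by (simp add: subsetD[OF closure_subset])
      with r[OF this] * show False by simp
    qed
  qed simp
qed

lemma abs_diff_le_nn_integral_deriv:
  fixes g g' :: "real \<Rightarrow> real"
  assumes "T \<ge> 0" and deriv: "\<And>t. t \<in> {0..T} \<Longrightarrow> (g has_real_derivative g' t) (at t)"
    and cont: "continuous_on {0..T} g'"
  shows "ennreal \<bar>g T - g 0\<bar> \<le> (\<integral>\<^sup>+t. indicator {0..T} t * ennreal \<bar>g' t\<bar> \<partial>lborel)"
proof -
  have 1: "(g' has_integral g T - g 0) {0..T}"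
    using assms by (intro fundamental_theorem_of_calculus)
      (auto simp flip: has_real_derivative_iff_has_vector_derivative intro: DERIV_subset)
  have 2: "(\<lambda>t. \<bar>g' t\<bar>) integrable_on {0..T}"
    by (intro integrable_continuous_real continuous_intros cont)
  have "\<bar>g T - g 0\<bar> \<le> integral {0..T} (\<lambda>t. \<bar>g' t\<bar>)"
    using integral_norm_bound_integral[of g' "{0..T}" "\<lambda>t. \<bar>g' t\<bar>"] 1 2
    by (auto simp: integral_unique)
  then have "ennreal \<bar>g T - g 0\<bar> \<le> ennreal (integral {0..T} (\<lambda>t. \<bar>g' t\<bar>))"
    by (simp add: ennreal_leI)
  also have "\<dots> = (\<integral>\<^sup>+t. ennreal (indicator {0..T} t * \<bar>g' t\<bar>) \<partial>lborel)"
    using nn_integral_has_integral_lebesgue[OF _ integrable_integral[OF 2]] by simp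
  finally show ?thesis by (simp add: ennreal_mult' ennreal_indicator)
qed

context anisotropic
begin

abbreviation energy :: "(real^'n \<Rightarrow> real) \<Rightarrow> ennreal" where
  "energy \<phi> \<equiv> (\<integral>\<^sup>+x. ennreal (F (grad \<phi> x) powr N) \<partial>lborel)"

text \<open>The cut-off confines the potential to a set of finite measure, which makes up for the
  kernel failing to be N/(N-1)-integrable at infinity.\<close>

definition supergrad :: "(real^'n \<Rightarrow> real) \<Rightarrow> real^'n \<Rightarrow> real" where
  "supergrad \<phi> x = (if \<bar>\<phi> x\<bar> > 1 then F (grad \<phi> x) else 0)"

lemma supergrad_nonneg [simp]: "supergrad \<phi> x \<ge> 0"
  by (simp add: supergrad_def)

lemma supergrad_measurable:
  assumes "test_function \<phi>"
  shows "supergrad \<phi> \<in> borel_measurable borel"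
proof -
  note [measurable] = test_function_measurable[OF assms]
  show ?thesis unfolding supergrad_def by measurable
qed

text \<open>Integration along the ray from \<open>x\<close> up to its first exit from \<open>{\<bar>\<phi>\<bar> > 1}\<close>.\<close>

lemma excess_le_ray_integral:
  assumes \<phi>: "test_function \<phi>" and "y \<noteq> 0" and x: "\<bar>\<phi> x\<bar> > 1"
  shows "ennreal (\<bar>\<phi> x\<bar> - 1) \<le>
    (\<integral>\<^sup>+t. ennreal (P y * supergrad \<phi> (x + t *\<^sub>R y)) * indicator {0<..} t \<partial>lborel)"
proof -
  define g where "g t = \<phi> (x + t *\<^sub>R y)" for t
  define g' where "g' t = grad \<phi> (x + t *\<^sub>R y) \<bullet> y" for t
  have deriv: "(g has_real_derivative g' t) (at t)" for t
  proof -
    have "((\<lambda>t. x + t *\<^sub>R y) has_derivative (\<lambda>s. s *\<^sub>R y)) (at t)"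
      by (auto intro!: derivative_eq_intros)
    from has_derivative_compose[OF this grad_has_derivative[OF test_function_differentiable[OF \<phi>]]]
    moreover have "(\<lambda>s. grad \<phi> (x + t *\<^sub>R y) \<bullet> (s *\<^sub>R y)) = (*) (g' t)"
      by (simp add: fun_eq_iff g'_def)
    ultimately show ?thesis
      by (simp add: g_def[abs_def] has_field_derivative_def)
  qed
  have cont_g: "continuous_on S g" for S
    using deriv by (intro continuous_at_imp_continuous_on) (auto intro: DERIV_isCont)
  have cont_g': "continuous_on S g'" for S
    unfolding g'_def
    by (intro continuous_intros continuous_on_compose2[OF test_function_grad_continuous[OF \<phi>, of UNIV]]) auto
  obtain r where r: "r > 0" "\<And>x. norm x > r \<Longrightarrow> \<phi> x = 0"
    using test_function_bounded_support[OF \<phi>] by blast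
  \<comment> \<open>Times at which the ray is outside the superlevel set. \<open>Z\<close> is
    closed, so its infimum is attained and is the first exit time.\<close>
  define Z where "Z = {t. t \<ge> 0 \<and> \<bar>g t\<bar> \<le> 1}"
  have "closed Z"
    unfolding Z_def by (intro closed_Collect_conj closed_Collect_le continuous_intros cont_g)
  moreover have "(norm x + r + 1) / norm y \<in> Z"
  proof -
    \<comment> \<open>Long enough to leave the support: the reverse triangle inequality puts x + s y
      at norm at least r + 1.\<close>
    define s where "s = (norm x + r + 1) / norm y"
    have "s \<ge> 0" using r by (simp add: s_def)
    have "norm (s *\<^sub>R y) \<le> norm (x + s *\<^sub>R y) + norm x"
      using norm_triangle_ineq4[of "x + s *\<^sub>R y" x] by simp
    moreover have "norm (s *\<^sub>R y) = norm x + r + 1"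
      using \<open>y \<noteq> 0\<close> r by (simp add: s_def)
    ultimately have "norm (x + s *\<^sub>R y) > r" by simp
    then show ?thesis using r(2) \<open>s \<ge> 0\<close> by (simp add: Z_def g_def flip: s_def)
  qed
  moreover have bdd: "bdd_below Z" by (auto simp: Z_def intro: bdd_belowI[of _ 0])
  ultimately have "Inf Z \<in> Z" using closed_contains_Inf by blast
  define T where "T = Inf Z"
  have T: "T \<ge> 0" "\<bar>g T\<bar> \<le> 1" using \<open>Inf Z \<in> Z\<close> by (auto simp: T_def Z_def)
  have below: "\<bar>g t\<bar> > 1" if "0 \<le> t" "t < T" for t
    using cInf_lower[OF _ bdd, of t] that by (force simp: T_def Z_def)
  have "ennreal (\<bar>\<phi> x\<bar> - 1) \<le> ennreal \<bar>g T - g 0\<bar>"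
    using T(2) by (intro ennreal_leI) (simp add: g_def)
  also have "\<dots> \<le> (\<integral>\<^sup>+t. indicator {0..T} t * ennreal \<bar>g' t\<bar> \<partial>lborel)"
    using T(1) deriv cont_g' by (rule abs_diff_le_nn_integral_deriv)
  also have "\<dots> \<le> (\<integral>\<^sup>+t. ennreal (P y * supergrad \<phi> (x + t *\<^sub>R y)) * indicator {0<..} t \<partial>lborel)"
  proof (rule nn_integral_mono_AE)
    \<comment> \<open>Both endpoints are dropped: the right-hand integrand vanishes at 0 because of
      the indicator, and at T because \<bar>g T\<bar> \<le> 1 makes \<open>supergrad\<close>
      zero.\<close>
    have "AE t in lborel. t \<noteq> 0 \<and> t \<noteq> T"
      using AE_lborel_singleton[of 0] AE_lborel_singleton[of T] by eventually_elim simp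
    then show "AE t in lborel. indicator {0..T} t * ennreal \<bar>g' t\<bar>
        \<le> ennreal (P y * supergrad \<phi> (x + t *\<^sub>R y)) * indicator {0<..} t"
    proof eventually_elim
      case (elim t)
      show ?case
      proof (cases "t \<in> {0<..<T}")
        case True
        have "\<bar>g' t\<bar> \<le> P y * F (grad \<phi> (x + t *\<^sub>R y))"
          using abs_inner_le_polar[of y "grad \<phi> (x + t *\<^sub>R y)"] by (simp add: g'_def inner_commute)
        then show ?thesis
          using True below[of t] by (auto simp: supergrad_def g_def indicator_def intro: ennreal_leI)
      qed (use elim in \<open>auto simp: indicator_def\<close>)
    qed
  qed
  finally show ?thesis .
qed

text \<open>The Riesz kernel of order one for the norm \<open>P\<close>, normalised to have integral
  exactly d over the polar ball of radius d.\<close>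

definition riesz :: "real^'n \<Rightarrow> real" where
  "riesz z = P z powr (1 - N) / (N * \<kappa>)"

lemma riesz_nonneg [simp]: "riesz z \<ge> 0"
  using N_ge_2 kappa_pos by (simp add: riesz_def)

lemma riesz_measurable [measurable]: "riesz \<in> borel_measurable borel"
  unfolding riesz_def by measurable

text \<open>Averaging the ray estimate over \<open>y \<in> W\<^sub>1\<close>.\<close>

lemma excess_le_riesz_potential:
  assumes \<phi>: "test_function \<phi>" and x: "\<bar>\<phi> x\<bar> > 1"
  shows "ennreal (\<bar>\<phi> x\<bar> - 1) \<le> (\<integral>\<^sup>+z. ennreal (riesz z * supergrad \<phi> (x + z)) \<partial>lborel)"
proof -
  note [measurable] = supergrad_measurable[OF \<phi>]
  let ?h = "supergrad \<phi>"
  let ?W = "{z. P z \<le> 1}"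
  have N: "N > 0" using N_ge_2 by simp
  have [measurable]: "Measurable.pred (borel \<Otimes>\<^sub>M borel) (\<lambda>x. P (fst x) \<le> snd x)"
    "Measurable.pred (borel \<Otimes>\<^sub>M borel) (\<lambda>x. P (snd x) \<le> fst x)" by measurable
  \<comment> \<open>Averaging over the solid ball avoids surface measure; its volume
    \<open>\<kappa>\<close> is divided out at the end.\<close>
  have "ennreal \<kappa> * ennreal (\<bar>\<phi> x\<bar> - 1) = (\<integral>\<^sup>+y. ennreal (\<bar>\<phi> x\<bar> - 1) * indicator ?W y \<partial>lborel)"
    by (simp add: nn_integral_cmult_indicator emeasure_polar_ball_1 mult.commute)
  also have "\<dots> \<le> (\<integral>\<^sup>+y. (\<integral>\<^sup>+t. ennreal (P y * ?h (x + t *\<^sub>R y)) * indicator {0<..} t * indicator ?W y \<partial>lborel) \<partial>lborel)"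
  proof (intro nn_integral_mono_AE eventually_mono[OF AE_lborel_singleton[of 0]])
    fix y :: "real^'n" assume "y \<noteq> 0"
    show "ennreal (\<bar>\<phi> x\<bar> - 1) * indicator ?W y \<le>
        (\<integral>\<^sup>+t. ennreal (P y * ?h (x + t *\<^sub>R y)) * indicator {0<..} t * indicator ?W y \<partial>lborel)"
      using excess_le_ray_integral[OF \<phi> \<open>y \<noteq> 0\<close> x]
      by (subst nn_integral_multc) (auto intro: mult_right_mono)
  qed
  also have "\<dots> = (\<integral>\<^sup>+t. (\<integral>\<^sup>+y. ennreal (P y * ?h (x + t *\<^sub>R y)) * indicator {0<..} t * indicator ?W y \<partial>lborel) \<partial>lborel)"
    by (rule lborel_pair.Fubini'[symmetric]) (simp add: case_prod_unfold cong: measurable_cong_sets)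
  \<comment> \<open>Substitution z = t y for fixed t: the Jacobian gives t powr (-N), and P y = P z
    / t one more factor 1 / t.\<close>
  also have "\<dots> = (\<integral>\<^sup>+t. (\<integral>\<^sup>+z. ennreal (t powr (- N - 1)) * indicator {0<..} t * indicator {z. P z \<le> t} z *
      ennreal (P z * ?h (x + z)) \<partial>lborel) \<partial>lborel)"
  proof (rule nn_integral_cong)
    fix t :: real
    show "(\<integral>\<^sup>+y. ennreal (P y * ?h (x + t *\<^sub>R y)) * indicator {0<..} t * indicator ?W y \<partial>lborel) =
      (\<integral>\<^sup>+z. ennreal (t powr (- N - 1)) * indicator {0<..} t * indicator {z. P z \<le> t} z * ennreal (P z * ?h (x + z)) \<partial>lborel)"
    proof (cases "t > 0")
      case True
      let ?f = "\<lambda>z. ennreal (t powr (- N - 1)) * indicator {z. P z \<le> t} z * ennreal (P z * ?h (x + z))"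
      have "(\<integral>\<^sup>+z. ?f z \<partial>lborel) = ennreal (\<bar>t\<bar> ^ DIM(real^'n)) * (\<integral>\<^sup>+y. ?f (0 + t *\<^sub>R y) \<partial>lborel)"
        using True by (intro nn_integral_lborel_affine) auto
      also have "\<dots> = (\<integral>\<^sup>+y. ennreal (t powr N) * ?f (t *\<^sub>R y) \<partial>lborel)"
        using True by (subst nn_integral_cmult) (auto simp: N_eq powr_realpow)
      also have "\<dots> = (\<integral>\<^sup>+y. ennreal (P y * ?h (x + t *\<^sub>R y)) * indicator ?W y \<partial>lborel)"
      proof (rule nn_integral_cong)
        fix y
        have "t powr N * (t powr (- N - 1) * (t * c)) = c" for c
          using True by (simp add: powr_diff powr_minus field_simps)
        then show "ennreal (t powr N) * ?f (t *\<^sub>R y) = ennreal (P y * ?h (x + t *\<^sub>R y)) * indicator ?W y"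
          using True by (auto simp: polar_scaleR indicator_def mult.assoc simp flip: ennreal_mult')
      qed
      finally show ?thesis using True by simp
    qed simp
  qed
  also have "\<dots> = (\<integral>\<^sup>+z. (\<integral>\<^sup>+t. ennreal (t powr (- N - 1)) * indicator {0<..} t * indicator {z. P z \<le> t} z *
      ennreal (P z * ?h (x + z)) \<partial>lborel) \<partial>lborel)"
    by (rule lborel_pair.Fubini'[symmetric])
       (simp add: indicator_def case_prod_unfold of_bool_def cong: measurable_cong_sets)
  \<comment> \<open>For fixed z only t \<ge> P z remains. The t-integral is P z powr (-N) / N, and
    the factor P z turns it into \<open>\<kappa> * riesz z\<close>.\<close>
  also have "\<dots> = (\<integral>\<^sup>+z. ennreal \<kappa> * ennreal (riesz z * ?h (x + z)) \<partial>lborel)"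
  proof (intro nn_integral_cong_AE eventually_mono[OF AE_lborel_singleton[of 0]])
    fix z :: "real^'n" assume "z \<noteq> 0"
    then have z: "P z > 0" by (rule polar_pos)
    have "(\<integral>\<^sup>+t. ennreal (t powr (- N - 1)) * indicator {0<..} t * indicator {z. P z \<le> t} z \<partial>lborel)
       = (\<integral>\<^sup>+t. ennreal (1 * t powr (- N - 1)) * indicator {P z..} t \<partial>lborel)"
      using z by (intro nn_integral_cong) (auto simp: indicator_def)
    also have "\<dots> = ennreal (1 * P z powr (- N - 1 + 1) / (- (- N - 1) - 1))"
      using z N by (intro nn_integral_powr_atLeast) auto
    finally have "(\<integral>\<^sup>+t. ennreal (t powr (- N - 1)) * indicator {0<..} t * indicator {z. P z \<le> t} z *
        ennreal (P z * ?h (x + z)) \<partial>lborel) = ennreal (P z powr (- N) / N) * ennreal (P z * ?h (x + z))"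
      by (subst nn_integral_multc) auto
    also have "\<dots> = ennreal (P z powr (- N) / N * (P z * ?h (x + z)))"
      using N by (simp flip: ennreal_mult')
    also have "P z powr (- N) / N * (P z * ?h (x + z)) = \<kappa> * (riesz z * ?h (x + z))"
      using z kappa_pos by (simp add: riesz_def powr_diff powr_minus field_simps)
    finally show "(\<integral>\<^sup>+t. ennreal (t powr (- N - 1)) * indicator {0<..} t * indicator {z. P z \<le> t} z *
        ennreal (P z * ?h (x + z)) \<partial>lborel) = ennreal \<kappa> * ennreal (riesz z * ?h (x + z))"
      using kappa_pos by (simp add: ennreal_mult')
  qed
  also have "\<dots> = ennreal \<kappa> * (\<integral>\<^sup>+z. ennreal (riesz z * ?h (x + z)) \<partial>lborel)"
    by (rule nn_integral_cmult) measurable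
  finally show ?thesis
    using kappa_pos by (subst (asm) ennreal_mult_le_mult_iff) auto
qed

end

section \<open>Far and near parts of the potential, and the measure of level sets\<close>

lemma ennreal_lincomb:
  assumes "a \<ge> 0" "b \<ge> 0" "x \<ge> 0" "y \<ge> 0"
  shows "ennreal (a * x + b * y) = ennreal a * ennreal x + ennreal b * ennreal y"
  using assms by (simp add: ennreal_mult' ennreal_plus)

lemma nn_integral_lincomb:
  assumes "f \<in> borel_measurable M" "g \<in> borel_measurable M"
  shows "(\<integral>\<^sup>+x. a * f x + b * g x \<partial>M) = a * (\<integral>\<^sup>+x. f x \<partial>M) + b * (\<integral>\<^sup>+x. g x \<partial>M)"
  using assms by (simp add: nn_integral_add nn_integral_cmult)

context anisotropic
begin

text \<open>The critical constant in the form in which it leaves Hoelder's inequality: (N \<kappa>)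
  powr (1/(N-1)) is the reciprocal of the logarithm's coefficient in the kernel integral, and the
  outer N comes from writing the target measure as the N-th power of a radius.\<close>

definition crit :: real where "crit = N * (N * \<kappa>) powr (1 / (N - 1))"

lemma crit_eq: "lambda_crit F = crit"
  using N_ge_2 kappa_pos
  by (simp add: lambda_crit_def crit_def Let_def powr_mult N_eq[symmetric] powr_add[symmetric] field_simps)
     (simp add: powr_add[symmetric] powr_mult_base field_simps)

lemma crit_pos: "crit > 0"
  using N_ge_2 kappa_pos by (simp add: crit_def)

lemma riesz_integral_ball:
  assumes "d > 0"
  shows "(\<integral>\<^sup>+z. ennreal (riesz z) * indicator {z. P z \<le> d} z \<partial>lborel) \<le> ennreal d"
proof -
  have "(\<integral>\<^sup>+z. ennreal (riesz z) * indicator {z. P z \<le> d} z \<partial>lborel)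
     = (\<integral>\<^sup>+z. ennreal (1 / (N * \<kappa>)) * (ennreal (P z powr (- (N - 1))) * indicator {z. P z \<le> d} z) \<partial>lborel)"
  proof (rule nn_integral_cong)
    fix z
    have "ennreal (riesz z) = ennreal (1 / (N * \<kappa>)) * ennreal (P z powr (- (N - 1)))"
      using N_ge_2 kappa_pos by (subst ennreal_mult'[symmetric]) (auto simp: riesz_def)
    then show "ennreal (riesz z) * indicator {z. P z \<le> d} z =
        ennreal (1 / (N * \<kappa>)) * (ennreal (P z powr (- (N - 1))) * indicator {z. P z \<le> d} z)"
      by (simp only: mult.assoc)
  qed
  also have "\<dots> = ennreal (1 / (N * \<kappa>)) * (\<integral>\<^sup>+z. ennreal (P z powr (- (N - 1))) * indicator {z. P z \<le> d} z \<partial>lborel)"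
    by (rule nn_integral_cmult) measurable
  also have "\<dots> \<le> ennreal (1 / (N * \<kappa>)) * ennreal (\<kappa> * N / (N - (N - 1)) * d powr (N - (N - 1)))"
    by (intro mult_left_mono nn_integral_polar_powr_ball) (use N_ge_2 assms in auto)
  also have "\<dots> = ennreal d"
    using N_ge_2 kappa_pos assms by (simp flip: ennreal_mult')
  finally show ?thesis .
qed

text \<open>Young's inequality with the parameter that turns it into Hoelder's inequality.\<close>

lemma riesz_potential_far:
  assumes \<phi>: "test_function \<phi>" and "0 < d" "d \<le> R" "\<sigma> > 0" "B > 0"
    and vol: "emeasure lborel (superlevel \<phi>) \<le> ennreal (R powr N)"
    and en: "energy \<phi> \<le> ennreal B"
    and small: "(N * \<kappa>) powr (- (N / (N - 1))) * (N * \<kappa> * ln (R / d) + 1) * B powr (1 / (N - 1)) \<le> \<sigma> powr (N / (N - 1))"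
  shows "(\<integral>\<^sup>+z. ennreal (riesz z * supergrad \<phi> (x + z)) * indicator {z. P z > d} z \<partial>lborel) \<le> ennreal \<sigma>"
proof -
  note [measurable] = supergrad_measurable[OF \<phi>] test_function_measurable[OF \<phi>]
  define N' where "N' = N / (N - 1)"
  have N: "N > 1" "N > 0" "N' > 1" "1 / N' + 1 / N = 1"
    using N_ge_2 by (auto simp: N'_def field_simps)
  \<comment> \<open>The weight that balances Young's inequality: the gradient term becomes exactly
    \<sigma> / N, and \<open>small\<close> brings the kernel term below \<sigma> / N'.\<close>
  define \<theta> where "\<theta> = (B / \<sigma>) powr (1 / N)"
  have \<theta>: "\<theta> > 0" using assms by (simp add: \<theta>_def)
  \<comment> \<open>Where the integrand can be nonzero. By translation invariance its volume is at
    most that of the superlevel set, for every x.\<close>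
  define A where "A = {z. P z > d \<and> \<bar>\<phi> (x + z)\<bar> > 1}"
  have [measurable]: "A \<in> sets borel" unfolding A_def by measurable
  define c where "c = \<theta> powr N' * (N * \<kappa>) powr (- N') / N'"
  have c: "c \<ge> 0" using N by (simp add: c_def)
  have "(\<integral>\<^sup>+z. ennreal (riesz z * supergrad \<phi> (x + z)) * indicator {z. P z > d} z \<partial>lborel)
    \<le> (\<integral>\<^sup>+z. ennreal c * (ennreal (P z powr (- N)) * indicator A z)
        + ennreal (\<theta> powr (- N) / N) * ennreal (F (grad \<phi> (x + z)) powr N) \<partial>lborel)"
  proof (rule nn_integral_mono)
    fix z
    show "ennreal (riesz z * supergrad \<phi> (x + z)) * indicator {z. P z > d} z \<le>
      ennreal c * (ennreal (P z powr (- N)) * indicator A z) + ennreal (\<theta> powr (- N) / N) * ennreal (F (grad \<phi> (x + z)) powr N)"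
    proof (cases "z \<in> A")
      case True
      then have Pz: "P z > 0" using assms by (simp add: A_def)
      let ?f = "F (grad \<phi> (x + z))"
      have "riesz z * ?f = (\<theta> * riesz z) * (?f / \<theta>)" using \<theta> by simp
      also have "\<dots> \<le> (\<theta> * riesz z) powr N' / N' + (?f / \<theta>) powr N / N"
        by (rule Youngs_inequality) (use N \<theta> in auto)
      also have "(\<theta> * riesz z) powr N' / N' = c * P z powr (- N)"
      proof -
        have "(1 - N) * N' = - N" using N by (simp add: N'_def divide_eq_eq algebra_simps)
        then have "(P z powr (1 - N)) powr N' = P z powr (- N)"
          by (simp add: powr_powr)
        then show ?thesis
          using \<theta> N kappa_pos by (simp add: riesz_def c_def powr_mult powr_divide powr_minus field_simps)
      qed
      also have "(?f / \<theta>) powr N / N = \<theta> powr (- N) / N * ?f powr N"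
        using \<theta> by (simp add: powr_divide powr_minus field_simps)
      finally have "ennreal (riesz z * ?f) \<le> ennreal (c * P z powr (- N) + \<theta> powr (- N) / N * ?f powr N)"
        by (rule ennreal_leI)
      also have "\<dots> = ennreal c * ennreal (P z powr (- N)) + ennreal (\<theta> powr (- N) / N) * ennreal (?f powr N)"
        using c N by (intro ennreal_lincomb) auto
      finally show ?thesis using True by (simp add: A_def supergrad_def)
    next
      case False
      then show ?thesis by (auto simp: A_def supergrad_def indicator_def)
    qed
  qed
  also have "\<dots> = ennreal c * (\<integral>\<^sup>+z. ennreal (P z powr (- N)) * indicator A z \<partial>lborel)
      + ennreal (\<theta> powr (- N) / N) * (\<integral>\<^sup>+z. ennreal (F (grad \<phi> (x + z)) powr N) \<partial>lborel)"
    by (rule nn_integral_lincomb) measurable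
  also have "(\<integral>\<^sup>+z. ennreal (F (grad \<phi> (x + z)) powr N) \<partial>lborel) = (\<integral>\<^sup>+z. ennreal (F (grad \<phi> z) powr N) \<partial>lborel)"
    by (rule nn_integral_lborel_translate[of "\<lambda>z. ennreal (F (grad \<phi> z) powr N)"]) measurable
  \<comment> \<open>Since the volume bound is R powr N, the tail beyond radius R contributes exactly
    the \<open>+ 1\<close> that appears in \<open>small\<close>.\<close>
  also have "ennreal c * (\<integral>\<^sup>+z. ennreal (P z powr (- N)) * indicator A z \<partial>lborel)
      + ennreal (\<theta> powr (- N) / N) * (\<integral>\<^sup>+z. ennreal (F (grad \<phi> z) powr N) \<partial>lborel)
    \<le> ennreal c * ennreal (N * \<kappa> * ln (R / d) + R powr N * R powr (- N)) + ennreal (\<theta> powr (- N) / N) * ennreal B"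
  proof (intro add_mono mult_left_mono nn_integral_polar_powr_critical en)
    have "emeasure lborel A \<le> emeasure lborel {z. \<bar>\<phi> (x + z)\<bar> > 1}"
      by (intro emeasure_mono) (auto simp: A_def)
    also have "\<dots> = (\<integral>\<^sup>+z. indicator (superlevel \<phi>) (x + z) \<partial>lborel)"
    proof -
      have "(\<integral>\<^sup>+z. indicator (superlevel \<phi>) (x + z) \<partial>lborel) = (\<integral>\<^sup>+z. indicator {z. \<bar>\<phi> (x + z)\<bar> > 1} z \<partial>lborel)"
        by (intro nn_integral_cong) (simp add: indicator_def)
      also have "\<dots> = emeasure lborel {z. \<bar>\<phi> (x + z)\<bar> > 1}"
        by (rule nn_integral_indicator) measurable
      finally show ?thesis by simp
    qed
    also have "\<dots> = emeasure lborel (superlevel \<phi>)"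
      by (subst nn_integral_lborel_translate) auto
    finally show "emeasure lborel A \<le> ennreal (R powr N)" using vol by simp
  qed (use assms in \<open>auto simp: A_def\<close>)
  also have "\<dots> = ennreal (c * (N * \<kappa> * ln (R / d) + 1) + \<theta> powr (- N) / N * B)"
  proof -
    have "R powr N * R powr (- N) = 1" using assms by (simp flip: powr_add)
    moreover have "N * \<kappa> * ln (R / d) + 1 \<ge> 0" using N kappa_pos assms by simp
    ultimately show ?thesis using c N assms by (simp flip: ennreal_mult' ennreal_plus)
  qed
  also have "\<dots> \<le> ennreal \<sigma>"
  proof (rule ennreal_leI)
    have "\<theta> powr N' = (B / \<sigma>) powr (1 / (N - 1))"
      using N by (simp add: \<theta>_def powr_powr N'_def)
    then have \<theta>': "\<theta> powr N' = B powr (1 / (N - 1)) * \<sigma> powr (- (1 / (N - 1)))"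
      using assms by (simp add: powr_divide powr_minus_divide)
    have "c * (N * \<kappa> * ln (R / d) + 1)
      = ((N * \<kappa>) powr (- N') * (N * \<kappa> * ln (R / d) + 1) * B powr (1 / (N - 1))) * \<sigma> powr (- (1 / (N - 1))) / N'"
      unfolding c_def \<theta>' by (simp add: mult_ac)
    also have "\<dots> \<le> \<sigma> powr N' * \<sigma> powr (- (1 / (N - 1))) / N'"
      using small N by (intro divide_right_mono mult_right_mono) (auto simp: N'_def)
    also have "\<sigma> powr N' * \<sigma> powr (- (1 / (N - 1))) = \<sigma>"
    proof -
      have "N' + - (1 / (N - 1)) = 1" using N by (simp add: N'_def flip: diff_divide_distrib)
      then show ?thesis using assms by (simp only: powr_add[symmetric]) simp
    qed
    finally have 1: "c * (N * \<kappa> * ln (R / d) + 1) \<le> \<sigma> * (1 / N')" by simp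
    have "\<theta> powr (- N) = (B / \<sigma>) powr (- 1)" using N by (simp add: \<theta>_def powr_powr)
    then have 2: "\<theta> powr (- N) / N * B = \<sigma> * (1 / N)"
      using assms by (simp add: powr_minus)
    have "\<sigma> * (1 / N') + \<sigma> * (1 / N) = \<sigma>"
      unfolding distrib_left[symmetric] N(4) by simp
    with 1 2 show "c * (N * \<kappa> * ln (R / d) + 1) + \<theta> powr (- N) / N * B \<le> \<sigma>"
      by linarith
  qed
  finally show ?thesis .
qed

text \<open>Truncation at height a: a number f \<ge> 0 satisfies f \<le> a + a powr (1-N) * f powr
  N. The first part costs a * d; the second is a convolution of the energy density with an
  integrable kernel, so its integral over x is easy to bound.\<close>

lemma riesz_potential_near:
  assumes \<phi>: "test_function \<phi>" and "d > 0" "a > 0"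
  shows "(\<integral>\<^sup>+z. ennreal (riesz z * supergrad \<phi> (x + z)) * indicator {z. P z \<le> d} z \<partial>lborel) \<le>
    ennreal (a * d) + ennreal (a powr (1 - N)) *
      (\<integral>\<^sup>+z. ennreal (riesz z) * indicator {z. P z \<le> d} z * ennreal (F (grad \<phi> (x + z)) powr N) \<partial>lborel)"
proof -
  note [measurable] = supergrad_measurable[OF \<phi>] test_function_measurable[OF \<phi>]
  have "(\<integral>\<^sup>+z. ennreal (riesz z * supergrad \<phi> (x + z)) * indicator {z. P z \<le> d} z \<partial>lborel) \<le>
    (\<integral>\<^sup>+z. ennreal a * (ennreal (riesz z) * indicator {z. P z \<le> d} z) + ennreal (a powr (1 - N)) *
      (ennreal (riesz z) * indicator {z. P z \<le> d} z * ennreal (F (grad \<phi> (x + z)) powr N)) \<partial>lborel)"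
  proof (rule nn_integral_mono)
    fix z
    let ?f = "F (grad \<phi> (x + z))"
    have "?f \<le> a + a powr (1 - N) * ?f powr N"
    proof (cases "?f \<le> a")
      case False
      then have "?f > 0" using \<open>a > 0\<close> by simp
      have "a powr (N - 1) \<le> ?f powr (N - 1)"
        using False N_ge_2 \<open>a > 0\<close> by (intro powr_mono2) auto
      then have "1 \<le> a powr (1 - N) * ?f powr (N - 1)"
        using mult_left_mono[of "a powr (N - 1)" "?f powr (N - 1)" "a powr (1 - N)"] \<open>a > 0\<close>
        by (simp flip: powr_add)
      then have "?f * 1 \<le> ?f * (a powr (1 - N) * ?f powr (N - 1))"
        by (intro mult_left_mono) auto
      also have "\<dots> = a powr (1 - N) * ?f powr N"
        using \<open>?f > 0\<close> by (simp add: powr_diff)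
      finally show ?thesis using \<open>a > 0\<close> by simp
    qed (use \<open>a > 0\<close> in \<open>simp add: add_increasing2\<close>)
    then have "riesz z * supergrad \<phi> (x + z) \<le> riesz z * (a + a powr (1 - N) * ?f powr N)"
      using \<open>a > 0\<close> by (intro mult_left_mono) (auto simp: supergrad_def)
    then have "ennreal (riesz z * supergrad \<phi> (x + z)) \<le> ennreal (a * riesz z + a powr (1 - N) * (riesz z * ?f powr N))"
      by (intro ennreal_leI) (simp add: algebra_simps)
    also have "\<dots> = ennreal a * ennreal (riesz z) + ennreal (a powr (1 - N)) * (ennreal (riesz z) * ennreal (?f powr N))"
      using \<open>a > 0\<close> by (simp add: ennreal_lincomb ennreal_mult')
    finally show "ennreal (riesz z * supergrad \<phi> (x + z)) * indicator {z. P z \<le> d} z \<le>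
      ennreal a * (ennreal (riesz z) * indicator {z. P z \<le> d} z) + ennreal (a powr (1 - N)) *
      (ennreal (riesz z) * indicator {z. P z \<le> d} z * ennreal (?f powr N))"
      by (auto simp: indicator_def)
  qed
  also have "\<dots> = ennreal a * (\<integral>\<^sup>+z. ennreal (riesz z) * indicator {z. P z \<le> d} z \<partial>lborel) + ennreal (a powr (1 - N)) *
      (\<integral>\<^sup>+z. ennreal (riesz z) * indicator {z. P z \<le> d} z * ennreal (F (grad \<phi> (x + z)) powr N) \<partial>lborel)"
    by (rule nn_integral_lincomb) measurable
  also have "ennreal a * (\<integral>\<^sup>+z. ennreal (riesz z) * indicator {z. P z \<le> d} z \<partial>lborel) \<le> ennreal a * ennreal d"
    by (intro mult_left_mono riesz_integral_ball assms) simp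
  finally show ?thesis using \<open>a > 0\<close> by (simp add: ennreal_mult' add_right_mono)
qed

text \<open>Of the excess \<tau>, the far potential supplies at most (1 - \<epsilon>) \<tau> and the
  constant part of the near potential \<epsilon> \<tau> / 2. The convolution part must supply the
  remaining \<epsilon> \<tau> / 2, and Markov's inequality limits where it can.\<close>

lemma emeasure_level_set:
  assumes \<phi>: "test_function \<phi>" and "0 < d" "d \<le> R" "0 < \<epsilon>" "\<epsilon> < 1" "B > 0" "\<tau> > 0"
    and vol: "emeasure lborel (superlevel \<phi>) \<le> ennreal (R powr N)"
    and en: "energy \<phi> \<le> ennreal B"
    and small: "(N * \<kappa>) powr (- (N / (N - 1))) * (N * \<kappa> * ln (R / d) + 1) * B powr (1 / (N - 1))
      \<le> ((1 - \<epsilon>) * \<tau>) powr (N / (N - 1))"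
  shows "emeasure lborel {x. \<bar>\<phi> x\<bar> > 1 + \<tau>} \<le> ennreal (B * (2 * d / (\<epsilon> * \<tau>)) powr N)"
proof -
  note [measurable] = supergrad_measurable[OF \<phi>] test_function_measurable[OF \<phi>]
  \<comment> \<open>Truncation height for which \<open>a * d\<close> is half of the share \<epsilon>
    \<tau> left to the near potential.\<close>
  define a where "a = \<epsilon> * \<tau> / (2 * d)"
  have a: "a > 0" using assms by (simp add: a_def)
  define G where "G x = (\<integral>\<^sup>+z. ennreal (riesz z) * indicator {z. P z \<le> d} z * ennreal (F (grad \<phi> (x + z)) powr N) \<partial>lborel)" for x
  have [measurable]: "G \<in> borel_measurable borel"
    unfolding G_def by measurable
  \<comment> \<open>Tonelli and translation invariance factor the integral of the convolution into
    kernel mass, at most d, times energy, at most B.\<close>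
  have "(\<integral>\<^sup>+x. G x \<partial>lborel) = (\<integral>\<^sup>+z. (\<integral>\<^sup>+x. ennreal (riesz z) * indicator {z. P z \<le> d} z * ennreal (F (grad \<phi> (x + z)) powr N) \<partial>lborel) \<partial>lborel)"
    unfolding G_def
    by (rule lborel_pair.Fubini'[symmetric]) (simp add: case_prod_unfold cong: measurable_cong_sets)
  also have "\<dots> = (\<integral>\<^sup>+z. ennreal (riesz z) * indicator {z. P z \<le> d} z * energy \<phi> \<partial>lborel)"
  proof (rule nn_integral_cong)
    fix z
    have "(\<integral>\<^sup>+x. ennreal (F (grad \<phi> (x + z)) powr N) \<partial>lborel) = energy \<phi>"
      using nn_integral_lborel_translate[of "\<lambda>x. ennreal (F (grad \<phi> x) powr N)" z] by (simp add: add.commute)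
    then show "(\<integral>\<^sup>+x. ennreal (riesz z) * indicator {z. P z \<le> d} z * ennreal (F (grad \<phi> (x + z)) powr N) \<partial>lborel) =
      ennreal (riesz z) * indicator {z. P z \<le> d} z * energy \<phi>"
      by (subst nn_integral_cmult) auto
  qed
  also have "\<dots> = (\<integral>\<^sup>+z. ennreal (riesz z) * indicator {z. P z \<le> d} z \<partial>lborel) * energy \<phi>"
    by (rule nn_integral_multc) measurable
  also have "\<dots> \<le> ennreal d * ennreal B"
    by (intro mult_mono riesz_integral_ball en assms) auto
  finally have G: "(\<integral>\<^sup>+x. G x \<partial>lborel) \<le> ennreal (d * B)" using assms by (simp add: ennreal_mult')
  define c where "c = a powr (1 - N) * (2 / (\<epsilon> * \<tau>))"
  have c: "c > 0" using assms a by (simp add: c_def)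
  have "{x. \<bar>\<phi> x\<bar> > 1 + \<tau>} \<subseteq> {x \<in> space lborel. 1 \<le> ennreal c * G x}"
  proof safe
    fix x assume x: "\<bar>\<phi> x\<bar> > 1 + \<tau>"
    show "x \<in> space lborel" by simp
    have "ennreal \<tau> \<le> ennreal (\<bar>\<phi> x\<bar> - 1)" using x by (intro ennreal_leI) simp
    also have "\<dots> \<le> (\<integral>\<^sup>+z. ennreal (riesz z * supergrad \<phi> (x + z)) \<partial>lborel)"
      using x assms by (intro excess_le_riesz_potential) auto
    also have "\<dots> = (\<integral>\<^sup>+z. ennreal (riesz z * supergrad \<phi> (x + z)) * indicator {z. P z > d} z
        + ennreal (riesz z * supergrad \<phi> (x + z)) * indicator {z. P z \<le> d} z \<partial>lborel)"
      by (intro nn_integral_cong) (auto simp: indicator_def)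
    also have "\<dots> = (\<integral>\<^sup>+z. ennreal (riesz z * supergrad \<phi> (x + z)) * indicator {z. P z > d} z \<partial>lborel)
        + (\<integral>\<^sup>+z. ennreal (riesz z * supergrad \<phi> (x + z)) * indicator {z. P z \<le> d} z \<partial>lborel)"
      by (rule nn_integral_add) measurable
    also have "\<dots> \<le> ennreal ((1 - \<epsilon>) * \<tau>) + (ennreal (a * d) + ennreal (a powr (1 - N)) * G x)"
      unfolding G_def using assms a
      by (intro add_mono riesz_potential_far[where R = R and B = B] riesz_potential_near) auto
    finally have le: "ennreal \<tau> \<le> ennreal ((1 - \<epsilon>) * \<tau>) + (ennreal (a * d) + ennreal (a powr (1 - N)) * G x)" .
    show "1 \<le> ennreal c * G x"
    proof (cases "G x")
      case (real g)
      have "ennreal \<tau> \<le> ennreal ((1 - \<epsilon>) * \<tau> + (a * d + a powr (1 - N) * g))"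
        using le real assms a by (simp flip: ennreal_mult' ennreal_plus)
      then have "\<tau> \<le> (1 - \<epsilon>) * \<tau> + (a * d + a powr (1 - N) * g)"
        using assms a real by (subst (asm) ennreal_le_iff) auto
      moreover have "a * d = \<epsilon> * \<tau> / 2" using assms by (simp add: a_def)
      ultimately have "\<epsilon> * \<tau> / 2 \<le> a powr (1 - N) * g" by (simp add: algebra_simps)
      then have "1 \<le> c * g" using assms by (simp add: c_def field_simps)
      then show ?thesis using real c by (simp flip: ennreal_mult')
    qed (use c in \<open>simp add: ennreal_mult_top\<close>)
  qed
  then have "emeasure lborel {x. \<bar>\<phi> x\<bar> > 1 + \<tau>} \<le> emeasure lborel {x \<in> space lborel. 1 \<le> ennreal c * G x}"
    by (intro emeasure_mono) auto
  also have "\<dots> \<le> ennreal c * (\<integral>\<^sup>+x. G x * indicator (space lborel) x \<partial>lborel)"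
    by (rule nn_integral_Markov_inequality) auto
  also have "\<dots> \<le> ennreal c * ennreal (d * B)"
    using G by (intro mult_left_mono) auto
  also have "\<dots> = ennreal (c * (d * B))" using c by (simp add: ennreal_mult')
  also have "c * (d * B) = B * (2 * d / (\<epsilon> * \<tau>)) powr N"
  proof -
    have "2 * d / (\<epsilon> * \<tau>) = 1 / a" by (simp add: a_def)
    moreover have "(1 / a) powr N = a powr (1 - N) * (1 / a)"
      using a by (simp add: powr_divide powr_diff field_simps)
    ultimately show ?thesis by (simp add: c_def a_def)
  qed
  finally show ?thesis .
qed

end

section \<open>Exponential integrability\<close>

lemma suminf_exp_tail:
  fixes t :: real
  shows "(\<Sum>j. t ^ (j + n) / fact (j + n)) = exp t - (\<Sum>j<n. t ^ j / fact j)"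
    and "summable (\<lambda>j. t ^ (j + n) / fact (j + n))"
proof -
  have s: "summable (\<lambda>j. t ^ j / fact j)"
    using summable_exp_generic[of t] by (simp add: divide_inverse mult.commute)
  have e: "exp t = (\<Sum>j. t ^ j / fact j)"
    by (simp add: exp_def divide_inverse mult.commute)
  show "summable (\<lambda>j. t ^ (j + n) / fact (j + n))"
    using summable_ignore_initial_segment[OF s, of n] .
  show "(\<Sum>j. t ^ (j + n) / fact (j + n)) = exp t - (\<Sum>j<n. t ^ j / fact j)"
    using suminf_split_initial_segment[OF s, of n] e by simp
qed

lemma infsum_exp_tail:
  fixes t :: real
  assumes "t \<ge> 0"
  shows "(\<Sum>\<^sub>\<infinity>j\<in>{n..}. t ^ j / fact j) = exp t - (\<Sum>j<n. t ^ j / fact j)"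
proof -
  have "(\<Sum>\<^sub>\<infinity>j\<in>{n..}. t ^ j / fact j) = (\<Sum>\<^sub>\<infinity>j\<in>(\<lambda>j. j + n) ` UNIV. t ^ j / fact j)"
    by (rule arg_cong[where f = "infsum _"]) (auto simp: image_def intro: le_Suc_ex[THEN exE] exI[of _ "_ - n"])
  also have "\<dots> = (\<Sum>\<^sub>\<infinity>j. t ^ (j + n) / fact (j + n))"
    by (subst infsum_reindex) (auto simp: o_def)
  also have "\<dots> = (\<Sum>j. t ^ (j + n) / fact (j + n))"
    using suminf_exp_tail(2)[of t n] assms
    by (intro infsumI norm_summable_imp_has_sum summable_sums) simp_all
  finally show ?thesis by (simp add: suminf_exp_tail)
qed

text \<open>Factoring out t^n leaves denominators at least \<open>fact j\<close>. The tail thus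
  vanishes to order n at 0 and grows no faster than t^n times the exponential.\<close>

lemma exp_tail_le:
  fixes t :: real
  assumes "t \<ge> 0"
  shows "exp t - (\<Sum>j<n. t ^ j / fact j) \<le> t ^ n * exp t"
proof -
  have s: "summable (\<lambda>j. t ^ j / fact j)"
    using suminf_exp_tail(2)[of t 0] by simp
  have "exp t - (\<Sum>j<n. t ^ j / fact j) = (\<Sum>j. t ^ (j + n) / fact (j + n))"
    by (simp add: suminf_exp_tail)
  also have "\<dots> \<le> (\<Sum>j. t ^ n * (t ^ j / fact j))"
  proof (rule suminf_le)
    fix j
    have "t ^ (j + n) / fact (j + n) \<le> t ^ (j + n) / fact j"
      using assms by (intro divide_left_mono fact_mono) auto
    then show "t ^ (j + n) / fact (j + n) \<le> t ^ n * (t ^ j / fact j)"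
      by (simp add: power_add mult_ac)
  qed (use suminf_exp_tail(2) summable_mult[OF s, of "t ^ n"] in auto)
  also have "\<dots> = t ^ n * exp t"
    using suminf_mult[OF s, of "t ^ n"] suminf_exp_tail(1)[of t 0] by simp
  finally show ?thesis .
qed

lemma exp_tail_nonneg:
  fixes t :: real
  assumes "t \<ge> 0"
  shows "0 \<le> exp t - (\<Sum>j<n. t ^ j / fact j)"
  unfolding suminf_exp_tail(1)[symmetric] using assms
  by (intro suminf_nonneg suminf_exp_tail(2)) auto

text \<open>Both index sets are final segments of the naturals, and 0 is not in them because the
  threshold is positive. The product j * (N/(N-1)) is the order to which \<Phi>(v^(N/(N-1)))
  vanishes at v = 0; its comparison with q (1 - \<beta>/N) is what later gives integrability where u
  is small.\<close>

lemma Phi_eq_exp_tail: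
  assumes "N > 1" "q > 0" "0 \<le> \<beta>" "\<beta> < N"
  obtains j where "j \<ge> 1"
    "\<And>t. t \<ge> 0 \<Longrightarrow> Phi N q \<beta> t = exp t - (\<Sum>i<j. t ^ i / fact i)"
    "\<beta> > 0 \<Longrightarrow> real j * (N / (N - 1)) > q * (1 - \<beta> / N)"
    "\<beta> = 0 \<Longrightarrow> real j * (N / (N - 1)) \<ge> q"
proof -
  define x where "x = q * (N - 1) / N * (1 - \<beta> / N)"
  have x: "x > 0" "x * (N / (N - 1)) = q * (1 - \<beta> / N)" using assms by (simp_all add: x_def)
  define S where "S = (if \<beta> > 0 then {j. real j > x} else {j. real j \<ge> x})"
  \<comment> \<open>First admissible index: the floor plus one for the strict threshold, the ceiling
    for the non-strict one. They differ when x is an integer.\<close>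
  define j where "j = (if \<beta> > 0 then nat (\<lfloor>x\<rfloor> + 1) else nat \<lceil>x\<rceil>)"
  have S: "S = {j..}"
    unfolding S_def j_def by (auto simp: nat_le_iff) linarith+
  have j: "j \<in> S" "0 \<notin> S" using x by (simp add: S, simp add: S_def)
  have le: "real j * (N / (N - 1)) \<ge> x * (N / (N - 1))" if "real j \<ge> x"
    using that assms by (intro mult_right_mono) auto
  have less: "real j * (N / (N - 1)) > x * (N / (N - 1))" if "real j > x"
    using that assms by (intro mult_strict_right_mono) auto
  show ?thesis
  proof (rule that[of j])
    show "j \<ge> 1" using j by (metis less_one not_le)
    show "Phi N q \<beta> t = exp t - (\<Sum>i<j. t ^ i / fact i)" if "t \<ge> 0" for t
    proof -
      have "Phi N q \<beta> t = (\<Sum>\<^sub>\<infinity>j\<in>S. t ^ j / fact j)"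
        using assms unfolding Phi_def S_def x_def by (cases "\<beta> > 0") auto
      then show ?thesis using infsum_exp_tail[OF that] S by simp
    qed
    show "real j * (N / (N - 1)) > q * (1 - \<beta> / N)" if "\<beta> > 0"
      using less j(1) that x(2) by (simp add: S_def)
    show "real j * (N / (N - 1)) \<ge> q" if "\<beta> = 0"
      using le j(1) that x(2) by (simp add: S_def)
  qed
qed

text \<open>A superlinear exponent absorbs the shift between consecutive integer layers.\<close>

lemma summable_exp_shifted_powr:
  fixes \<mu> \<nu> p :: real
  assumes "0 \<le> \<mu>" "\<mu> < \<nu>" "p > 1"
  shows "summable (\<lambda>k::nat. exp (\<mu> * (real k + 2) powr p - \<nu> * real k powr p))"
proof -
  define c where "c = (\<nu> - \<mu>) / 2"
  have c: "c > 0" using assms by (simp add: c_def)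
  have "(\<lambda>k::nat. \<mu> * ((real k + 2) / real k) powr p) \<longlonglongrightarrow> \<mu> * 1 powr p"
    by (intro tendsto_intros) (real_asymp, simp)
  then have "\<forall>\<^sub>F k in sequentially. \<mu> * ((real k + 2) / real k) powr p < (\<mu> + \<nu>) / 2"
    using assms by (intro order_tendstoD) auto
  then have "\<forall>\<^sub>F k in sequentially. norm (exp (\<mu> * (real k + 2) powr p - \<nu> * real k powr p)) \<le> exp (- c) ^ k"
    using eventually_ge_at_top[of 1]
  proof eventually_elim
    case (elim k)
    have k: "real k \<ge> 1" using elim by simp
    have "\<mu> * (real k + 2) powr p = \<mu> * ((real k + 2) / real k) powr p * real k powr p"
      using k by (simp add: powr_divide)
    also have "\<dots> \<le> (\<mu> + \<nu>) / 2 * real k powr p"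
      using elim by (intro mult_right_mono) auto
    finally have "\<mu> * (real k + 2) powr p - \<nu> * real k powr p \<le> - c * real k powr p"
      by (simp add: c_def algebra_simps add_divide_distrib diff_divide_distrib)
    also have "\<dots> \<le> - c * real k"
    proof -
      have "real k powr 1 \<le> real k powr p" using k assms by (intro powr_mono) auto
      then show ?thesis using c k by simp
    qed
    finally have "exp (\<mu> * (real k + 2) powr p - \<nu> * real k powr p) \<le> exp (- c * real k)" by simp
    also have "\<dots> = exp (- c) ^ k" by (simp add: exp_of_nat_mult[symmetric] mult.commute)
    finally show ?case by simp
  qed
  then show ?thesis
    by (rule summable_comparison_test_ev) (use c in \<open>auto intro: summable_geometric\<close>)
qed

text \<open>On the layer 1 + k < \<bar>u\<bar> \<le> k + 2 the integrand is at most its value at k +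
  2, while the measure decays at rate \<nu> in k. The mismatch of two between these arguments is
  harmless because \<mu> < \<nu>.\<close>

lemma nn_integral_exp_powr_le:
  fixes u :: "'a \<Rightarrow> real" and \<mu> \<nu> p m C :: real
  assumes [measurable]: "u \<in> borel_measurable M"
    and "0 \<le> \<mu>" "\<mu> < \<nu>" "p > 1" "C \<ge> 0" "m \<ge> 0"
    and decay: "\<And>\<tau>. \<tau> \<ge> 0 \<Longrightarrow> emeasure M {x \<in> space M. \<bar>u x\<bar> > 1 + \<tau>} \<le> ennreal (C * m * exp (- \<nu> * \<tau> powr p))"
  shows "(\<integral>\<^sup>+x. ennreal (exp (\<mu> * \<bar>u x\<bar> powr p)) * indicator {x. \<bar>u x\<bar> > 1} x \<partial>M)
    \<le> ennreal (C * (\<Sum>k. exp (\<mu> * (real k + 2) powr p - \<nu> * real k powr p)) * m)"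
proof -
  let ?L = "\<lambda>k::nat. {x \<in> space M. \<bar>u x\<bar> > 1 + real k}"
  have "(\<integral>\<^sup>+x. ennreal (exp (\<mu> * \<bar>u x\<bar> powr p)) * indicator {x. \<bar>u x\<bar> > 1} x \<partial>M)
    \<le> (\<integral>\<^sup>+x. (\<Sum>k. ennreal (exp (\<mu> * (real k + 2) powr p)) * indicator (?L k) x) \<partial>M)"
  proof (rule nn_integral_mono)
    fix x assume x: "x \<in> space M"
    show "ennreal (exp (\<mu> * \<bar>u x\<bar> powr p)) * indicator {x. \<bar>u x\<bar> > 1} x \<le>
      (\<Sum>k. ennreal (exp (\<mu> * (real k + 2) powr p)) * indicator (?L k) x)"
    proof (cases "\<bar>u x\<bar> > 1")
      case True
      define f where "f k = ennreal (exp (\<mu> * (real k + 2) powr p)) * indicator (?L k) x" for k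
      \<comment> \<open>Subtracting 2 from the ceiling, rather than rounding down, gives the strict
        inequality 1 + k < \<bar>u x\<bar> even at integer values.\<close>
      define k where "k = nat (\<lceil>\<bar>u x\<bar>\<rceil> - 2)"
      have "\<lceil>\<bar>u x\<bar>\<rceil> \<ge> 2" using True by linarith
      then have k: "\<bar>u x\<bar> > 1 + real k" "\<bar>u x\<bar> \<le> real k + 2"
        unfolding k_def by linarith+
      have "\<mu> * \<bar>u x\<bar> powr p \<le> \<mu> * (real k + 2) powr p"
        using k assms by (intro mult_left_mono powr_mono2) auto
      then have "ennreal (exp (\<mu> * \<bar>u x\<bar> powr p)) * indicator {x. \<bar>u x\<bar> > 1} x
        \<le> sum f {k}"
        using True k x by (simp add: f_def ennreal_leI)
      also have "\<dots> \<le> suminf f"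
        by (rule sum_le_suminf) auto
      also have "suminf f = (\<Sum>k. ennreal (exp (\<mu> * (real k + 2) powr p)) * indicator (?L k) x)"
        unfolding f_def ..
      finally show ?thesis .
    qed simp
  qed
  also have "\<dots> = (\<Sum>k. ennreal (exp (\<mu> * (real k + 2) powr p)) * emeasure M (?L k))"
    by (subst nn_integral_suminf) (auto simp: nn_integral_cmult)
  also have "\<dots> \<le> (\<Sum>k. ennreal (C * m * exp (\<mu> * (real k + 2) powr p - \<nu> * real k powr p)))"
  proof (rule suminf_le)
    fix k :: nat
    have "ennreal (exp (\<mu> * (real k + 2) powr p)) * emeasure M (?L k)
      \<le> ennreal (exp (\<mu> * (real k + 2) powr p)) * ennreal (C * m * exp (- \<nu> * real k powr p))"
      by (intro mult_left_mono decay) auto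
    also have "\<dots> = ennreal (C * m * exp (\<mu> * (real k + 2) powr p - \<nu> * real k powr p))"
      by (subst ennreal_mult'[symmetric]) (auto simp: exp_diff exp_minus field_simps)
    finally show "ennreal (exp (\<mu> * (real k + 2) powr p)) * emeasure M (?L k)
      \<le> ennreal (C * m * exp (\<mu> * (real k + 2) powr p - \<nu> * real k powr p))" .
  qed auto
  also have "\<dots> = ennreal (\<Sum>k. C * m * exp (\<mu> * (real k + 2) powr p - \<nu> * real k powr p))"
    using assms by (intro suminf_ennreal2 summable_mult summable_exp_shifted_powr) auto
  also have "(\<Sum>k. C * m * exp (\<mu> * (real k + 2) powr p - \<nu> * real k powr p))
    = C * m * (\<Sum>k. exp (\<mu> * (real k + 2) powr p - \<nu> * real k powr p))"
    using assms by (intro suminf_mult summable_exp_shifted_powr) auto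
  finally show ?thesis by (simp add: mult_ac)
qed

section \<open>Decay of level sets and the exponential integral of test functions\<close>

context anisotropic
begin

text \<open>The gap between \<nu> and \<open>crit\<close> pays for three losses: an energy budget
  above 1, the share of the level conceded to the near potential, and the additive constant next to
  the logarithm.\<close>

lemma level_set_decay:
  assumes "0 < \<nu>" "\<nu> < crit"
  obtains B C where "B > 1" "C > 0"
    "\<And>\<phi> (m::real) (\<tau>::real). test_function \<phi> \<Longrightarrow> m > 0 \<Longrightarrow> \<tau> \<ge> 0 \<Longrightarrow>
      emeasure lborel (superlevel \<phi>) \<le> ennreal m \<Longrightarrow>
      energy \<phi> \<le> ennreal B \<Longrightarrow>
      emeasure lborel {x. \<bar>\<phi> x\<bar> > 1 + \<tau>} \<le> ennreal (C * m * exp (- \<nu> * \<tau> powr (N / (N - 1))))"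
proof -
  define N' where "N' = N / (N - 1)"
  have N: "N > 1" "N > 0" "N' > 1" using N_ge_2 by (auto simp: N'_def field_simps)
  \<comment> \<open>The limit as \<epsilon> tends to 0 is 1 - \<nu> / crit > 0. One small \<epsilon>
    therefore serves both as conceded share of the level and as excess energy, with a margin \<eta>
    to spare.\<close>
  have "((\<lambda>\<epsilon>. (1 - \<epsilon>) powr N' - (1 + \<epsilon>) powr (1 / (N - 1)) * (\<nu> / crit)) \<longlongrightarrow>
      (1 - 0) powr N' - (1 + 0) powr (1 / (N - 1)) * (\<nu> / crit)) (at_right 0)"
    by (intro tendsto_intros) auto
  moreover have "(1 - 0) powr N' - (1 + 0) powr (1 / (N - 1)) * (\<nu> / crit) > 0"
    using assms crit_pos by simp
  ultimately have "\<forall>\<^sub>F \<epsilon> in at_right 0. (1 - \<epsilon>) powr N' - (1 + \<epsilon>) powr (1 / (N - 1)) * (\<nu> / crit) > 0"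
    by (rule order_tendstoD)
  moreover have "\<forall>\<^sub>F \<epsilon> in at_right 0. \<epsilon> \<in> {0<..<1::real}"
    by (rule eventually_at_right_real) simp
  ultimately have "\<forall>\<^sub>F \<epsilon> in at_right 0. \<epsilon> \<in> {0<..<1::real} \<and>
      (1 - \<epsilon>) powr N' - (1 + \<epsilon>) powr (1 / (N - 1)) * (\<nu> / crit) > 0"
    by eventually_elim simp
  then obtain \<epsilon> where \<epsilon>: "0 < \<epsilon>" "\<epsilon> < 1"
    and \<eta>0: "(1 - \<epsilon>) powr N' - (1 + \<epsilon>) powr (1 / (N - 1)) * (\<nu> / crit) > 0"
    using eventually_happens[of _ "at_right (0::real)"] by force
  define B where "B = 1 + \<epsilon>"
  define \<eta> where "\<eta> = (1 - \<epsilon>) powr N' - B powr (1 / (N - 1)) * (\<nu> / crit)"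
  have \<eta>: "\<eta> > 0" using \<eta>0 by (simp add: \<eta>_def B_def)
  define c0 where "c0 = (N * \<kappa>) powr (- N') * B powr (1 / (N - 1))"
  \<comment> \<open>From \<tau>0 on, the additive constant c0 is absorbed by the margin \<eta>
    \<tau> powr N'. Below \<tau>0 the trivial bound by m is enough, which explains the first summand
    of \<open>C\<close>.\<close>
  define \<tau>0 where "\<tau>0 = max 1 ((c0 / \<eta>) powr (1 / N'))"
  define C where "C = exp (\<nu> * \<tau>0 powr N') + B * (2 / \<epsilon>) powr N"
  have C: "C > 0" using \<epsilon> by (simp add: C_def B_def add_pos_nonneg)
  show ?thesis
  proof (rule that[of B C])
    fix \<phi> :: "real^'n \<Rightarrow> real" and m \<tau> :: real
    assume \<phi>: "test_function \<phi>" and m: "m > 0" and "\<tau> \<ge> 0"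
      and vol: "emeasure lborel (superlevel \<phi>) \<le> ennreal m"
      and en: "energy \<phi> \<le> ennreal B"
    note [measurable] = test_function_measurable[OF \<phi>]
    show "emeasure lborel {x. \<bar>\<phi> x\<bar> > 1 + \<tau>} \<le> ennreal (C * m * exp (- \<nu> * \<tau> powr (N / (N - 1))))"
      unfolding N'_def[symmetric]
    proof (cases "\<tau> \<ge> \<tau>0")
      case False
      have "emeasure lborel {x. \<bar>\<phi> x\<bar> > 1 + \<tau>} \<le> emeasure lborel (superlevel \<phi>)"
        using \<open>\<tau> \<ge> 0\<close> by (intro emeasure_mono) auto
      also note vol
      also have "ennreal m \<le> ennreal (C * m * exp (- \<nu> * \<tau> powr N'))"
      proof (rule ennreal_leI)
        have "\<nu> * \<tau> powr N' \<le> \<nu> * \<tau>0 powr N'"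
          using False \<open>\<tau> \<ge> 0\<close> assms N by (intro mult_left_mono powr_mono2) auto
        then have "1 \<le> exp (\<nu> * \<tau>0 powr N') * exp (- \<nu> * \<tau> powr N')"
          by (simp flip: exp_add)
        also have "\<dots> \<le> C * exp (- \<nu> * \<tau> powr N')"
          using \<epsilon> by (intro mult_right_mono) (auto simp: C_def B_def)
        finally show "m \<le> C * m * exp (- \<nu> * \<tau> powr N')"
          using mult_left_mono[of 1 "C * exp (- \<nu> * \<tau> powr N')" m] m by (simp add: mult_ac)
      qed
      finally show "emeasure lborel {x. \<bar>\<phi> x\<bar> > 1 + \<tau>} \<le> ennreal (C * m * exp (- \<nu> * \<tau> powr N'))" .
    next
      case True
      then have \<tau>: "\<tau> \<ge> 1" by (simp add: \<tau>0_def)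
      define R where "R = m powr (1 / N)"
      have R: "R > 0" "R powr N = m" using m N by (auto simp: R_def powr_powr)
      \<comment> \<open>Chosen so that d powr N is the target measure m * exp (-\<nu> \<tau> powr
        N').\<close>
      define d where "d = R * exp (- (\<nu> / N) * \<tau> powr N')"
      have d: "d > 0" "d \<le> R" "ln (R / d) = (\<nu> / N) * \<tau> powr N'"
      proof -
        have "0 \<le> (\<nu> / N) * \<tau> powr N'" using N assms by simp
        then show "d > 0" "d \<le> R" using R by (auto simp: d_def)
        have "R / d = exp ((\<nu> / N) * \<tau> powr N')" using R by (simp add: d_def exp_minus divide_inverse)
        then show "ln (R / d) = (\<nu> / N) * \<tau> powr N'" by simp
      qed
      have "emeasure lborel {x. \<bar>\<phi> x\<bar> > 1 + \<tau>} \<le> ennreal (B * (2 * d / (\<epsilon> * \<tau>)) powr N)"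
      proof (rule emeasure_level_set[OF \<phi> d(1,2) \<epsilon>])
        \<comment> \<open>Here the critical constant emerges: Hoelder's coefficient times \<nu> / N
          is \<nu> / crit.\<close>
        have *: "(N * \<kappa>) powr (- N') * (N * \<kappa>) * (\<nu> / N) = \<nu> / crit"
        proof -
          have "- N' + 1 = - (1 / (N - 1))" using N by (simp add: N'_def field_simps)
          then have "(N * \<kappa>) powr (- N') * (N * \<kappa>) powr 1 = (N * \<kappa>) powr (- (1 / (N - 1)))"
            by (simp only: powr_add[symmetric])
          then show ?thesis
            using N kappa_pos by (simp add: crit_def powr_minus_divide)
        qed
        have "c0 \<le> \<eta> * \<tau> powr N'"
        proof -
          have "(c0 / \<eta>) powr (1 / N') \<le> \<tau>" using True by (simp add: \<tau>0_def)
          then have "((c0 / \<eta>) powr (1 / N')) powr N' \<le> \<tau> powr N'" using N by (intro powr_mono2) auto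
          then have "c0 / \<eta> \<le> \<tau> powr N'" using N \<eta> by (simp add: powr_powr c0_def B_def)
          then show ?thesis using \<eta> by (simp add: field_simps)
        qed
        have "(N * \<kappa>) powr (- N') * (N * \<kappa> * ln (R / d) + 1) * B powr (1 / (N - 1))
          = ((N * \<kappa>) powr (- N') * (N * \<kappa>) * (\<nu> / N)) * \<tau> powr N' * B powr (1 / (N - 1)) + c0"
          unfolding d(3) c0_def by (simp add: algebra_simps)
        also have "\<dots> \<le> \<nu> / crit * \<tau> powr N' * B powr (1 / (N - 1)) + \<eta> * \<tau> powr N'"
          unfolding * using \<open>c0 \<le> \<eta> * \<tau> powr N'\<close> by simp
        also have "\<dots> = (1 - \<epsilon>) powr N' * \<tau> powr N'"
          by (simp add: \<eta>_def algebra_simps)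
        also have "\<dots> = ((1 - \<epsilon>) * \<tau>) powr N'"
          using \<epsilon> \<tau> by (simp add: powr_mult)
        finally show "(N * \<kappa>) powr (- (N / (N - 1))) * (N * \<kappa> * ln (R / d) + 1) * B powr (1 / (N - 1))
           \<le> ((1 - \<epsilon>) * \<tau>) powr (N / (N - 1))" by (simp only: N'_def)
      qed (use vol en R \<tau> \<epsilon> in \<open>auto simp: B_def\<close>)
      also have "\<dots> \<le> ennreal (C * m * exp (- \<nu> * \<tau> powr N'))"
      proof (rule ennreal_leI)
        have "2 * d / (\<epsilon> * \<tau>) \<le> 2 / \<epsilon> * d"
          using d \<epsilon> \<tau> by (simp add: field_simps)
        then have "(2 * d / (\<epsilon> * \<tau>)) powr N \<le> (2 / \<epsilon> * d) powr N"
          using d \<epsilon> \<tau> N by (intro powr_mono2) auto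
        also have "\<dots> = (2 / \<epsilon>) powr N * (m * exp (- \<nu> * \<tau> powr N'))"
        proof -
          have "d powr N = m * exp (- \<nu> * \<tau> powr N')"
            using R N by (simp add: d_def powr_mult exp_powr_real)
          then show ?thesis using d \<epsilon> by (subst powr_mult) auto
        qed
        finally have "B * (2 * d / (\<epsilon> * \<tau>)) powr N \<le> B * ((2 / \<epsilon>) powr N * (m * exp (- \<nu> * \<tau> powr N')))"
          using \<epsilon> by (intro mult_left_mono) (auto simp: B_def)
        also have "\<dots> = (B * (2 / \<epsilon>) powr N) * (m * exp (- \<nu> * \<tau> powr N'))" by simp
        also have "\<dots> \<le> C * (m * exp (- \<nu> * \<tau> powr N'))"
          using m by (intro mult_right_mono) (auto simp: C_def)
        finally show "B * (2 * d / (\<epsilon> * \<tau>)) powr N \<le> C * m * exp (- \<nu> * \<tau> powr N')"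
          by (simp add: mult_ac)
      qed
      finally show "emeasure lborel {x. \<bar>\<phi> x\<bar> > 1 + \<tau>} \<le> ennreal (C * m * exp (- \<nu> * \<tau> powr N'))" .
    qed
  qed (use \<epsilon> C in \<open>auto simp: B_def\<close>)
qed

text \<open>A rate \<nu> strictly between \<mu> and \<open>crit\<close> still governs the level
  sets, and decay at rate \<nu> beats growth at rate \<mu> in the layer sum. Linearity in m survives
  because the decay estimate has it.\<close>

lemma exponential_integral:
  assumes "0 \<le> \<mu>" "\<mu> < crit"
  obtains B K where "B > 1" "K \<ge> 0"
    "\<And>\<phi> (m::real). test_function \<phi> \<Longrightarrow> m > 0 \<Longrightarrow>
      emeasure lborel (superlevel \<phi>) \<le> ennreal m \<Longrightarrow>
      energy \<phi> \<le> ennreal B \<Longrightarrow>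
      (\<integral>\<^sup>+x. ennreal (exp (\<mu> * \<bar>\<phi> x\<bar> powr (N / (N - 1)))) * indicator (superlevel \<phi>) x \<partial>lborel)
        \<le> ennreal (K * m)"
proof -
  define p where "p = N / (N - 1)"
  have p: "p > 1" using N_ge_2 by (simp add: p_def)
  obtain \<nu> where \<nu>: "\<mu> < \<nu>" "\<nu> < crit" using assms dense by blast
  then have "0 < \<nu>" using assms by simp
  obtain B C where BC: "B > 1" "C > 0"
    "\<And>\<phi> (m::real) (\<tau>::real). test_function \<phi> \<Longrightarrow> m > 0 \<Longrightarrow> \<tau> \<ge> 0 \<Longrightarrow>
      emeasure lborel (superlevel \<phi>) \<le> ennreal m \<Longrightarrow>
      energy \<phi> \<le> ennreal B \<Longrightarrow>
      emeasure lborel {x. \<bar>\<phi> x\<bar> > 1 + \<tau>} \<le> ennreal (C * m * exp (- \<nu> * \<tau> powr p))"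
    using level_set_decay[OF \<open>0 < \<nu>\<close> \<nu>(2)] unfolding p_def by blast
  let ?K = "C * (\<Sum>k. exp (\<mu> * (real k + 2) powr p - \<nu> * real k powr p))"
  have "?K \<ge> 0"
    using BC assms \<nu> p by (intro mult_nonneg_nonneg suminf_nonneg summable_exp_shifted_powr) auto
  moreover have "(\<integral>\<^sup>+x. ennreal (exp (\<mu> * \<bar>\<phi> x\<bar> powr p)) * indicator (superlevel \<phi>) x \<partial>lborel) \<le> ennreal (?K * m)"
    if "test_function \<phi>" "m > 0" "emeasure lborel (superlevel \<phi>) \<le> ennreal m"
      "energy \<phi> \<le> ennreal B" for \<phi> m
    using BC(3)[OF that(1,2) _ that(3,4)] that assms \<nu> p BC test_function_measurable[OF that(1)]
    by (intro nn_integral_exp_powr_le) auto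
  ultimately show ?thesis using that[of B ?K] BC(1) unfolding p_def by blast
qed

end

section \<open>Bounds for test functions, including the singular weight\<close>

lemma mult_le_powr_add_powr:
  fixes a b p q :: real
  assumes "p > 1" "q > 1" "1 / p + 1 / q = 1" "a \<ge> 0" "b \<ge> 0"
  shows "a * b \<le> a powr p + b powr q"
proof -
  have "a * b \<le> a powr p / p + b powr q / q" by (rule Youngs_inequality) (use assms in auto)
  also have "\<dots> \<le> a powr p + b powr q"
    using divide_left_mono[of 1 p "a powr p"] divide_left_mono[of 1 q "b powr q"] assms by simp
  finally show ?thesis .
qed

context anisotropic
begin

text \<open>For v \<le> 1 the first retained power of the series dominates up to a constant, with p
  = j * (N/(N-1)); in general the tail is at most the whole exponential.\<close>

lemma Phi_bounds:
  assumes "0 \<le> \<beta>" "\<beta> < N" "q > 0" "c \<ge> 0"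
  obtains A p where "A \<ge> 1" "p > 0" "\<beta> > 0 \<Longrightarrow> p > q * (1 - \<beta> / N)" "\<beta> = 0 \<Longrightarrow> p \<ge> q"
    "\<And>v. 0 \<le> v \<Longrightarrow> v \<le> 1 \<Longrightarrow> Phi N q \<beta> (c * v powr (N / (N - 1))) \<le> A * v powr p"
    "\<And>v. 0 \<le> v \<Longrightarrow> Phi N q \<beta> (c * v powr (N / (N - 1))) \<le> exp (c * v powr (N / (N - 1)))"
    "\<And>v. 0 \<le> v \<Longrightarrow> 0 \<le> Phi N q \<beta> (c * v powr (N / (N - 1)))"
proof -
  have N: "N > 1" using N_ge_2 by simp
  obtain j where j: "j \<ge> 1"
    "\<And>t. t \<ge> 0 \<Longrightarrow> Phi N q \<beta> t = exp t - (\<Sum>i<j. t ^ i / fact i)"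
    "\<beta> > 0 \<Longrightarrow> real j * (N / (N - 1)) > q * (1 - \<beta> / N)"
    "\<beta> = 0 \<Longrightarrow> real j * (N / (N - 1)) \<ge> q"
    using Phi_eq_exp_tail[OF N \<open>q > 0\<close> assms(1,2)] by blast
  let ?p = "real j * (N / (N - 1))"
  show ?thesis
  \<comment> \<open>The maximum with 1 lets the same constant also cover the region v > 1, where the
    exponential bound has coefficient 1.\<close>
  proof (rule that[of "max 1 (c ^ j * exp c)" ?p])
    fix v :: real assume v: "0 \<le> v"
    let ?t = "c * v powr (N / (N - 1))"
    have t: "?t \<ge> 0" using assms by simp
    show "Phi N q \<beta> ?t \<le> exp ?t"
      using j(2)[OF t] sum_nonneg[of "{..<j}" "\<lambda>i. ?t ^ i / fact i"] t by simp
    show "0 \<le> Phi N q \<beta> ?t"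
      using j(2)[OF t] exp_tail_nonneg[OF t, of j] by simp
    assume v1: "v \<le> 1"
    have "v powr (N / (N - 1)) \<le> 1" using v v1 N powr_mono2[of "N / (N - 1)" v 1] by simp
    then have "?t \<le> c" using mult_left_mono[of "v powr (N / (N - 1))" 1 c] assms by simp
    have "Phi N q \<beta> ?t \<le> ?t ^ j * exp ?t" using j(2)[OF t] exp_tail_le[OF t, of j] by simp
    also have "\<dots> \<le> ?t ^ j * exp c" using \<open>?t \<le> c\<close> t by (intro mult_left_mono) auto
    also have "?t ^ j = c ^ j * v powr ?p"
    \<comment> \<open>At v = 0 both sides are 0, which relies on j \<ge> 1 since 0^0 = 1.\<close>
    proof (cases "v = 0")
      case True then show ?thesis using j(1) N by (simp add: power_0_left)
    next
      case False
      then have "v powr ?p = (v powr (N / (N - 1))) ^ j"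
        using v by (simp add: powr_powr mult.commute flip: powr_realpow)
      then show ?thesis by (simp add: power_mult_distrib)
    qed
    finally have "Phi N q \<beta> ?t \<le> (c ^ j * exp c) * v powr ?p" by (simp add: mult_ac)
    also have "\<dots> \<le> max 1 (c ^ j * exp c) * v powr ?p" by (intro mult_right_mono) auto
    finally show "Phi N q \<beta> ?t \<le> max 1 (c ^ j * exp c) * v powr ?p" .
  qed (use j N in auto)
qed

text \<open>
  Young's inequality decouples the weight from \<open>u\<close>: on \<open>{\<bar>u\<bar> \<le> 1}\<close> the weight is raised to a
  power integrable at infinity, on \<open>{\<bar>u\<bar> > 1}\<close> to one integrable at the origin.
\<close>

lemma Phi_weight_pointwise:
  assumes "0 < \<beta>" "\<beta> < N" "q > 0" "0 \<le> \<Lambda>" "\<Lambda> < crit"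
  obtains A b1 b2 \<mu> where "A \<ge> 0" "b1 > N" "0 < b2" "b2 < N" "0 \<le> \<mu>" "\<mu> < crit"
    "\<And>v w R. v \<ge> 0 \<Longrightarrow> w > 0 \<Longrightarrow> R > 0 \<Longrightarrow>
      Phi N q \<beta> (\<Lambda> * (1 - \<beta> / N) * v powr (N / (N - 1))) / w powr \<beta> \<le>
      A * (w powr (- \<beta>) * indicat_real {..R} w + R powr (- \<beta>) *
        (v powr q + R powr b1 * (w powr (- b1) * indicat_real {R<..} w)
        + exp (\<mu> * v powr (N / (N - 1))) * indicat_real {1<..} v + R powr b2 * (w powr (- b2) * indicat_real {..R} w)))"
proof -
  have N: "N > 1" using N_ge_2 by simp
  define \<gamma> where "\<gamma> = 1 - \<beta> / N"
  have \<gamma>: "0 < \<gamma>" "\<gamma> < 1" using assms N by (auto simp: \<gamma>_def)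
  let ?N' = "N / (N - 1)"
  have "\<Lambda> * \<gamma> \<ge> 0" using assms \<gamma> by simp
  then obtain A p where A: "A \<ge> 1" "p > 0" "\<beta> > 0 \<Longrightarrow> p > q * (1 - \<beta> / N)"
    "\<And>v. 0 \<le> v \<Longrightarrow> v \<le> 1 \<Longrightarrow> Phi N q \<beta> (\<Lambda> * \<gamma> * v powr ?N') \<le> A * v powr p"
    "\<And>v. 0 \<le> v \<Longrightarrow> Phi N q \<beta> (\<Lambda> * \<gamma> * v powr ?N') \<le> exp (\<Lambda> * \<gamma> * v powr ?N')"
    using Phi_bounds[of \<beta> q "\<Lambda> * \<gamma>"] assms by (metis less_imp_le)
  have "p > q * \<gamma>" using A(3) assms by (simp add: \<gamma>_def)
  moreover have "q > q * \<gamma>" using \<gamma> assms by simp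
  \<comment> \<open>The strict inequality p > q \<gamma> leaves room for p0. Below q, it admits q /
    p0 as a Young exponent; above q \<gamma>, the conjugate s1 satisfies \<beta> s1 > N, so the
    weight is integrable at infinity.\<close>
  ultimately obtain p0 where p0: "q * \<gamma> < p0" "p0 < min p q"
    using dense[of "q * \<gamma>" "min p q"] by auto
  have "p0 > 0" using p0 \<gamma> assms by (meson less_trans mult_pos_pos)
  define s1 where "s1 = q / (q - p0)"
  have s1: "s1 > 1" "q / p0 > 1" "1 / (q / p0) + 1 / s1 = 1"
    using p0 \<open>p0 > 0\<close> by (auto simp: s1_def field_simps)
  have b1: "\<beta> * s1 > N"
  proof -
    have "q - p0 < q * (\<beta> / N)" using p0 by (simp add: \<gamma>_def algebra_simps)
    then have "N * (q - p0) < q * \<beta>" using N by (simp add: field_simps)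
    then show ?thesis using p0 by (simp add: s1_def field_simps)
  qed
  obtain \<mu> where \<mu>: "\<Lambda> < \<mu>" "\<mu> < crit" using assms dense by blast
  \<comment> \<open>An enlargement factor that keeps \<open>k * \<Lambda>\<close> subcritical. The
    case \<Lambda> = 0 is separate because \<mu> / \<Lambda> would be a division by zero.\<close>
  obtain k where k: "k > 1" "k * \<Lambda> < crit"
  proof (cases "\<Lambda> = 0")
    case True then show ?thesis using that[of 2] crit_pos by simp
  next
    case False
    then have "\<mu> / \<Lambda> > 1" "\<mu> / \<Lambda> * \<Lambda> < crit" using \<mu> assms by auto
    then show ?thesis using that by blast
  qed
  \<comment> \<open>Raising exp (\<Lambda> \<gamma> v powr N') to the power s2 replaces \<Lambda>
    \<gamma> by k \<Lambda>. As s2 > 1 / \<gamma>, the conjugate exponent t2 satisfies \<beta> t2 <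
    N, so the weight stays integrable at the origin.\<close>
  define s2 where "s2 = k / \<gamma>"
  have s2: "s2 > 1" using k \<gamma> by (simp add: s2_def field_simps)
  define t2 where "t2 = s2 / (s2 - 1)"
  have t2: "t2 > 1" "1 / s2 + 1 / t2 = 1" using s2 by (auto simp: t2_def field_simps)
  have b2: "\<beta> * t2 < N"
  proof -
    have "s2 * \<gamma> > 1" using k \<gamma> by (simp add: s2_def)
    then have "s2 * (N - \<beta>) > N" using N by (simp add: \<gamma>_def field_simps)
    then have "\<beta> * s2 < N * (s2 - 1)" by (simp add: algebra_simps)
    then show ?thesis using s2 by (simp add: t2_def field_simps)
  qed
  show ?thesis
  proof (rule that[of A "\<beta> * s1" "\<beta> * t2" "k * \<Lambda>"])
    fix v w R :: real assume vw: "v \<ge> 0" "w > 0" "R > 0"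
    define I1 where "I1 = w powr (- \<beta>) * indicat_real {..R} w"
    define I2 where "I2 = R powr (\<beta> * s1) * (w powr (- (\<beta> * s1)) * indicat_real {R<..} w)"
    define I3 where "I3 = exp (k * \<Lambda> * v powr ?N') * indicat_real {1<..} v"
    define I4 where "I4 = R powr (\<beta> * t2) * (w powr (- (\<beta> * t2)) * indicat_real {..R} w)"
    have nn: "0 \<le> I1" "0 \<le> I2" "0 \<le> I3" "0 \<le> I4" "0 \<le> v powr q"
      by (simp_all add: I1_def I2_def I3_def I4_def)
    \<comment> \<open>Young's inequality is applied to the dimensionless R / w, so that after
      integration all terms scale by the same power of R.\<close>
    have scale: "w powr (- \<beta>) = R powr (- \<beta>) * (R / w) powr \<beta>"
      using vw by (simp add: powr_divide powr_minus field_simps)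
    have pw: "((R / w) powr \<beta>) powr s = R powr (\<beta> * s) * w powr (- (\<beta> * s))" for s
      using vw by (simp add: powr_powr powr_divide powr_minus field_simps)
    have "Phi N q \<beta> (\<Lambda> * \<gamma> * v powr ?N') * w powr (- \<beta>) \<le> A * (I1 + R powr (- \<beta>) * (v powr q + I2 + I3 + I4))"
    proof (cases "v \<le> 1")
      case True
      have le: "Phi N q \<beta> (\<Lambda> * \<gamma> * v powr ?N') \<le> A * v powr p" using A(4) vw True by blast
      have 1: "Phi N q \<beta> (\<Lambda> * \<gamma> * v powr ?N') * w powr (- \<beta>) \<le> A * (v powr p * w powr (- \<beta>))"
        using mult_right_mono[OF le, of "w powr (- \<beta>)"] by (simp add: mult.assoc)
      have "v powr p * w powr (- \<beta>) \<le> I1 + R powr (- \<beta>) * (v powr q + I2 + I3 + I4)"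
      proof (cases "w \<le> R")
        case True
        have "v powr p \<le> 1" using \<open>v \<le> 1\<close> vw A(2) powr_mono2[of p v 1] by simp
        then have "v powr p * w powr (- \<beta>) \<le> I1"
          using True mult_right_mono[of "v powr p" 1 "w powr (- \<beta>)"] by (simp add: I1_def)
        also have "\<dots> \<le> I1 + R powr (- \<beta>) * (v powr q + I2 + I3 + I4)" using nn by simp
        finally show ?thesis .
      next
        case False
        have "v powr p \<le> v powr p0" using True vw p0 \<open>p0 > 0\<close> by (cases "v = 0") (auto intro: powr_mono')
        then have "v powr p * w powr (- \<beta>) \<le> v powr p0 * (R powr (- \<beta>) * (R / w) powr \<beta>)"
          unfolding scale by (intro mult_right_mono) auto
        also have "\<dots> = R powr (- \<beta>) * (v powr p0 * (R / w) powr \<beta>)" by simp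
        also have "v powr p0 * (R / w) powr \<beta> \<le> (v powr p0) powr (q / p0) + ((R / w) powr \<beta>) powr s1"
          by (rule mult_le_powr_add_powr) (use s1 in auto)
        also have "(v powr p0) powr (q / p0) = v powr q"
          using \<open>p0 > 0\<close> by (simp add: powr_powr)
        also have "((R / w) powr \<beta>) powr s1 = I2" using False by (simp add: I2_def pw)
        finally have "v powr p * w powr (- \<beta>) \<le> R powr (- \<beta>) * (v powr q + I2)"
          by (simp add: mult_left_mono)
        also have "\<dots> \<le> R powr (- \<beta>) * (v powr q + I2 + I3 + I4)"
          using nn by (intro mult_left_mono) auto
        also have "\<dots> \<le> I1 + R powr (- \<beta>) * (v powr q + I2 + I3 + I4)" using nn by simp
        finally show ?thesis .
      qed
      then have "A * (v powr p * w powr (- \<beta>)) \<le> A * (I1 + R powr (- \<beta>) * (v powr q + I2 + I3 + I4))"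
        using A(1) by (intro mult_left_mono) auto
      with 1 show ?thesis by linarith
    next
      case False
      let ?e = "exp (\<Lambda> * \<gamma> * v powr ?N')"
      have e: "?e powr s2 = I3"
        using False \<gamma> by (simp add: I3_def exp_powr_real s2_def mult_ac)
      have e1: "?e \<ge> 1" using assms \<gamma> by simp
      have "Phi N q \<beta> (\<Lambda> * \<gamma> * v powr ?N') * w powr (- \<beta>) \<le> ?e * w powr (- \<beta>)"
        using A(5)[OF vw(1)] by (intro mult_right_mono) auto
      also have "\<dots> = R powr (- \<beta>) * (?e * (R / w) powr \<beta>)" by (simp add: scale)
      also have "\<dots> \<le> R powr (- \<beta>) * (I3 + I4)"
      proof (intro mult_left_mono)
        show "?e * (R / w) powr \<beta> \<le> I3 + I4"
        proof (cases "w \<le> R")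
          case True
          have "?e * (R / w) powr \<beta> \<le> ?e powr s2 + ((R / w) powr \<beta>) powr t2"
            by (rule mult_le_powr_add_powr) (use s2 t2 in auto)
          then show ?thesis unfolding e using True by (simp add: I4_def pw)
        next
          case False
          have "(R / w) powr \<beta> \<le> 1" using False vw assms powr_mono2[of \<beta> "R / w" 1] by simp
          then have "?e * (R / w) powr \<beta> \<le> ?e" using mult_left_mono[of _ 1 ?e] by simp
          also have "?e \<le> ?e powr s2" using powr_mono[of 1 s2 ?e] e1 s2 by simp
          finally show ?thesis using e nn by simp
        qed
      qed simp
      also have "\<dots> \<le> R powr (- \<beta>) * (v powr q + I2 + I3 + I4)"
        using nn by (intro mult_left_mono) auto
      also have "\<dots> \<le> I1 + R powr (- \<beta>) * (v powr q + I2 + I3 + I4)" using nn by simp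
      also have "\<dots> \<le> A * (I1 + R powr (- \<beta>) * (v powr q + I2 + I3 + I4))"
        using A(1) nn by (intro mult_right_mono[of 1 A, simplified]) auto
      finally show ?thesis .
    qed
    then show "Phi N q \<beta> (\<Lambda> * (1 - \<beta> / N) * v powr ?N') / w powr \<beta> \<le>
      A * (w powr (- \<beta>) * indicat_real {..R} w + R powr (- \<beta>) *
        (v powr q + R powr (\<beta> * s1) * (w powr (- (\<beta> * s1)) * indicat_real {R<..} w)
        + exp (k * \<Lambda> * v powr ?N') * indicat_real {1<..} v
        + R powr (\<beta> * t2) * (w powr (- (\<beta> * t2)) * indicat_real {..R} w)))"
      unfolding I1_def I2_def I3_def I4_def \<gamma>_def by (simp add: powr_minus_divide)
  qed (use A b1 b2 k t2 assms in auto)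
qed

lemma emeasure_superlevel_le:
  assumes [measurable]: "\<phi> \<in> borel_measurable borel" and "q > 0"
    and le: "(\<integral>\<^sup>+x. ennreal (\<bar>\<phi> x\<bar> powr q) \<partial>lborel) \<le> ennreal m"
  shows "emeasure lborel (superlevel \<phi>) \<le> ennreal m"
proof -
  have "emeasure lborel (superlevel \<phi>) = (\<integral>\<^sup>+x. indicator (superlevel \<phi>) x \<partial>lborel)"
    by (rule nn_integral_indicator[symmetric]) measurable
  also have "\<dots> \<le> (\<integral>\<^sup>+x. ennreal (\<bar>\<phi> x\<bar> powr q) \<partial>lborel)"
    using \<open>q > 0\<close> by (intro nn_integral_mono) (auto simp: indicator_def ge_one_powr_ge_zero)
  finally show ?thesis using le by simp
qed

lemma test_function_bound_weighted:
  assumes "0 < \<beta>" "\<beta> < N" "q > 0" "0 \<le> \<Lambda>" "\<Lambda> < crit"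
  obtains B K where "B > 1" "K \<ge> 0"
    "\<And>\<phi> (m::real). test_function \<phi> \<Longrightarrow> m > 0 \<Longrightarrow>
      (\<integral>\<^sup>+x. ennreal (\<bar>\<phi> x\<bar> powr q) \<partial>lborel) \<le> ennreal m \<Longrightarrow>
      energy \<phi> \<le> ennreal B \<Longrightarrow>
      (\<integral>\<^sup>+x. ennreal (Phi N q \<beta> (\<Lambda> * (1 - \<beta> / N) * \<bar>\<phi> x\<bar> powr (N / (N - 1))) / P x powr \<beta>) \<partial>lborel)
        \<le> ennreal (K * m powr (1 - \<beta> / N))"
proof -
  have N: "N > 1" using N_ge_2 by simp
  obtain A b1 b2 \<mu> where A: "A \<ge> 0" "b1 > N" "0 < b2" "b2 < N" "0 \<le> \<mu>" "\<mu> < crit"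
    and pointwise: "\<And>v w R. v \<ge> 0 \<Longrightarrow> w > 0 \<Longrightarrow> R > 0 \<Longrightarrow>
      Phi N q \<beta> (\<Lambda> * (1 - \<beta> / N) * v powr (N / (N - 1))) / w powr \<beta> \<le>
      A * (w powr (- \<beta>) * indicat_real {..R} w + R powr (- \<beta>) *
        (v powr q + R powr b1 * (w powr (- b1) * indicat_real {R<..} w)
        + exp (\<mu> * v powr (N / (N - 1))) * indicat_real {1<..} v + R powr b2 * (w powr (- b2) * indicat_real {..R} w)))"
    using Phi_weight_pointwise[OF assms] by blast
  obtain B K where BK: "B > 1" "K \<ge> 0"
    and expint: "\<And>\<phi> (m::real). test_function \<phi> \<Longrightarrow> m > 0 \<Longrightarrow>
      emeasure lborel (superlevel \<phi>) \<le> ennreal m \<Longrightarrow>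
      energy \<phi> \<le> ennreal B \<Longrightarrow>
      (\<integral>\<^sup>+x. ennreal (exp (\<mu> * \<bar>\<phi> x\<bar> powr (N / (N - 1)))) * indicator (superlevel \<phi>) x \<partial>lborel)
        \<le> ennreal (K * m)"
    using exponential_integral[OF A(5,6)] by blast
  define C0 where "C0 = \<kappa> * N / (N - \<beta>)"
  define C1 where "C1 = \<kappa> * b1 / (b1 - N)"
  define C2 where "C2 = \<kappa> * N / (N - b2)"
  have C: "C0 \<ge> 0" "C1 \<ge> 0" "C2 \<ge> 0" using A assms N kappa_pos by (auto simp: C0_def C1_def C2_def)
  show ?thesis
  proof (rule that[of B "A * (C0 + 1 + C1 + K + C2)"])
    fix \<phi> :: "real^'n \<Rightarrow> real" and m :: real
    assume \<phi>: "test_function \<phi>" and m: "m > 0"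
      and Lq: "(\<integral>\<^sup>+x. ennreal (\<bar>\<phi> x\<bar> powr q) \<partial>lborel) \<le> ennreal m"
      and en: "energy \<phi> \<le> ennreal B"
    note [measurable] = test_function_measurable[OF \<phi>]
    have vol: "emeasure lborel (superlevel \<phi>) \<le> ennreal m"
      using Lq assms by (intro emeasure_superlevel_le[of \<phi> q]) auto
    \<comment> \<open>The radius with R powr N = m. Each of the five terms then scales like R powr
      (N - \<beta>) = m powr (1 - \<beta>/N), the power by which the quotient is normalised.\<close>
    define R where "R = m powr (1 / N)"
    have R: "R > 0" "R powr N = m" using m N by (auto simp: R_def powr_powr)
    let ?f = "\<lambda>x. ennreal (Phi N q \<beta> (\<Lambda> * (1 - \<beta> / N) * \<bar>\<phi> x\<bar> powr (N / (N - 1))) / P x powr \<beta>)"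
    let ?i1 = "\<lambda>x. ennreal (P x powr (- \<beta>)) * indicator {z. P z \<le> R} x"
    let ?i2 = "\<lambda>x. ennreal (\<bar>\<phi> x\<bar> powr q)"
    let ?i3 = "\<lambda>x. ennreal (P x powr (- b1)) * indicator {z. P z > R} x"
    let ?i4 = "\<lambda>x. ennreal (exp (\<mu> * \<bar>\<phi> x\<bar> powr (N / (N - 1)))) * indicator (superlevel \<phi>) x"
    let ?i5 = "\<lambda>x. ennreal (P x powr (- b2)) * indicator {z. P z \<le> R} x"
    have "(\<integral>\<^sup>+x. ?f x \<partial>lborel) \<le> (\<integral>\<^sup>+x. ennreal A * (?i1 x + ennreal (R powr (- \<beta>)) *
        (?i2 x + ennreal (R powr b1) * ?i3 x + ?i4 x + ennreal (R powr b2) * ?i5 x)) \<partial>lborel)"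
    proof (intro nn_integral_mono_AE eventually_mono[OF AE_lborel_singleton[of 0]])
      fix x :: "real^'n" assume "x \<noteq> 0"
      then have w: "P x > 0" by (rule polar_pos)
      have ind: "ennreal c * indicator {z. P z \<le> R} x = ennreal (c * indicat_real {..R} (P x))"
        "ennreal c * indicator {z. P z > R} x = ennreal (c * indicat_real {R<..} (P x))"
        "ennreal c * indicator (superlevel \<phi>) x = ennreal (c * indicat_real {1<..} \<bar>\<phi> x\<bar>)" for c
        by (auto simp: indicator_def)
      show "?f x \<le> ennreal A * (?i1 x + ennreal (R powr (- \<beta>)) *
        (?i2 x + ennreal (R powr b1) * ?i3 x + ?i4 x + ennreal (R powr b2) * ?i5 x))"
        unfolding ind using ennreal_leI[OF pointwise[OF abs_ge_zero w R(1), of "\<phi> x"]] A(1)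
        by (simp add: ennreal_mult' ennreal_plus)
    qed
    also have "\<dots> = ennreal A * ((\<integral>\<^sup>+x. ?i1 x \<partial>lborel) + ennreal (R powr (- \<beta>)) *
        ((\<integral>\<^sup>+x. ?i2 x \<partial>lborel) + ennreal (R powr b1) * (\<integral>\<^sup>+x. ?i3 x \<partial>lborel) + (\<integral>\<^sup>+x. ?i4 x \<partial>lborel)
        + ennreal (R powr b2) * (\<integral>\<^sup>+x. ?i5 x \<partial>lborel)))"
      by (simp add: nn_integral_add nn_integral_cmult)
    also have "\<dots> \<le> ennreal A * (ennreal (C0 * R powr (N - \<beta>)) + ennreal (R powr (- \<beta>)) *
        (ennreal m + ennreal (R powr b1) * ennreal (C1 * R powr (N - b1)) + ennreal (K * m)
        + ennreal (R powr b2) * ennreal (C2 * R powr (N - b2))))"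
      unfolding C0_def C1_def C2_def
      by (intro add_mono mult_left_mono nn_integral_polar_powr_ball nn_integral_polar_powr_exterior
          expint[OF \<phi> m vol en] Lq) (use A assms R in auto)
    also have "\<dots> = ennreal (A * (C0 * R powr (N - \<beta>) + R powr (- \<beta>) *
        (m + R powr b1 * (C1 * R powr (N - b1)) + K * m + R powr b2 * (C2 * R powr (N - b2)))))"
      using A C BK m by (simp add: ennreal_mult' ennreal_plus)
    also have "A * (C0 * R powr (N - \<beta>) + R powr (- \<beta>) *
        (m + R powr b1 * (C1 * R powr (N - b1)) + K * m + R powr b2 * (C2 * R powr (N - b2))))
      = A * (C0 + 1 + C1 + K + C2) * m powr (1 - \<beta> / N)"
    proof -
      have 1: "R powr b * R powr (N - b) = m" for b
        unfolding powr_add[symmetric] using R by simp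
      have 2: "R powr (N - \<beta>) = m powr (1 - \<beta> / N)" "R powr (- \<beta>) * m = m powr (1 - \<beta> / N)"
      proof -
        show "R powr (N - \<beta>) = m powr (1 - \<beta> / N)"
          using N by (simp add: R_def powr_powr diff_divide_distrib)
        moreover have "R powr (- \<beta>) * m = R powr (N - \<beta>)"
          unfolding R(2)[symmetric] powr_add[symmetric] by simp
        ultimately show "R powr (- \<beta>) * m = m powr (1 - \<beta> / N)" by simp
      qed
      have 3: "R powr b * (c * R powr (N - b)) = c * m" for b c
        unfolding 1[of b, symmetric] by (simp add: mult_ac)
      have "A * (C0 * R powr (N - \<beta>) + R powr (- \<beta>) *
        (m + R powr b1 * (C1 * R powr (N - b1)) + K * m + R powr b2 * (C2 * R powr (N - b2))))
        = A * (C0 * R powr (N - \<beta>) + (1 + C1 + K + C2) * (R powr (- \<beta>) * m))"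
        unfolding 3 by (simp add: algebra_simps)
      then show ?thesis unfolding 2 by (simp add: algebra_simps)
    qed
    finally show "(\<integral>\<^sup>+x. ?f x \<partial>lborel) \<le> ennreal (A * (C0 + 1 + C1 + K + C2) * m powr (1 - \<beta> / N))" .
  qed (use A BK C in auto)
qed

lemma test_function_bound:
  assumes "0 \<le> \<beta>" "\<beta> < N" "q > 0" "0 \<le> \<Lambda>" "\<Lambda> < crit"
  obtains B K where "B > 1" "K \<ge> 0"
    "\<And>\<phi> (m::real). test_function \<phi> \<Longrightarrow> m > 0 \<Longrightarrow>
      (\<integral>\<^sup>+x. ennreal (\<bar>\<phi> x\<bar> powr q) \<partial>lborel) \<le> ennreal m \<Longrightarrow>
      energy \<phi> \<le> ennreal B \<Longrightarrow>
      (\<integral>\<^sup>+x. ennreal (Phi N q \<beta> (\<Lambda> * (1 - \<beta> / N) * \<bar>\<phi> x\<bar> powr (N / (N - 1))) / P x powr \<beta>) \<partial>lborel)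
        \<le> ennreal (K * m powr (1 - \<beta> / N))"
proof (cases "\<beta> > 0")
  case True
  show ?thesis by (rule test_function_bound_weighted[OF True assms(2-)]) (rule that)
next
  case False
  with assms have \<beta>: "\<beta> = 0" by simp
  \<comment> \<open>Without a weight nothing has to be traded in Young's inequality, so the
    non-strict bound p \<ge> q suffices: powers with v \<le> 1 compare directly.\<close>
  obtain A p where A: "A \<ge> 1" "p > 0" "p \<ge> q"
    "\<And>v. 0 \<le> v \<Longrightarrow> v \<le> 1 \<Longrightarrow> Phi N q \<beta> (\<Lambda> * v powr (N / (N - 1))) \<le> A * v powr p"
    "\<And>v. 0 \<le> v \<Longrightarrow> Phi N q \<beta> (\<Lambda> * v powr (N / (N - 1))) \<le> exp (\<Lambda> * v powr (N / (N - 1)))"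
    "\<And>v. 0 \<le> v \<Longrightarrow> 0 \<le> Phi N q \<beta> (\<Lambda> * v powr (N / (N - 1)))"
    using Phi_bounds[OF assms(1-4)] \<beta> by metis
  obtain B K where BK: "B > 1" "K \<ge> 0"
    and expint: "\<And>\<phi> (m::real). test_function \<phi> \<Longrightarrow> m > 0 \<Longrightarrow>
      emeasure lborel (superlevel \<phi>) \<le> ennreal m \<Longrightarrow>
      energy \<phi> \<le> ennreal B \<Longrightarrow>
      (\<integral>\<^sup>+x. ennreal (exp (\<Lambda> * \<bar>\<phi> x\<bar> powr (N / (N - 1)))) * indicator (superlevel \<phi>) x \<partial>lborel)
        \<le> ennreal (K * m)"
    using exponential_integral[OF assms(4,5)] by blast
  show ?thesis
  proof (rule that[of B "A + K"])
    fix \<phi> :: "real^'n \<Rightarrow> real" and m :: real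
    assume \<phi>: "test_function \<phi>" and m: "m > 0"
      and Lq: "(\<integral>\<^sup>+x. ennreal (\<bar>\<phi> x\<bar> powr q) \<partial>lborel) \<le> ennreal m"
      and en: "energy \<phi> \<le> ennreal B"
    note [measurable] = test_function_measurable[OF \<phi>]
    have vol: "emeasure lborel (superlevel \<phi>) \<le> ennreal m"
      using Lq assms by (intro emeasure_superlevel_le[of \<phi> q]) auto
    let ?f = "\<lambda>x. ennreal (Phi N q \<beta> (\<Lambda> * (1 - \<beta> / N) * \<bar>\<phi> x\<bar> powr (N / (N - 1))) / P x powr \<beta>)"
    let ?i4 = "\<lambda>x. ennreal (exp (\<Lambda> * \<bar>\<phi> x\<bar> powr (N / (N - 1)))) * indicator (superlevel \<phi>) x"
    have "(\<integral>\<^sup>+x. ?f x \<partial>lborel) \<le> (\<integral>\<^sup>+x. ennreal A * ennreal (\<bar>\<phi> x\<bar> powr q) + 1 * ?i4 x \<partial>lborel)"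
    proof (rule nn_integral_mono)
      fix x
      \<comment> \<open>For \<beta> = 0 the denominator is 1 except at the origin, where
        \<open>0 powr 0 = 0\<close> makes the quotient 0; nonnegativity of \<open>Phi\<close> covers
        that point.\<close>
      have "Phi N q \<beta> (\<Lambda> * (1 - \<beta> / N) * \<bar>\<phi> x\<bar> powr (N / (N - 1))) / P x powr \<beta>
          \<le> Phi N q \<beta> (\<Lambda> * \<bar>\<phi> x\<bar> powr (N / (N - 1)))"
        using A(6)[of "\<bar>\<phi> x\<bar>"] \<beta> by (cases "x = 0") (auto simp: polar_pos less_imp_neq[symmetric])
      moreover have "Phi N q \<beta> (\<Lambda> * \<bar>\<phi> x\<bar> powr (N / (N - 1))) \<le> A * \<bar>\<phi> x\<bar> powr q" if "\<bar>\<phi> x\<bar> \<le> 1"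
      proof -
        have "\<bar>\<phi> x\<bar> powr p \<le> \<bar>\<phi> x\<bar> powr q"
          using that A(3) by (cases "\<phi> x = 0") (auto intro: powr_mono')
        then have "A * \<bar>\<phi> x\<bar> powr p \<le> A * \<bar>\<phi> x\<bar> powr q" using A(1) by (intro mult_left_mono) auto
        then show ?thesis using A(4)[of "\<bar>\<phi> x\<bar>"] that by simp
      qed
      moreover note A(5)[of "\<bar>\<phi> x\<bar>"]
      ultimately have "Phi N q \<beta> (\<Lambda> * (1 - \<beta> / N) * \<bar>\<phi> x\<bar> powr (N / (N - 1))) / P x powr \<beta>
        \<le> A * \<bar>\<phi> x\<bar> powr q + exp (\<Lambda> * \<bar>\<phi> x\<bar> powr (N / (N - 1))) * indicat_real (superlevel \<phi>) x"
        using A(1) by (cases "\<bar>\<phi> x\<bar> \<le> 1") (auto simp: add_increasing)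
      then have "?f x \<le> ennreal (A * \<bar>\<phi> x\<bar> powr q + exp (\<Lambda> * \<bar>\<phi> x\<bar> powr (N / (N - 1))) * indicat_real (superlevel \<phi>) x)"
        by (rule ennreal_leI)
      also have "\<dots> = ennreal A * ennreal (\<bar>\<phi> x\<bar> powr q) + 1 * ?i4 x"
        using A(1) by (simp add: ennreal_mult' ennreal_plus ennreal_indicator)
      finally show "?f x \<le> ennreal A * ennreal (\<bar>\<phi> x\<bar> powr q) + 1 * ?i4 x" .
    qed
    also have "\<dots> = ennreal A * (\<integral>\<^sup>+x. ennreal (\<bar>\<phi> x\<bar> powr q) \<partial>lborel) + 1 * (\<integral>\<^sup>+x. ?i4 x \<partial>lborel)"
      by (rule nn_integral_lincomb) measurable
    also have "\<dots> \<le> ennreal A * ennreal m + 1 * ennreal (K * m)"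
      by (intro add_mono mult_left_mono expint[OF \<phi> m vol en] Lq) auto
    also have "\<dots> = ennreal ((A + K) * m)"
      using A(1) BK m by (simp add: distrib_right ennreal_plus ennreal_mult')
    finally show "(\<integral>\<^sup>+x. ?f x \<partial>lborel) \<le> ennreal ((A + K) * m powr (1 - \<beta> / N))"
      using \<beta> m by simp
  qed (use A BK in auto)
qed

end

section \<open>From test functions to \<open>D\<^sup>N\<^sup>,\<^sup>q\<close>\<close>

text \<open>Split according to whether b \<le> \<eta> a. The point is the coefficient of a powr p,
  which approaches 1 as \<eta> tends to 0; a fixed factor such as 2 powr p would destroy the sharp
  energy bound.\<close>

lemma powr_add_le:
  fixes a b p :: real
  assumes "a \<ge> 0" "b \<ge> 0" "p \<ge> 0" "\<eta> > 0"
  shows "(a + b) powr p \<le> (1 + \<eta>) powr p * a powr p + (1 + 1 / \<eta>) powr p * b powr p"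
proof (cases "b \<le> \<eta> * a")
  case True
  have "(a + b) powr p \<le> ((1 + \<eta>) * a) powr p"
    using True assms by (intro powr_mono2) (auto simp: algebra_simps)
  also have "\<dots> = (1 + \<eta>) powr p * a powr p" by (rule powr_mult)
  finally show ?thesis by (simp add: add_increasing2)
next
  case False
  have "(a + b) powr p \<le> ((1 + 1 / \<eta>) * b) powr p"
    using False assms by (intro powr_mono2) (auto simp: field_simps)
  also have "\<dots> = (1 + 1 / \<eta>) powr p * b powr p" by (rule powr_mult)
  finally show ?thesis by (simp add: add_increasing)
qed

lemma nn_integral_Lp:
  assumes "f \<in> Lp p"
  shows "(\<integral>\<^sup>+x. ennreal (norm (f x) powr p) \<partial>lebesgue) = ennreal (LINT x|lebesgue. norm (f x) powr p)"
  using assms by (intro nn_integral_eq_integral) (auto simp: Lp_def)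

lemma Lp_norm_powr:
  assumes "p > 0"
  shows "Lp_norm p f powr p = (LINT x|lebesgue. norm (f x) powr p)"
  using assms by (simp add: Lp_norm_def powr_powr)

lemma Lp_integral_pos:
  assumes "u \<in> Lp p" "\<not> (AE x in lebesgue. u x = 0)"
  shows "(LINT x|lebesgue. norm (u x) powr p) > 0"
proof -
  have "(LINT x|lebesgue. norm (u x) powr p) \<noteq> 0"
  proof
    assume "(LINT x|lebesgue. norm (u x) powr p) = 0"
    then have "AE x in lebesgue. norm (u x) powr p = 0"
      using assms by (subst (asm) integral_nonneg_eq_0_iff_AE) (auto simp: Lp_def)
    then have "AE x in lebesgue. u x = 0" by (auto elim: eventually_mono)
    with assms show False by simp
  qed
  moreover have "(LINT x|lebesgue. norm (u x) powr p) \<ge> 0" by simp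
  ultimately show ?thesis by linarith
qed

lemma Lp_diff:
  assumes f: "f \<in> Lp p" and g: "g \<in> Lp p" and "p \<ge> 0"
  shows "(\<lambda>x. f x - g x) \<in> Lp p"
proof -
  have [measurable]: "f \<in> borel_measurable lebesgue" "g \<in> borel_measurable lebesgue"
    using f g by (auto simp: Lp_def)
  have "integrable lebesgue (\<lambda>x. norm (f x - g x) powr p)"
  proof (rule Bochner_Integration.integrable_bound)
    show "integrable lebesgue (\<lambda>x. 2 powr p * norm (f x) powr p + 2 powr p * norm (g x) powr p)"
      using f g by (auto simp: Lp_def)
    show "AE x in lebesgue. norm (norm (f x - g x) powr p)
        \<le> norm (2 powr p * norm (f x) powr p + 2 powr p * norm (g x) powr p)"
    proof (rule AE_I2)
      fix x
      have "norm (f x - g x) powr p \<le> (norm (f x) + norm (g x)) powr p"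
        using assms by (intro powr_mono2 norm_triangle_ineq4) auto
      also have "\<dots> \<le> 2 powr p * norm (f x) powr p + 2 powr p * norm (g x) powr p"
        using powr_add_le[of "norm (f x)" "norm (g x)" p 1] assms by simp
      finally show "norm (norm (f x - g x) powr p)
        \<le> norm (2 powr p * norm (f x) powr p + 2 powr p * norm (g x) powr p)" by simp
    qed
  qed measurable
  then show ?thesis by (simp add: Lp_def)
qed

lemma Lp_norm_tendsto_0:
  assumes "p > 0" "\<And>k. f k \<in> Lp p" "(\<lambda>k. Lp_norm p (f k)) \<longlonglongrightarrow> 0"
  shows "(\<lambda>k. LINT x|lebesgue. norm (f k x) powr p) \<longlonglongrightarrow> 0"
proof -
  have "(\<lambda>k. Lp_norm p (f k) powr p) \<longlonglongrightarrow> 0 powr p"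
    using assms by (intro tendsto_powr') (auto simp: Lp_norm_def)
  then show ?thesis using assms by (simp add: Lp_norm_powr)
qed

text \<open>Norm convergence makes the integrals of the approximants eventually lie below any B > A.
  It is stated for a majorised quantity \<open>a k\<close> so that it serves both for
  \<bar>\<phi>\<bar> and for F of the gradient.\<close>

lemma eventually_nn_integral_powr_le:
  fixes f :: "nat \<Rightarrow> real^'n \<Rightarrow> 'b::euclidean_space"
  assumes "p > 0" and f: "\<And>k. f k \<in> Lp p" and g: "g \<in> Lp p"
    and lim: "(\<lambda>k. Lp_norm p (\<lambda>x. f k x - g x)) \<longlonglongrightarrow> 0"
    and [measurable]: "h \<in> borel_measurable lebesgue"
    and nonneg: "\<And>x. 0 \<le> h x" "\<And>k x. 0 \<le> a k x" and "C > 0"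
    and le: "\<And>k x. a k x \<le> h x + C * norm (f k x - g x)"
    and A: "(\<integral>\<^sup>+x. ennreal (h x powr p) \<partial>lebesgue) \<le> ennreal A" "0 < A" "A < B"
  shows "\<forall>\<^sub>F k in sequentially. (\<integral>\<^sup>+x. ennreal (a k x powr p) \<partial>lebesgue) \<le> ennreal B"
proof -
  define b where "b = (1 + B / A) / 2"
  have b: "b > 1" "b * A < B" using A by (auto simp: b_def field_simps)
  \<comment> \<open>Chosen so that (1 + \<eta>) powr p = b, where b lies midway between 1 and B / A;
    this leaves b A < B and room for the error term.\<close>
  define \<eta> where "\<eta> = b powr (1 / p) - 1"
  have \<eta>: "\<eta> > 0" using b \<open>p > 0\<close> by (simp add: \<eta>_def gr_one_powr)
  have \<eta>p: "(1 + \<eta>) powr p = b" using b \<open>p > 0\<close> by (simp add: \<eta>_def powr_powr)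
  define D where "D = ((1 + 1 / \<eta>) * C) powr p"
  define I where "I k = (LINT x|lebesgue. norm (f k x - g x) powr p)" for k
  have [measurable]: "g \<in> borel_measurable lebesgue" "f k \<in> borel_measurable lebesgue" for k
    using f g by (auto simp: Lp_def)
  have diff: "(\<lambda>x. f k x - g x) \<in> Lp p" for k using f g \<open>p > 0\<close> by (intro Lp_diff) auto
  have "I \<longlonglongrightarrow> 0"
    unfolding I_def using \<open>p > 0\<close> diff lim by (rule Lp_norm_tendsto_0)
  then have "(\<lambda>k. b * A + D * I k) \<longlonglongrightarrow> b * A + D * 0" by (intro tendsto_intros)
  then have "\<forall>\<^sub>F k in sequentially. b * A + D * I k < B"
    by (rule order_tendstoD(2)) (use b in simp)
  then show ?thesis
  proof eventually_elim
    case (elim k)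
    have "(\<integral>\<^sup>+x. ennreal (a k x powr p) \<partial>lebesgue) \<le>
      (\<integral>\<^sup>+x. ennreal b * ennreal (h x powr p) + ennreal D * ennreal (norm (f k x - g x) powr p) \<partial>lebesgue)"
    proof (rule nn_integral_mono)
      fix x
      have "a k x powr p \<le> (h x + C * norm (f k x - g x)) powr p"
        using nonneg le \<open>p > 0\<close> by (intro powr_mono2) auto
      also have "\<dots> \<le> (1 + \<eta>) powr p * h x powr p + (1 + 1 / \<eta>) powr p * (C * norm (f k x - g x)) powr p"
        using \<eta> nonneg \<open>p > 0\<close> \<open>C > 0\<close> by (intro powr_add_le) auto
      also have "\<dots> = b * h x powr p + D * norm (f k x - g x) powr p"
        using \<open>C > 0\<close> \<eta> by (simp add: \<eta>p D_def powr_mult)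
      finally have "ennreal (a k x powr p) \<le> ennreal (b * h x powr p + D * norm (f k x - g x) powr p)"
        by (rule ennreal_leI)
      also have "\<dots> = ennreal b * ennreal (h x powr p) + ennreal D * ennreal (norm (f k x - g x) powr p)"
        using b by (intro ennreal_lincomb) (auto simp: D_def)
      finally show "ennreal (a k x powr p) \<le> \<dots>" .
    qed
    also have "\<dots> = ennreal b * (\<integral>\<^sup>+x. ennreal (h x powr p) \<partial>lebesgue)
        + ennreal D * (\<integral>\<^sup>+x. ennreal (norm (f k x - g x) powr p) \<partial>lebesgue)"
      by (rule nn_integral_lincomb) measurable
    also have "\<dots> \<le> ennreal b * ennreal A + ennreal D * ennreal (I k)"
      unfolding I_def nn_integral_Lp[OF diff] by (intro add_mono mult_left_mono A) auto
    also have "\<dots> = ennreal (b * A + D * I k)"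
      using b A by (intro ennreal_lincomb[symmetric]) (auto simp: D_def I_def)
    also have "\<dots> \<le> ennreal B" using elim by (intro ennreal_leI) simp
    finally show ?case .
  qed
qed

lemma continuous_bounded_support_Lp:
  fixes f :: "real^'n \<Rightarrow> 'b::euclidean_space"
  assumes cont: "continuous_on UNIV f" and supp: "\<And>x. norm x > r \<Longrightarrow> f x = 0" and "p \<ge> 0"
  shows "f \<in> Lp p"
proof -
  have [measurable]: "f \<in> borel_measurable borel"
    using cont by (rule borel_measurable_continuous_onI)
  have "bounded (f ` cball 0 r)"
    by (intro compact_imp_bounded compact_continuous_image continuous_on_subset[OF cont]) auto
  then obtain C where C: "\<And>x. x \<in> cball 0 r \<Longrightarrow> norm (f x) \<le> C"
    unfolding bounded_iff by blast
  have "integrable lborel (\<lambda>x. norm (f x) powr p)"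
  proof (rule Bochner_Integration.integrable_bound)
    show "integrable lborel (\<lambda>x::real^'n. C powr p * indicat_real (cball 0 r) x)"
      by (intro integrable_mult_right integrable_real_indicator) (use emeasure_compact_finite[OF compact_cball, of "0::real^'n" r] in auto)
    show "AE x in lborel. norm (norm (f x) powr p) \<le> norm (C powr p * indicat_real (cball 0 r) x)"
    proof (rule AE_I2)
      fix x
      show "norm (norm (f x) powr p) \<le> norm (C powr p * indicat_real (cball 0 r) x)"
        using C[of x] supp[of x] \<open>p \<ge> 0\<close> by (cases "norm x \<le> r") (auto intro: powr_mono2)
    qed
  qed measurable
  then have "integrable lebesgue (\<lambda>x. norm (f x) powr p)"
    by (intro integrable_completion[THEN iffD2]) auto
  moreover have "f \<in> borel_measurable lebesgue"
    by (intro measurable_completion) measurable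
  ultimately show ?thesis by (simp add: Lp_def)
qed

lemma test_function_grad_support:
  assumes "\<And>x. norm x > r \<Longrightarrow> \<phi> x = 0" "norm x > r"
  shows "grad \<phi> x = 0"
proof (rule grad_eqI)
  have "open (- cball (0::real^'a) r)" by auto
  moreover have "x \<in> - cball 0 r" using assms by simp
  moreover have "((\<lambda>x. 0::real) has_derivative (\<lambda>v. 0 \<bullet> v)) (at x)" by simp
  ultimately show "(\<phi> has_derivative (\<lambda>v. 0 \<bullet> v)) (at x)"
    using assms(1) by (intro has_derivative_transform_within_open[of "\<lambda>x. 0" _ x _ "- cball 0 r" \<phi>]) auto
qed

lemma test_function_Lp:
  assumes "test_function \<phi>" "p \<ge> 0"
  shows "\<phi> \<in> Lp p" "grad \<phi> \<in> Lp p"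
proof -
  obtain r where r: "\<And>x. norm x > r \<Longrightarrow> \<phi> x = 0"
    using test_function_bounded_support[OF assms(1)] by blast
  show "\<phi> \<in> Lp p"
    by (rule continuous_bounded_support_Lp[OF test_function_continuous[OF assms(1)] r assms(2)])
  show "grad \<phi> \<in> Lp p"
    by (rule continuous_bounded_support_Lp[OF test_function_grad_continuous[OF assms(1)]
          test_function_grad_support[OF r] assms(2)])
qed

context anisotropic
begin

lemma F_Lp:
  assumes "g \<in> Lp p" "p \<ge> 0"
  shows "(\<lambda>x. F (g x)) \<in> Lp p"
proof -
  have [measurable]: "g \<in> borel_measurable lebesgue" using assms by (auto simp: Lp_def)
  obtain C where C: "C > 0" "\<And>\<xi>. F \<xi> \<le> C * norm \<xi>" using F_bounds by metis
  have "integrable lebesgue (\<lambda>x. norm (F (g x)) powr p)"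
  proof (rule Bochner_Integration.integrable_bound)
    show "integrable lebesgue (\<lambda>x. C powr p * norm (g x) powr p)"
      using assms by (auto simp: Lp_def)
    show "AE x in lebesgue. norm (norm (F (g x)) powr p) \<le> norm (C powr p * norm (g x) powr p)"
      using C assms by (auto simp: powr_mult[symmetric] intro!: powr_mono2)
  qed measurable
  then show ?thesis by (simp add: Lp_def)
qed

lemma Phi_continuous:
  assumes "0 \<le> \<beta>" "\<beta> < N" "q > 0"
  shows "continuous_on {0..} (Phi N q \<beta>)"
proof -
  have N: "N > 1" using N_ge_2 by simp
  obtain j where j: "\<And>t. t \<ge> 0 \<Longrightarrow> Phi N q \<beta> t = exp t - (\<Sum>i<j. t ^ i / fact i)"
    using Phi_eq_exp_tail[OF N assms(3,1,2)] by metis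
  show ?thesis
    by (subst continuous_on_cong[OF refl, of _ _ "\<lambda>t. exp t - (\<Sum>i<j. t ^ i / fact i)"])
       (auto simp: j intro!: continuous_intros)
qed

lemma ATMSC_finite:
  assumes "0 \<le> \<beta>" "\<beta> < N" "q > 0" "0 \<le> \<Lambda>" "\<Lambda> < crit"
  shows "ATMSC F q \<Lambda> \<beta> < \<infinity>"
proof -
  have N: "N > 0" using N_ge_2 by simp
  define \<gamma> where "\<gamma> = 1 - \<beta> / N"
  have \<gamma>: "\<gamma> > 0" using assms N by (simp add: \<gamma>_def)
  obtain B K where B: "B > 1" and K: "K \<ge> 0"
    and bound: "\<And>\<phi> (m::real). test_function \<phi> \<Longrightarrow> m > 0 \<Longrightarrow>
      (\<integral>\<^sup>+x. ennreal (\<bar>\<phi> x\<bar> powr q) \<partial>lborel) \<le> ennreal m \<Longrightarrow>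
      energy \<phi> \<le> ennreal B \<Longrightarrow>
      (\<integral>\<^sup>+x. ennreal (Phi N q \<beta> (\<Lambda> * \<gamma> * \<bar>\<phi> x\<bar> powr (N / (N - 1))) / P x powr \<beta>) \<partial>lborel)
        \<le> ennreal (K * m powr \<gamma>)"
    using test_function_bound[OF assms] unfolding \<gamma>_def by blast
  define G where "G v x = ennreal (Phi N q \<beta> (\<Lambda> * \<gamma> * \<bar>v\<bar> powr (N / (N - 1))) / P x powr \<beta>)" for v x
  have contG: "continuous_on UNIV (\<lambda>v. Phi N q \<beta> (\<Lambda> * \<gamma> * \<bar>v\<bar> powr (N / (N - 1))))"
  proof (rule continuous_on_compose2[OF Phi_continuous[OF assms(1-3)]])
    show "continuous_on UNIV (\<lambda>v::real. \<Lambda> * \<gamma> * \<bar>v\<bar> powr (N / (N - 1)))"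
      using N_ge_2 by (intro continuous_intros continuous_on_powr') auto
  qed (use assms \<gamma> in auto)
  then have [measurable]: "(\<lambda>v. Phi N q \<beta> (\<Lambda> * \<gamma> * \<bar>v\<bar> powr (N / (N - 1)))) \<in> borel_measurable borel"
    by (rule borel_measurable_continuous_onI)
  have "ennreal (1 / Lp_norm q u powr (q * \<gamma>)) * (\<integral>\<^sup>+x. G (u x) x \<partial>lebesgue) \<le> ennreal (K * 2 powr \<gamma>)"
    if g: "has_D_gradient q u g" and le: "Lp_norm N (\<lambda>x. F (g x)) \<le> 1"
      and nz: "\<not> (AE x in lebesgue. u x = 0)" for u g
  proof -
    obtain \<phi> where \<phi>: "\<And>k. test_function (\<phi> k)"
      and lim1: "(\<lambda>k. Lp_norm q (\<lambda>x. \<phi> k x - u x)) \<longlonglongrightarrow> 0"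
      and lim2: "(\<lambda>k. Lp_norm N (\<lambda>x. grad (\<phi> k) x - g x)) \<longlonglongrightarrow> 0"
      and u: "u \<in> Lp q" and gL: "g \<in> Lp N"
      using g unfolding has_D_gradient_def N_eq[symmetric] by blast
    have [measurable]: "\<phi> k \<in> borel_measurable borel" "u \<in> borel_measurable lebesgue" for k
      using test_function_measurable[OF \<phi>] u by (auto simp: Lp_def)
    define I where "I = (LINT x|lebesgue. norm (u x) powr q)"
    have I: "I > 0" unfolding I_def by (rule Lp_integral_pos[OF u nz])
    \<comment> \<open>Any factor above 1 would do: the approximants' L^q mass is eventually below m,
      just as their energy is eventually below B > 1.\<close>
    define m where "m = 2 * I"
    have m: "m > 0" using I by (simp add: m_def)
    have ev: "\<forall>\<^sub>F k in sequentially. (\<integral>\<^sup>+x. G (\<phi> k x) x \<partial>lborel) \<le> ennreal (K * m powr \<gamma>)"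
    proof -
      have "\<forall>\<^sub>F k in sequentially. (\<integral>\<^sup>+x. ennreal (\<bar>\<phi> k x\<bar> powr q) \<partial>lebesgue) \<le> ennreal m"
      proof (rule eventually_nn_integral_powr_le[OF \<open>q > 0\<close> test_function_Lp(1)[OF \<phi>] u lim1])
        show "(\<integral>\<^sup>+x. ennreal (\<bar>u x\<bar> powr q) \<partial>lebesgue) \<le> ennreal I"
          using nn_integral_Lp[OF u] by (simp add: I_def)
        show "\<bar>\<phi> k x\<bar> \<le> \<bar>u x\<bar> + 1 * norm (\<phi> k x - u x)" for k x by simp
      qed (use assms I in \<open>auto simp: m_def\<close>)
      moreover have "\<forall>\<^sub>F k in sequentially. (\<integral>\<^sup>+x. ennreal (F (grad (\<phi> k) x) powr N) \<partial>lebesgue) \<le> ennreal B"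
      proof -
        obtain C where C: "C > 0" "\<And>\<xi>. F \<xi> \<le> C * norm \<xi>" using F_bounds by metis
        have FL: "(\<lambda>x. F (g x)) \<in> Lp N" using gL N by (intro F_Lp) auto
        show ?thesis
        proof (rule eventually_nn_integral_powr_le[OF N test_function_Lp(2)[OF \<phi>] gL lim2])
          have "Lp_norm N (\<lambda>x. F (g x)) powr N \<le> 1"
            using le N powr_mono2[of N "Lp_norm N (\<lambda>x. F (g x))" 1] by (simp add: Lp_norm_def)
          then show "(\<integral>\<^sup>+x. ennreal (F (g x) powr N) \<partial>lebesgue) \<le> ennreal 1"
            using nn_integral_Lp[OF FL] Lp_norm_powr[OF N, of "\<lambda>x. F (g x)"] by (simp add: ennreal_leI)
          show "F (grad (\<phi> k) x) \<le> F (g x) + C * norm (grad (\<phi> k) x - g x)" for k x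
            using F_triangle[of "g x" "grad (\<phi> k) x - g x"] C(2)[of "grad (\<phi> k) x - g x"] by simp
        qed (use FL C B N in \<open>auto simp: Lp_def\<close>)
      qed
      ultimately show ?thesis
        unfolding G_def nn_integral_completion
        by eventually_elim (rule bound[OF \<phi> m])
    qed
    have diff: "(\<lambda>x. \<phi> k x - u x) \<in> Lp q" for k
      using test_function_Lp(1)[OF \<phi>] u assms by (intro Lp_diff) auto
    \<comment> \<open>Fatou's lemma needs pointwise limits, and L^q convergence provides them almost
      everywhere along a subsequence.\<close>
    obtain r where r: "strict_mono r" "AE x in lebesgue. (\<lambda>k. norm (\<phi> (r k) x - u x) powr q) \<longlonglongrightarrow> 0"
    proof -
      have "(\<lambda>k. \<integral>x. norm (norm (\<phi> k x - u x) powr q) \<partial>lebesgue) \<longlonglongrightarrow> 0"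
        using Lp_norm_tendsto_0[OF \<open>q > 0\<close> diff lim1] by simp
      then show ?thesis
        using tendsto_L1_AE_subseq[of lebesgue "\<lambda>k x. norm (\<phi> k x - u x) powr q"] diff that
        by (auto simp: Lp_def)
    qed
    have "(\<integral>\<^sup>+x. G (u x) x \<partial>lebesgue) \<le> (\<integral>\<^sup>+x. liminf (\<lambda>k. G (\<phi> (r k) x) x) \<partial>lebesgue)"
    proof (rule nn_integral_mono_AE, use r(2) in eventually_elim)
      case (elim x)
      have "(\<lambda>k. (norm (\<phi> (r k) x - u x) powr q) powr (1 / q)) \<longlonglongrightarrow> 0 powr (1 / q)"
        using elim assms by (intro tendsto_powr') auto
      then have "(\<lambda>k. norm (\<phi> (r k) x - u x)) \<longlonglongrightarrow> 0"
        using assms by (simp add: powr_powr)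
      then have "(\<lambda>k. \<phi> (r k) x) \<longlonglongrightarrow> u x"
        by (rule LIM_zero_cancel[OF tendsto_norm_zero_cancel])
      then have "(\<lambda>k. Phi N q \<beta> (\<Lambda> * \<gamma> * \<bar>\<phi> (r k) x\<bar> powr (N / (N - 1)))) \<longlonglongrightarrow> Phi N q \<beta> (\<Lambda> * \<gamma> * \<bar>u x\<bar> powr (N / (N - 1)))"
        using continuous_on_tendsto_compose[OF contG] by auto
      then have "(\<lambda>k. G (\<phi> (r k) x) x) \<longlonglongrightarrow> G (u x) x"
        unfolding G_def by (cases "x = 0") (auto intro!: tendsto_ennrealI tendsto_divide simp: polar_pos)
      then show ?case using lim_imp_Liminf[of sequentially] by (metis order_refl trivial_limit_sequentially)
    qed
    also have "\<dots> \<le> liminf (\<lambda>k. \<integral>\<^sup>+x. G (\<phi> (r k) x) x \<partial>lebesgue)"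
      unfolding G_def by (intro nn_integral_liminf measurable_completion) measurable
    also have "\<dots> \<le> ennreal (K * m powr \<gamma>)"
    proof (rule Liminf_le)
      show "\<forall>\<^sub>F k in sequentially. (\<integral>\<^sup>+x. G (\<phi> (r k) x) x \<partial>lebesgue) \<le> ennreal (K * m powr \<gamma>)"
        using eventually_subseq[OF r(1) ev] by (simp add: nn_integral_completion)
    qed simp
    finally have "ennreal (1 / Lp_norm q u powr (q * \<gamma>)) * (\<integral>\<^sup>+x. G (u x) x \<partial>lebesgue)
      \<le> ennreal (1 / Lp_norm q u powr (q * \<gamma>)) * ennreal (K * m powr \<gamma>)"
      by (rule mult_left_mono) simp
    \<comment> \<open>The factor I powr \<gamma> cancels against the normalising norm, which makes
      the bound independent of u.\<close>
    also have "\<dots> = ennreal (K * 2 powr \<gamma>)"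
    proof -
      have "Lp_norm q u powr (q * \<gamma>) = I powr \<gamma>"
        using Lp_norm_powr[OF \<open>q > 0\<close>, of u] by (simp add: I_def powr_powr[symmetric])
      moreover have "m powr \<gamma> = 2 powr \<gamma> * I powr \<gamma>"
        using I by (simp add: m_def powr_mult)
      ultimately show ?thesis using I K by (simp flip: ennreal_mult')
    qed
    finally show ?thesis .
  qed
  then have "ATMSC F q \<Lambda> \<beta> \<le> ennreal (K * 2 powr \<gamma>)"
    unfolding ATMSC_def Let_def N_eq[symmetric] \<gamma>_def[symmetric] G_def
    by (intro SUP_least) auto
  then show ?thesis by (auto simp: less_top[symmetric] top_unique)
qed

end

section \<open>Mollification\<close>

lemma partial_deriv_eqI:
  assumes "(f has_derivative D) (at x)"
  shows "partial_deriv i f x = D (axis i 1)"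
  using frechet_derivative_at[OF assms] by (simp add: partial_deriv_def)

text \<open>The functions s^(-k) exp(-1/s), extended by 0 to s \<le> 0. Allowing every k makes their
  span closed under differentiation, so smoothness at 0 becomes an algebraic fact.\<close>

definition flat_exp :: "nat \<Rightarrow> real \<Rightarrow> real" where
  "flat_exp k s = (if s > 0 then exp (- 1 / s) / s ^ k else 0)"

lemma flat_exp_tendsto_0: "(flat_exp k \<longlongrightarrow> 0) (at_right 0)"
proof -
  have "((\<lambda>s::real. inverse s ^ k / exp (inverse s)) \<longlongrightarrow> 0) (at_right 0)"
    using filterlim_compose[OF tendsto_power_div_exp_0 filterlim_inverse_at_top_right] .
  moreover have "\<forall>\<^sub>F s in at_right 0. inverse s ^ k / exp (inverse s) = flat_exp k s"
    by (rule eventually_at_rightI[of 0 1])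
       (auto simp: flat_exp_def exp_minus field_simps)
  ultimately show ?thesis by (rule Lim_transform_eventually)
qed

lemma flat_exp_deriv:
  "(flat_exp k has_real_derivative flat_exp (k + 2) s - real k * flat_exp (k + 1) s) (at s)"
proof (cases s "0::real" rule: linorder_cases)
  case less
  have "((\<lambda>s. 0) has_real_derivative 0) (at s)" by simp
  then have "(flat_exp k has_real_derivative 0) (at s)"
    by (rule has_field_derivative_transform_within_open[of _ _ _ "{..<0}"])
       (use less in \<open>auto simp: flat_exp_def\<close>)
  then show ?thesis using less by (simp add: flat_exp_def)
next
  case equal
  \<comment> \<open>At 0 the difference quotient from the right is again a member of the family,
    \<open>flat_exp (k + 1)\<close>, which tends to 0; from the left it vanishes.\<close>
  have "((\<lambda>h. flat_exp k h / h) \<longlongrightarrow> 0) (at_right 0)"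
  proof (rule Lim_transform_eventually[OF flat_exp_tendsto_0[of "k + 1"]])
    show "\<forall>\<^sub>F h in at_right 0. flat_exp (k + 1) h = flat_exp k h / h"
      by (rule eventually_at_rightI[of 0 1]) (auto simp: flat_exp_def)
  qed
  moreover have "((\<lambda>h. flat_exp k h / h) \<longlongrightarrow> 0) (at_left 0)"
  proof (rule Lim_transform_eventually[OF tendsto_const[of 0]])
    show "\<forall>\<^sub>F h in at_left 0. 0 = flat_exp k h / h"
      by (rule eventually_at_leftI[of "-1" 0]) (auto simp: flat_exp_def)
  qed
  ultimately have "((\<lambda>h. flat_exp k h / h) \<longlongrightarrow> 0) (at 0)"
    by (simp add: filterlim_split_at)
  then show ?thesis using equal by (simp add: DERIV_def flat_exp_def)
next
  case greater
  have "((\<lambda>s. exp (- 1 / s) / s ^ k) has_real_derivative flat_exp (k + 2) s - real k * flat_exp (k + 1) s) (at s)"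
  proof (cases k)
    case 0
    then show ?thesis using greater
      by (auto intro!: derivative_eq_intros simp: flat_exp_def power2_eq_square)
  next
    case (Suc j)
    then show ?thesis using greater
      by (auto intro!: derivative_eq_intros simp: flat_exp_def field_simps power2_eq_square)
         (cases j; simp)
  qed
  then show ?thesis
    by (rule has_field_derivative_transform_within_open[of _ _ _ "{0<..}"])
       (use greater in \<open>auto simp: flat_exp_def\<close>)
qed

text \<open>Smoothness of the mollifiers: this algebra is closed under partial derivatives.\<close>

inductive_set bump_algebra :: "(real^'n \<Rightarrow> real) set" where
  const: "(\<lambda>x. c) \<in> bump_algebra"
| coord: "(\<lambda>x. x $ i) \<in> bump_algebra"
| bump: "(\<lambda>x. flat_exp k (1 - a * (x \<bullet> x))) \<in> bump_algebra"
| add: "f \<in> bump_algebra \<Longrightarrow> g \<in> bump_algebra \<Longrightarrow> (\<lambda>x. f x + g x) \<in> bump_algebra"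
| mult: "f \<in> bump_algebra \<Longrightarrow> g \<in> bump_algebra \<Longrightarrow> (\<lambda>x. f x * g x) \<in> bump_algebra"

text \<open>Induction over the generators. A bump differentiates into bumps of index k + 1 and k + 2
  times a multiple of a coordinate, so the chain and product rules never leave the algebra.\<close>

lemma bump_algebra_closed:
  assumes "f \<in> bump_algebra"
  shows "(\<forall>x. f differentiable (at x)) \<and> (\<forall>i. partial_deriv i f \<in> bump_algebra)"
  using assms
proof induction
  case (const c)
  have "partial_deriv i (\<lambda>x. c) = (\<lambda>x. 0)" for i :: 'a
    by (rule ext) (subst partial_deriv_eqI[OF has_derivative_const], simp)
  then show ?case by (auto intro: bump_algebra.const)
next
  case (coord i)
  have D: "((\<lambda>x. x $ i) has_derivative (\<lambda>v. v $ i)) (at x)" for x :: "real^'a"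
    by (rule bounded_linear_imp_has_derivative) (rule bounded_linear_vec_nth)
  have "partial_deriv j (\<lambda>x. x $ i) = (\<lambda>x. axis j 1 $ i)" for j :: 'a
    by (rule ext) (subst partial_deriv_eqI[OF D], simp)
  then show ?case using D by (auto intro: bump_algebra.const simp: differentiable_def)
next
  case (bump k a)
  let ?d = "\<lambda>s. flat_exp (k + 2) s - real k * flat_exp (k + 1) s"
  have D: "((\<lambda>x. flat_exp k (1 - a * (x \<bullet> x))) has_derivative
      (\<lambda>v. ?d (1 - a * (x \<bullet> x)) * (- a * (2 * (x \<bullet> v))))) (at x)" for x :: "real^'a"
  proof -
    have "((\<lambda>x. 1 - a * (x \<bullet> x)) has_derivative (\<lambda>v. - a * (2 * (x \<bullet> v)))) (at x)"
      by (auto intro!: derivative_eq_intros simp: inner_commute)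
    from has_derivative_compose[OF this flat_exp_deriv[unfolded has_field_derivative_def]]
    show ?thesis by simp
  qed
  have "partial_deriv i (\<lambda>x. flat_exp k (1 - a * (x \<bullet> x))) =
    (\<lambda>x. (flat_exp (k + 2) (1 - a * (x \<bullet> x)) + (- real k) * flat_exp (k + 1) (1 - a * (x \<bullet> x))) * ((- a * 2) * x $ i))" for i :: 'a
    by (rule ext) (subst partial_deriv_eqI[OF D], simp add: inner_axis)
  moreover have "(\<lambda>x::real^'a. (flat_exp (k + 2) (1 - a * (x \<bullet> x)) + (- real k) * flat_exp (k + 1) (1 - a * (x \<bullet> x))) * ((- a * 2) * x $ i))
    \<in> bump_algebra" for i
    by (intro bump_algebra.intros)
  ultimately show ?case using D by (auto simp: differentiable_def)
next
  case (add f g)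
  have D: "((\<lambda>x. f x + g x) has_derivative (\<lambda>v. frechet_derivative f (at x) v + frechet_derivative g (at x) v)) (at x)" for x
    using add by (intro has_derivative_add) (auto simp: frechet_derivative_works)
  have "partial_deriv i (\<lambda>x. f x + g x) = (\<lambda>x. partial_deriv i f x + partial_deriv i g x)" for i
    by (rule ext) (subst partial_deriv_eqI[OF D], simp add: partial_deriv_def)
  then show ?case using D add by (auto simp: differentiable_def intro: bump_algebra.add)
next
  case (mult f g)
  have D: "((\<lambda>x. f x * g x) has_derivative (\<lambda>v. f x * frechet_derivative g (at x) v + frechet_derivative f (at x) v * g x)) (at x)" for x
    using mult by (intro has_derivative_mult) (auto simp: frechet_derivative_works)
  have "partial_deriv i (\<lambda>x. f x * g x) = (\<lambda>x. f x * partial_deriv i g x + partial_deriv i f x * g x)" for i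
    by (rule ext) (subst partial_deriv_eqI[OF D], simp add: partial_deriv_def)
  moreover have "(\<lambda>x. f x * partial_deriv i g x + partial_deriv i f x * g x) \<in> bump_algebra" for i
    using mult by (intro bump_algebra.add bump_algebra.mult) auto
  ultimately show ?case using D by (auto simp: differentiable_def)
qed

lemma bump_algebra_continuous: "f \<in> bump_algebra \<Longrightarrow> continuous_on S f"
  using bump_algebra_closed[of f]
  by (auto intro!: continuous_at_imp_continuous_on differentiable_imp_continuous_within)

lemma bump_algebra_grad_continuous: "f \<in> bump_algebra \<Longrightarrow> continuous_on S (grad f)"
  unfolding grad_def using bump_algebra_closed[of f]
  by (auto intro!: continuous_on_vec_lambda bump_algebra_continuous)

text \<open>Differentiation under the integral over a fixed box: x occurs only in f, so v need only
  be continuous and the derivative falls on f.\<close>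

lemma convolution_has_derivative:
  fixes v :: "real^'n \<Rightarrow> real"
  assumes v: "continuous_on UNIV v" and f: "f \<in> bump_algebra"
  shows "((\<lambda>x. integral (cbox a b) (\<lambda>z. v z * f (x - z))) has_derivative
    (\<lambda>h. integral (cbox a b) (\<lambda>z. v z * (grad f (x - z) \<bullet> h)))) (at x)"
proof -
  \<comment> \<open>The derivative as a bounded linear map, the form for which
    \<open>leibniz_rule\<close> asks joint continuity in x and z.\<close>
  define fx where "fx x z = v z *\<^sub>R blinfun_inner_right (grad f (x - z))" for x z
  have cont_fx: "continuous_on S (\<lambda>(x, z). fx x z)" for S
  proof -
    have "continuous_on S (\<lambda>p. grad f (fst p - snd p))"
      by (rule continuous_on_compose2[OF bump_algebra_grad_continuous[OF f, of UNIV]])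
         (auto intro!: continuous_intros)
    moreover have "continuous_on S (\<lambda>p. v (snd p))"
      by (rule continuous_on_compose2[OF v]) (auto intro!: continuous_intros)
    ultimately show ?thesis
      unfolding fx_def case_prod_unfold
      by (intro continuous_on_scaleR bounded_linear.continuous_on[OF bounded_linear_blinfun_inner_right])
  qed
  have "((\<lambda>x. integral (cbox a b) (\<lambda>z. v z * f (x - z))) has_derivative integral (cbox a b) (fx x)) (at x within UNIV)"
  proof (rule leibniz_rule[OF _ _ cont_fx])
    fix y z
    have g: "(f has_derivative (\<lambda>h. grad f (y - z) \<bullet> h)) (at (y - z))"
      using bump_algebra_closed[OF f] by (intro grad_has_derivative) auto
    have "((\<lambda>y. y - z) has_derivative (\<lambda>h. h)) (at y)"
      by (auto intro!: derivative_eq_intros)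
    from has_derivative_compose[of "\<lambda>y. y - z" "\<lambda>h. h" y UNIV f "\<lambda>h. grad f (y - z) \<bullet> h", OF this g]
    have "((\<lambda>y. f (y - z)) has_derivative (\<lambda>h. grad f (y - z) \<bullet> h)) (at y)" .
    then show "((\<lambda>y. v z * f (y - z)) has_derivative fx y z) (at y within UNIV)"
      by (auto intro!: derivative_eq_intros simp: fx_def scaleR_blinfun.rep_eq)
  next
    fix y
    have "continuous_on (cbox a b) (\<lambda>z. v z * f (y - z))"
      by (intro continuous_intros continuous_on_subset[OF v]
            continuous_on_compose2[OF bump_algebra_continuous[OF f, of UNIV]]) auto
    then show "(\<lambda>z. v z * f (y - z)) integrable_on cbox a b" by (rule integrable_continuous)
  qed auto
  moreover have "blinfun_apply (integral (cbox a b) (fx x)) = (\<lambda>h. integral (cbox a b) (\<lambda>z. v z * (grad f (x - z) \<bullet> h)))"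
  proof
    fix h
    have "continuous_on (cbox a b) (\<lambda>z. (x, z))"
      by (rule continuous_on_Pair[OF continuous_on_const continuous_on_id])
    then have "continuous_on (cbox a b) (fx x)"
      using continuous_on_compose2[OF cont_fx[of UNIV], of "cbox a b" "\<lambda>z. (x, z)"] by simp
    then have "fx x integrable_on cbox a b" by (rule integrable_continuous)
    then show "blinfun_apply (integral (cbox a b) (fx x)) h = integral (cbox a b) (\<lambda>z. v z * (grad f (x - z) \<bullet> h))"
      by (subst blinfun_apply_integral) (auto simp: fx_def scaleR_blinfun.rep_eq)
  qed
  ultimately show ?thesis by simp
qed

text \<open>A partial derivative of the convolution is the same convolution with another member of
  the algebra, hence the induction with f arbitrary.\<close>

lemma convolution_smooth:
  fixes v :: "real^'n \<Rightarrow> real"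
  assumes v: "continuous_on UNIV v" and f: "f \<in> bump_algebra"
  shows "C_k_on k UNIV (\<lambda>x. integral (cbox a b) (\<lambda>z. v z * f (x - z)))"
  using f
proof (induction k arbitrary: f)
  case 0
  show ?case
    unfolding C_k_on.simps
    by (intro continuous_at_imp_continuous_on ballI has_derivative_continuous[OF convolution_has_derivative[OF v 0]])
next
  case (Suc k)
  have "partial_deriv i (\<lambda>x. integral (cbox a b) (\<lambda>z. v z * f (x - z))) =
      (\<lambda>x. integral (cbox a b) (\<lambda>z. v z * partial_deriv i f (x - z)))" for i
    by (rule ext) (subst partial_deriv_eqI[OF convolution_has_derivative[OF v Suc.prems]],
        simp add: inner_axis grad_def)
  moreover have "partial_deriv i f \<in> bump_algebra" for i
    using bump_algebra_closed[OF Suc.prems] by blast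
  moreover have "(\<lambda>x. integral (cbox a b) (\<lambda>z. v z * f (x - z))) differentiable (at x)" for x
    unfolding differentiable_def using convolution_has_derivative[OF v Suc.prems] by blast
  ultimately show ?case using Suc.IH by simp
qed

lemma C_k_on_UNIV_cmult:
  "C_k_on k UNIV f \<Longrightarrow> C_k_on k UNIV (\<lambda>x. c * f x)"
proof (induction k arbitrary: f)
  case 0
  then show ?case by (auto intro!: continuous_intros)
next
  case (Suc k)
  have D: "((\<lambda>x. c * f x) has_derivative (\<lambda>v. c * frechet_derivative f (at x) v)) (at x)" for x
    using Suc.prems by (auto intro!: derivative_eq_intros simp: frechet_derivative_works)
  have "partial_deriv i (\<lambda>x. c * f x) = (\<lambda>x. c * partial_deriv i f x)" for i
    by (rule ext) (subst partial_deriv_eqI[OF D], simp add: partial_deriv_def)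
  then show ?case using Suc D by (auto simp: differentiable_def)
qed

lemma grad_cmult:
  assumes "f differentiable (at x)"
  shows "grad (\<lambda>x. c * f x) x = c *\<^sub>R grad f x"
  by (rule grad_eqI) (use grad_has_derivative[OF assms] in \<open>auto intro!: derivative_eq_intros\<close>)

lemma test_function_cmult:
  assumes "test_function f"
  shows "test_function (\<lambda>x. c * f x)"
proof -
  have "closure {x. c * f x \<noteq> 0} \<subseteq> closure {x. f x \<noteq> 0}" by (rule closure_mono) auto
  moreover have "compact (closure {x. f x \<noteq> 0})" using assms by (simp add: test_function_def)
  ultimately have "compact (closure {x. c * f x \<noteq> 0})"
    by (metis closed_closure compact_Int_closed inf.absorb2 inf_commute)
  then show ?thesis using assms by (auto simp: test_function_def intro: C_k_on_UNIV_cmult)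
qed

lemma lborel_integral_reflect:
  fixes f :: "'a::euclidean_space \<Rightarrow> real"
  assumes "f \<in> borel_measurable borel"
  shows "(LINT z|lborel. f (x - z)) = (LINT z|lborel. f z)"
proof -
  have "(LINT z|lborel. f z) = (LINT z|density (distr lborel borel (\<lambda>z. x + (-1) *\<^sub>R z)) (\<lambda>_. ennreal (\<bar>-1\<bar> ^ DIM('a))). f z)"
    by (subst lborel_affine[of "-1" x]) auto
  also have "\<dots> = (LINT z|distr lborel borel (\<lambda>z. x - z). f z)" by (simp add: density_1)
  also have "\<dots> = (LINT z|lborel. f (x - z))"
    using assms by (subst integral_distr) auto
  finally show ?thesis by simp
qed

section \<open>Mollification adapted to the polar norm\<close>

context anisotropic
begin

lemma mollifier_exists:
  assumes "\<epsilon> > 0"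
  obtains \<rho> where "\<rho> \<in> bump_algebra" "\<And>z. \<rho> z \<ge> (0::real)" "\<And>z. P z > \<epsilon> \<Longrightarrow> \<rho> z = 0"
    "\<And>v. continuous_on UNIV v \<Longrightarrow> integrable lborel (\<lambda>z. v z * \<rho> z)" "(LINT z|lborel. \<rho> z) = 1"
proof -
  obtain C where C: "C > 0" "\<And>x. P x \<le> C * norm x" using polar_upper by blast
  \<comment> \<open>Makes the bump vanish outside the Euclidean ball of radius \<epsilon> / C, which
    is contained in the polar ball of radius \<epsilon>.\<close>
  define a where "a = (C / \<epsilon>)\<^sup>2"
  have a: "a > 0" using C assms by (simp add: a_def)
  define \<rho>0 :: "real^'n \<Rightarrow> real" where "\<rho>0 z = flat_exp 0 (1 - a * (z \<bullet> z))" for z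
  have alg: "\<rho>0 \<in> bump_algebra" unfolding \<rho>0_def[abs_def] by (rule bump_algebra.bump)
  have nonneg: "\<rho>0 z \<ge> 0" for z by (simp add: \<rho>0_def flat_exp_def)
  have a_norm: "a * (z \<bullet> z) = (C * norm z / \<epsilon>)\<^sup>2" for z :: "real^'n"
    by (simp add: a_def power_mult_distrib power_divide flip: power2_norm_eq_inner)
  have supp: "norm z \<le> \<epsilon> / C" if "\<rho>0 z \<noteq> 0" for z
  proof -
    have "(C * norm z / \<epsilon>)\<^sup>2 < 1" using that by (auto simp: \<rho>0_def flat_exp_def a_norm split: if_splits)
    then have "C * norm z / \<epsilon> < 1" using C assms by (simp add: power_less_one_iff abs_square_less_1)
    then show ?thesis using C assms by (simp add: field_simps)
  qed
  have int: "integrable lborel (\<lambda>z. v z * \<rho>0 z)" if v: "continuous_on UNIV v" for v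
  proof -
    have "integrable lborel (\<lambda>z. indicator (cball 0 (\<epsilon> / C)) z *\<^sub>R (v z * \<rho>0 z))"
      by (intro borel_integrable_compact continuous_intros continuous_on_subset[OF v]
          bump_algebra_continuous[OF alg]) auto
    also have "(\<lambda>z. indicator (cball 0 (\<epsilon> / C)) z *\<^sub>R (v z * \<rho>0 z)) = (\<lambda>z. v z * \<rho>0 z)"
      using supp by (auto simp: indicator_def fun_eq_iff)
    finally show ?thesis .
  qed
  have int0: "integrable lborel \<rho>0" using int[of "\<lambda>_. 1"] by simp
  define I where "I = (LINT z|lborel. \<rho>0 z)"
  have I: "I > 0"
  proof -
    \<comment> \<open>On half the support radius the argument of \<open>flat_exp\<close> is at least
      1/2, so the bump is at least exp (-2) there and its mass is positive.\<close>
    define r where "r = \<epsilon> / (2 * C)"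
    have r: "r > 0" using C assms by (simp add: r_def)
    have "0 < exp (- 2) * measure lborel (ball (0::real^'n) r)"
      using content_ball_pos[OF r, of "0::real^'n"] by simp
    also have "\<dots> = (LINT z|lborel. exp (- 2) * indicat_real (ball (0::real^'n) r) z)" by simp
    also have "\<dots> \<le> I"
      unfolding I_def
    proof (rule integral_mono[OF _ int0])
      show "integrable lborel (\<lambda>z. exp (- 2) * indicat_real (ball (0::real^'n) r) z)"
        by (intro integrable_mult_right integrable_real_indicator)
           (auto intro: order_le_less_trans[OF emeasure_mono[OF ball_subset_cball] emeasure_compact_finite[OF compact_cball, unfolded infinity_ennreal_def]])
      fix z
      show "exp (- 2) * indicat_real (ball 0 r) z \<le> \<rho>0 z"
      proof (cases "z \<in> ball 0 r")
        case True
        then have "C * norm z / \<epsilon> \<le> 1 / 2" using C assms by (simp add: r_def field_simps)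
        then have "(C * norm z / \<epsilon>)\<^sup>2 \<le> (1 / 2)\<^sup>2" using C assms by (intro power_mono) auto
        then have "a * (z \<bullet> z) \<le> (1 / 2)\<^sup>2" by (simp only: a_norm)
        moreover have "(1 / 2 :: real)\<^sup>2 = 1 / 4" by (simp add: power2_eq_square)
        ultimately have s: "1 - a * (z \<bullet> z) \<ge> 1 / 2" by linarith
        then have "- 1 / (1 - a * (z \<bullet> z)) \<ge> - 2" by (simp add: field_simps)
        then show ?thesis using True s by (simp add: \<rho>0_def flat_exp_def)
      qed (use nonneg in simp)
    qed
    finally show ?thesis .
  qed
  show ?thesis
  proof (rule that[of "\<lambda>z. (1 / I) * \<rho>0 z"])
    show "(\<lambda>z. (1 / I) * \<rho>0 z) \<in> bump_algebra"
      by (intro bump_algebra.mult bump_algebra.const alg)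
    show "(1 / I) * \<rho>0 z \<ge> 0" for z using nonneg I by simp
    show "(1 / I) * \<rho>0 z = 0" if "P z > \<epsilon>" for z
    proof (rule ccontr)
      assume "(1 / I) * \<rho>0 z \<noteq> 0"
      then have "C * norm z \<le> \<epsilon>" using supp[of z] C by (simp add: field_simps)
      with C(2)[of z] that show False by simp
    qed
    show "integrable lborel (\<lambda>z. v z * ((1 / I) * \<rho>0 z))" if "continuous_on UNIV v" for v
      using integrable_mult_right[of "1 / I", OF int[OF that]] by (simp add: mult_ac)
    show "(LINT z|lborel. (1 / I) * \<rho>0 z) = 1" using I by (simp add: I_def)
  qed
qed

text \<open>The bipolar inequality turns a local Lipschitz constant in the norm \<open>P\<close> into a bound on \<open>F (\<nabla>w)\<close>.\<close>

lemma mollification: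
  fixes v :: "real^'n \<Rightarrow> real"
  assumes v: "continuous_on UNIV v" and supp: "\<And>z. norm z > r \<Longrightarrow> v z = 0" and "\<epsilon> > 0"
  obtains w where "test_function w"
    "\<And>x m. (\<And>y. P (y - x) \<le> \<epsilon> \<Longrightarrow> v y \<le> m) \<Longrightarrow> w x \<le> m"
    "\<And>x m. (\<And>y. P (y - x) \<le> \<epsilon> \<Longrightarrow> m \<le> v y) \<Longrightarrow> m \<le> w x"
    "\<And>x M. 0 \<le> M \<Longrightarrow>
      (\<And>y y'. P (y - x) \<le> 2 * \<epsilon> \<Longrightarrow> P (y' - x) \<le> 2 * \<epsilon> \<Longrightarrow> v y - v y' \<le> M * P (y - y')) \<Longrightarrow>
      F (grad w x) \<le> M"
proof -
  obtain \<rho> where \<rho>: "\<rho> \<in> bump_algebra" "\<And>z. \<rho> z \<ge> (0::real)" "\<And>z. P z > \<epsilon> \<Longrightarrow> \<rho> z = 0"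
    and int: "\<And>v. continuous_on UNIV v \<Longrightarrow> integrable lborel (\<lambda>z. v z * \<rho> z)"
    and one: "(LINT z|lborel. \<rho> z) = 1"
    using mollifier_exists[OF \<open>\<epsilon> > 0\<close>] by blast
  have [measurable]: "v \<in> borel_measurable borel" "\<rho> \<in> borel_measurable borel"
    using v bump_algebra_continuous[OF \<rho>(1)] by (auto intro: borel_measurable_continuous_onI)
  obtain b :: "real^'n" where b: "cball 0 r \<subseteq> cbox (- b) b"
    using bounded_subset_cbox_symmetric[OF bounded_cball] by blast
  define w where "w x = integral (cbox (- b) b) (\<lambda>z. v z * \<rho> (x - z))" for x
  have shift: "continuous_on UNIV (\<lambda>z. v (x - z))" for x
    by (rule continuous_on_compose2[OF v]) (auto intro!: continuous_intros)
  have int': "integrable lborel (\<lambda>z. v (x - z) * \<rho> z)" for x by (rule int[OF shift])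
  \<comment> \<open>Two forms of one convolution: the integral over a box containing the support of
    v puts derivatives on \<rho>, while this one exhibits w x as an average of v over points within
    polar distance \<epsilon> of x.\<close>
  have w: "w x = (LINT z|lborel. v (x - z) * \<rho> z)" for x
  proof -
    have z: "v z = 0" if "z \<notin> cbox (- b) b" for z using supp[of z] b that by force
    have "continuous_on UNIV (\<lambda>z. \<rho> (x - z))"
      by (rule continuous_on_compose2[OF bump_algebra_continuous[OF \<rho>(1), of UNIV]]) (auto intro!: continuous_intros)
    then have "integrable lborel (\<lambda>z. indicator (cbox (- b) b) z *\<^sub>R (v z * \<rho> (x - z)))"
      by (intro borel_integrable_compact continuous_intros continuous_on_subset[OF v]) (auto intro: continuous_on_subset)
    also have "(\<lambda>z. indicator (cbox (- b) b) z *\<^sub>R (v z * \<rho> (x - z))) = (\<lambda>z. v z * \<rho> (x - z))"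
      using z by (auto simp: indicator_def fun_eq_iff)
    finally have "((\<lambda>z. v z * \<rho> (x - z)) has_integral (LINT z|lborel. v z * \<rho> (x - z))) UNIV"
      by (rule has_integral_integral_lborel)
    then have "((\<lambda>z. v z * \<rho> (x - z)) has_integral (LINT z|lborel. v z * \<rho> (x - z))) (cbox (- b) b)"
      using z has_integral_restrict_UNIV[of "cbox (- b) b" "\<lambda>z. v z * \<rho> (x - z)"]
      by (smt (verit, best) has_integral_cong mult_eq_0_iff)
    then have "w x = (LINT z|lborel. v z * \<rho> (x - z))" by (simp add: w_def integral_unique)
    also have "\<dots> = (LINT z|lborel. v (x - z) * \<rho> z)"
      using lborel_integral_reflect[of "\<lambda>z. v (x - z) * \<rho> z" x] by simp
    finally show ?thesis .
  qed
  have upper: "w x \<le> m" if "\<And>y. P (y - x) \<le> \<epsilon> \<Longrightarrow> v y \<le> m" for x m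
  proof -
    have "(LINT z|lborel. v (x - z) * \<rho> z) \<le> (LINT z|lborel. m * \<rho> z)"
    proof (rule integral_mono[OF int' int])
      fix z show "v (x - z) * \<rho> z \<le> m * \<rho> z"
        using that[of "x - z"] \<rho>(2,3)[of z] by (cases "P z > \<epsilon>") (auto intro: mult_right_mono)
    qed simp
    then show ?thesis by (simp add: w one)
  qed
  have lower: "m \<le> w x" if "\<And>y. P (y - x) \<le> \<epsilon> \<Longrightarrow> m \<le> v y" for x m
  proof -
    have "(LINT z|lborel. m * \<rho> z) \<le> (LINT z|lborel. v (x - z) * \<rho> z)"
    proof (rule integral_mono[OF int int'])
      fix z show "m * \<rho> z \<le> v (x - z) * \<rho> z"
        using that[of "x - z"] \<rho>(2,3)[of z] by (cases "P z > \<epsilon>") (auto intro: mult_right_mono)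
    qed simp
    then show ?thesis by (simp add: w one)
  qed
  have smooth: "C_k_on k UNIV w" for k
    unfolding w_def[abs_def] by (rule convolution_smooth[OF v \<rho>(1)])
  have test: "test_function w"
  proof -
    obtain c where c: "c > 0" "\<And>x. c * norm x \<le> P x" using polar_lower by blast
    have "norm x \<le> r + \<epsilon> / c" if "w x \<noteq> 0" for x
    proof (rule ccontr)
      assume far: "\<not> norm x \<le> r + \<epsilon> / c"
      have zero: "v y = 0" if "P (y - x) \<le> \<epsilon>" for y
      proof -
        have "norm (y - x) \<le> \<epsilon> / c" using c(2)[of "y - x"] that c(1) by (simp add: field_simps)
        then have "norm y > r" using far norm_triangle_ineq2[of x y] norm_minus_commute[of x y] by simp
        then show ?thesis by (rule supp)
      qed
      have "w x \<le> 0" by (rule upper) (simp add: zero)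
      moreover have "0 \<le> w x" by (rule lower) (simp add: zero)
      ultimately show False using that by simp
    qed
    then have "bounded {x. w x \<noteq> 0}" unfolding bounded_iff by blast
    then show ?thesis using smooth by (simp add: test_function_def compact_closure)
  qed
  have lip: "F (grad w x) \<le> M" if "0 \<le> M"
    and L: "\<And>y y'. P (y - x) \<le> 2 * \<epsilon> \<Longrightarrow> P (y' - x) \<le> 2 * \<epsilon> \<Longrightarrow> v y - v y' \<le> M * P (y - y')" for x M
  proof (rule F_leI)
    fix y assume y: "P y \<le> 1"
    \<comment> \<open>With h < \<epsilon> and P z \<le> \<epsilon>, both points at which v is
      compared stay within 2 \<epsilon> of x, the range of the Lipschitz hypothesis.\<close>
    have step: "w (x + h *\<^sub>R y) - w x \<le> M * h" if h: "0 < h" "h < \<epsilon>" for h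
    proof -
      have "w (x + h *\<^sub>R y) - w x = (LINT z|lborel. v (x + h *\<^sub>R y - z) * \<rho> z - v (x - z) * \<rho> z)"
        unfolding w by (rule Bochner_Integration.integral_diff[symmetric]) (rule int')+
      also have "\<dots> \<le> (LINT z|lborel. (M * h) * \<rho> z)"
      proof (rule integral_mono)
        fix z
        show "v (x + h *\<^sub>R y - z) * \<rho> z - v (x - z) * \<rho> z \<le> M * h * \<rho> z"
        proof (cases "P z > \<epsilon>")
          case False
          have hy: "P (h *\<^sub>R y) \<le> h" using h y by (simp add: polar_scaleR)
          have "P (x + h *\<^sub>R y - z - x) \<le> 2 * \<epsilon>"
            using polar_triangle[of "h *\<^sub>R y" "- z"] hy h False by simp
          moreover have "P (x - z - x) \<le> 2 * \<epsilon>" using False \<open>\<epsilon> > 0\<close> by simp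
          ultimately have "v (x + h *\<^sub>R y - z) - v (x - z) \<le> M * P (x + h *\<^sub>R y - z - (x - z))" by (rule L)
          also have "x + h *\<^sub>R y - z - (x - z) = h *\<^sub>R y" by simp
          also have "M * P (h *\<^sub>R y) \<le> M * h" using hy \<open>0 \<le> M\<close> by (rule mult_left_mono)
          finally show ?thesis using mult_right_mono[OF _ \<rho>(2)[of z]] by (simp flip: left_diff_distrib)
        qed (simp add: \<rho>(3))
      qed (use int' int[of "\<lambda>_. M * h"] in auto)
      also have "\<dots> = M * h" by (simp add: one)
      finally show ?thesis .
    qed
    have "((\<lambda>t. x + t *\<^sub>R y) has_derivative (\<lambda>s. s *\<^sub>R y)) (at 0)"
      by (auto intro!: derivative_eq_intros)
    moreover have "(w has_derivative (\<lambda>k. grad w x \<bullet> k)) (at (x + 0 *\<^sub>R y))"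
      using grad_has_derivative[OF test_function_differentiable[OF test]] by simp
    ultimately have "((\<lambda>t. w (x + t *\<^sub>R y)) has_derivative (\<lambda>s. grad w x \<bullet> (s *\<^sub>R y))) (at 0)"
      by (rule has_derivative_compose)
    moreover have "(\<lambda>s. grad w x \<bullet> (s *\<^sub>R y)) = (*) (grad w x \<bullet> y)" by (simp add: fun_eq_iff)
    ultimately have "((\<lambda>t. w (x + t *\<^sub>R y)) has_real_derivative (grad w x \<bullet> y)) (at 0)"
      by (simp add: has_field_derivative_def)
    then have "((\<lambda>h. (w (x + h *\<^sub>R y) - w x) / h) \<longlongrightarrow> grad w x \<bullet> y) (at 0)"
      by (simp add: DERIV_def)
    \<comment> \<open>One-sided quotients suffice, since the bipolar inequality needs only an upper
      bound of the directional derivative in each direction y.\<close>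
    then have "((\<lambda>h. (w (x + h *\<^sub>R y) - w x) / h) \<longlongrightarrow> grad w x \<bullet> y) (at_right 0)"
      by (rule tendsto_mono[OF at_le, rotated]) simp
    moreover have "\<forall>\<^sub>F h in at_right 0. (w (x + h *\<^sub>R y) - w x) / h \<le> M"
      using eventually_at_right_real[OF \<open>\<epsilon> > 0\<close>]
      by eventually_elim (use step in \<open>auto simp: field_simps\<close>)
    ultimately have "grad w x \<bullet> y \<le> M"
      by (rule tendsto_upperbound) simp
    then show "y \<bullet> grad w x \<le> M" by (simp add: inner_commute)
  qed
  show ?thesis by (rule that[of w]) (use test upper lower lip in blast)+
qed

section \<open>Moser functions\<close>

text \<open>Energy of the logarithmic profile when mollification has worsened its gradient bound
  from 1 / P to 1 / ((1 - \<theta>) P).\<close>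

lemma nn_integral_scaled_critical:
  assumes "0 < d" "d \<le> R" "\<theta> < 1"
  shows "(\<integral>\<^sup>+x. ennreal (((1 - \<theta>) * P x) powr (- N)) * indicator {x. d \<le> P x \<and> P x \<le> R} x \<partial>lborel)
    \<le> ennreal ((1 - \<theta>) powr (- N) * (N * \<kappa> * ln (R / d) + \<kappa>))"
proof -
  let ?A = "{x. d \<le> P x \<and> P x \<le> R}"
  have "emeasure lborel ?A \<le> emeasure lborel {x. P x \<le> R}" by (intro emeasure_mono) auto
  also have "\<dots> = ennreal (\<kappa> * R powr N)" using assms by (intro emeasure_polar_ball_powr) simp
  finally have A: "emeasure lborel ?A \<le> ennreal (\<kappa> * R powr N)" .
  have "(\<integral>\<^sup>+x. ennreal (((1 - \<theta>) * P x) powr (- N)) * indicator ?A x \<partial>lborel)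
    = (\<integral>\<^sup>+x. ennreal ((1 - \<theta>) powr (- N)) * (ennreal (P x powr (- N)) * indicator ?A x) \<partial>lborel)"
    using assms by (intro nn_integral_cong) (simp add: powr_mult ennreal_mult' mult.assoc)
  also have "\<dots> = ennreal ((1 - \<theta>) powr (- N)) * (\<integral>\<^sup>+x. ennreal (P x powr (- N)) * indicator ?A x \<partial>lborel)"
    by (rule nn_integral_cmult) measurable
  also have "\<dots> \<le> ennreal ((1 - \<theta>) powr (- N)) * ennreal (N * \<kappa> * ln (R / d) + \<kappa> * R powr N * R powr (- N))"
    using assms A kappa_pos by (intro mult_left_mono nn_integral_polar_powr_critical) auto
  also have "\<dots> = ennreal ((1 - \<theta>) powr (- N) * (N * \<kappa> * ln (R / d) + \<kappa>))"
  proof -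
    have "R powr N * R powr (- N) = 1" using assms by (simp flip: powr_add)
    then show ?thesis by (simp add: mult.assoc flip: ennreal_mult')
  qed
  finally show ?thesis .
qed

lemma abs_ln_diff_le:
  fixes a b s :: real
  assumes "s > 0" "a \<ge> s" "b \<ge> s"
  shows "ln a - ln b \<le> \<bar>a - b\<bar> / s"
proof -
  have "ln a - ln b = ln (a / b)" using assms by (simp add: ln_div)
  also have "\<dots> \<le> a / b - 1" using assms by (intro ln_le_minus_one) auto
  also have "\<dots> = (a - b) / b" using assms by (simp add: diff_divide_distrib)
  also have "\<dots> \<le> \<bar>a - b\<bar> / b" using assms by (intro divide_right_mono) auto
  also have "\<dots> \<le> \<bar>a - b\<bar> / s" using assms by (intro divide_left_mono) auto
  finally show ?thesis .
qed

text \<open>The additive energy error must not depend on L. Both \<theta> and the mollification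
  radius may depend on L, so the relative loss (1 - \<theta>) powr (-N) is made to cost less than 1
  in total.\<close>

lemma moser_function:
  assumes "L > 0"
  obtains w where "test_function w" "\<And>x. 0 \<le> w x" "\<And>x. P x \<le> exp (- L) / 2 \<Longrightarrow> w x = L"
    "\<And>x. P x > 2 \<Longrightarrow> w x = 0" "\<And>x. x \<noteq> 0 \<Longrightarrow> P x \<le> 2 \<Longrightarrow> w x \<le> ln (2 / P x)"
    "energy w \<le> ennreal (N * \<kappa> * L + (2 * ln 2 * N * \<kappa> + \<kappa> + 1))"
proof -
  have N: "N > 0" using N_ge_2 by simp
  define a where "a = exp (- L)"
  have a: "0 < a" "a < 1" "ln a = - L" using assms by (auto simp: a_def)
  \<comment> \<open>The energy bound for \<theta> = 0 on exp (-L) / 2 \<le> P \<le> 2, where the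
    ratio of radii has logarithm L + 2 ln 2.\<close>
  define X where "X = N * \<kappa> * (L + 2 * ln 2) + \<kappa>"
  have "((\<lambda>\<theta>. (1 - \<theta>) powr (- N) * X) \<longlongrightarrow> (1 - 0) powr (- N) * X) (at_right 0)"
    by (intro tendsto_intros) auto
  then have "\<forall>\<^sub>F \<theta> in at_right 0. (1 - \<theta>) powr (- N) * X < X + 1"
    by (rule order_tendstoD(2)) simp
  moreover have "\<forall>\<^sub>F \<theta> in at_right 0. \<theta> \<in> {0<..<1 / 2 :: real}"
    by (rule eventually_at_right_real) simp
  ultimately have "\<forall>\<^sub>F \<theta> in at_right 0. \<theta> \<in> {0<..<1 / 2 :: real} \<and> (1 - \<theta>) powr (- N) * X < X + 1"
    by eventually_elim simp
  then obtain \<theta> where \<theta>: "0 < \<theta>" "\<theta> < 1 / 2" and \<theta>X: "(1 - \<theta>) powr (- N) * X < X + 1"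
    using eventually_happens[of _ "at_right (0::real)"] by force
  \<comment> \<open>Proportional to the inner radius: on P x \<ge> a / 2 this gives 2 \<epsilon>
    \<le> \<theta> P x, so a shift by 2 \<epsilon> costs only the factor 1 - \<theta>.\<close>
  define \<epsilon> where "\<epsilon> = a * \<theta> / 4"
  have \<epsilon>: "\<epsilon> > 0" using a \<theta> by (simp add: \<epsilon>_def)
  have \<epsilon>2: "2 * \<epsilon> = a * \<theta> / 2" by (simp add: \<epsilon>_def)
  have \<epsilon>a: "2 * \<epsilon> \<le> a / 4" using a \<theta> by (simp add: \<epsilon>_def)
  define \<tau> where "\<tau> z = min 1 (max a (P z))" for z
  have \<tau>: "a \<le> \<tau> z" "\<tau> z \<le> 1" "\<tau> z > 0" for z using a by (auto simp: \<tau>_def)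
  \<comment> \<open>Truncation inside the logarithm avoids the junk value \<open>ln 0 = 0\<close>.\<close>
  define v where "v z = - ln (\<tau> z)" for z
  have v0: "0 \<le> v z" and vL: "v z \<le> L" for z
  proof -
    show "0 \<le> v z" using \<tau>[of z] by (simp add: v_def)
    have "ln a \<le> ln (\<tau> z)" using \<tau>[of z] a(1) by simp
    then show "v z \<le> L" using a by (simp add: v_def)
  qed
  have v_in: "v z = L" if "P z \<le> a" for z using that a by (simp add: v_def \<tau>_def)
  have v_out: "v z = 0" if "P z \<ge> 1" for z using that a by (simp add: v_def \<tau>_def)
  have v_cont: "continuous_on UNIV v"
    unfolding v_def
  proof (intro continuous_intros)
    show "continuous_on UNIV \<tau>"
      unfolding \<tau>_def[abs_def] by (intro continuous_intros polar_continuous)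
    show "\<forall>x\<in>UNIV. \<tau> x \<noteq> 0" using \<tau>(3) by (metis less_irrefl)
  qed
  obtain c where c: "c > 0" "\<And>x. c * norm x \<le> P x" using polar_lower by blast
  have v_supp: "v z = 0" if "norm z > 1 / c" for z
  proof (rule v_out)
    have "1 < c * norm z" using that c(1) by (simp add: field_simps)
    then show "P z \<ge> 1" using c(2)[of z] by simp
  qed
  obtain w where test: "test_function w"
    and upper: "\<And>x m. (\<And>y. P (y - x) \<le> \<epsilon> \<Longrightarrow> v y \<le> m) \<Longrightarrow> w x \<le> m"
    and lower: "\<And>x m. (\<And>y. P (y - x) \<le> \<epsilon> \<Longrightarrow> m \<le> v y) \<Longrightarrow> m \<le> w x"
    and lip: "\<And>x M. 0 \<le> M \<Longrightarrow>
      (\<And>y y'. P (y - x) \<le> 2 * \<epsilon> \<Longrightarrow> P (y' - x) \<le> 2 * \<epsilon> \<Longrightarrow> v y - v y' \<le> M * P (y - y')) \<Longrightarrow>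
      F (grad w x) \<le> M"
    using mollification[OF v_cont v_supp \<epsilon>] by blast
  have near: "P x - e \<le> P y" "P y \<le> P x + e" if "P (y - x) \<le> e" for x y e
    using polar_triangle[of "y - x" x] polar_triangle[of "x - y" y] polar_minus_commute[of x y] that by auto
  have energy_pointwise: "F (grad w x) powr N \<le>
      ((1 - \<theta>) * P x) powr (- N) * indicat_real {x. a / 2 \<le> P x \<and> P x \<le> 2} x" for x
  proof -
    \<comment> \<open>In the first two regions v is constant within polar distance 2 \<epsilon> of
      x, so the Lipschitz constant 0 forces the gradient to vanish.\<close>
    consider "P x + 2 * \<epsilon> \<le> a" | "P x \<ge> 1 + 2 * \<epsilon>" | "a - 2 * \<epsilon> < P x" "P x < 1 + 2 * \<epsilon>" by linarith
    then show ?thesis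
    proof cases
      case 1
      have "F (grad w x) \<le> 0"
      proof (rule lip)
        fix y y' assume "P (y - x) \<le> 2 * \<epsilon>" "P (y' - x) \<le> 2 * \<epsilon>"
        then have "P y \<le> a" "P y' \<le> a" using near 1 by (meson order_trans)+
        then show "v y - v y' \<le> 0 * P (y - y')" by (simp add: v_in)
      qed simp
      then have "F (grad w x) = 0" using F_nonneg[of "grad w x"] by linarith
      then show ?thesis by simp
    next
      case 2
      have "F (grad w x) \<le> 0"
      proof (rule lip)
        fix y y' assume "P (y - x) \<le> 2 * \<epsilon>" "P (y' - x) \<le> 2 * \<epsilon>"
        then have "P y \<ge> 1" "P y' \<ge> 1" using near(1)[of y x "2 * \<epsilon>"] near(1)[of y' x "2 * \<epsilon>"] 2 by linarith+
        then show "v y - v y' \<le> 0 * P (y - y')" by (simp add: v_out)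
      qed simp
      then have "F (grad w x) = 0" using F_nonneg[of "grad w x"] by linarith
      then show ?thesis by simp
    next
      case 3
      define s where "s = P x - 2 * \<epsilon>"
      have Px: "a / 2 \<le> P x" "P x \<le> 2" using 3 \<epsilon>a a by auto
      have s: "s > 0" "s \<le> 1" using 3 \<epsilon>a a by (auto simp: s_def)
      have "a / 2 * \<theta> \<le> P x * \<theta>" using Px \<theta> by (intro mult_right_mono) auto
      then have "2 * \<epsilon> \<le> P x * \<theta>" unfolding \<epsilon>2 by simp
      then have s\<theta>: "(1 - \<theta>) * P x \<le> s" by (simp add: s_def algebra_simps)
      have "F (grad w x) \<le> 1 / s"
      proof (rule lip)
        fix y y' assume y: "P (y - x) \<le> 2 * \<epsilon>" "P (y' - x) \<le> 2 * \<epsilon>"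
        have "s \<le> P y" "s \<le> P y'" using near(1)[OF y(1)] near(1)[OF y(2)] by (auto simp: s_def)
        then have "\<tau> y \<ge> s" "\<tau> y' \<ge> s" using s by (auto simp: \<tau>_def)
        then have "ln (\<tau> y') - ln (\<tau> y) \<le> \<bar>\<tau> y' - \<tau> y\<bar> / s" using s by (intro abs_ln_diff_le) auto
        also have "\<dots> \<le> \<bar>P y' - P y\<bar> / s"
          using s by (intro divide_right_mono) (auto simp: \<tau>_def min_def max_def)
        also have "\<dots> \<le> P (y - y') / s"
          using s polar_triangle[of "y - y'" y'] polar_triangle[of "y' - y" y] polar_minus_commute[of y y']
          by (intro divide_right_mono) auto
        finally show "v y - v y' \<le> 1 / s * P (y - y')" by (simp add: v_def)
      qed (use s in simp)
      also have "1 / s \<le> 1 / ((1 - \<theta>) * P x)"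
        using s s\<theta> \<theta> Px a by (intro divide_left_mono mult_pos_pos) auto
      finally have "F (grad w x) powr N \<le> (1 / ((1 - \<theta>) * P x)) powr N"
        using N by (intro powr_mono2) auto
      also have "\<dots> = ((1 - \<theta>) * P x) powr (- N)"
        using \<theta> by (simp add: powr_divide powr_minus_divide)
      finally show ?thesis using Px by simp
    qed
  qed
  show ?thesis
  proof (rule that[of w])
    show "0 \<le> w x" for x by (rule lower) (rule v0)
    have w_le: "w x \<le> L" for x by (rule upper) (rule vL)
    show "w x = L" if "P x \<le> exp (- L) / 2" for x
    proof (rule antisym[OF w_le lower])
      fix y assume "P (y - x) \<le> \<epsilon>"
      then have "P y \<le> a" using near(2)[of y x \<epsilon>] that \<epsilon>a \<epsilon> a by (simp add: a_def)
      then show "L \<le> v y" by (simp add: v_in)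
    qed
    show "w x = 0" if "P x > 2" for x
    proof -
      have "v y = 0" if "P (y - x) \<le> \<epsilon>" for y
        using near(1)[OF that] \<open>P x > 2\<close> \<epsilon>a a by (intro v_out) simp
      then have "w x \<le> 0" "0 \<le> w x" by (auto intro!: upper lower)
      then show ?thesis by simp
    qed
    show "w x \<le> ln (2 / P x)" if "x \<noteq> 0" "P x \<le> 2" for x
    \<comment> \<open>Away from the origin averaging reaches only points y with P y \<ge> P x / 2,
      hence the factor 2 in the logarithm. Closer in, P x \<le> a and the bound w \<le> L is already
      good enough.\<close>
    proof (cases "P x \<ge> 2 * \<epsilon>")
      case True
      have Px: "P x > 0" using that by (intro polar_pos)
      show ?thesis
      proof (rule upper)
        fix y assume "P (y - x) \<le> \<epsilon>"
        then have "P x / 2 \<le> P y" using near(1)[of y x \<epsilon>] True by simp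
        then have "P x / 2 \<le> \<tau> y" using that by (auto simp: \<tau>_def)
        then have "ln (P x / 2) \<le> ln (\<tau> y)" using Px by (subst ln_le_cancel_iff) (auto simp: \<tau>)
        then show "v y \<le> ln (2 / P x)" using Px that(1) by (simp add: v_def ln_div)
      qed
    next
      case False
      have Px: "P x > 0" using that by (intro polar_pos)
      have "P x \<le> a" using False \<epsilon>a a by simp
      then have "ln (P x) \<le> - L" using Px a by (metis ln_le_cancel_iff)
      moreover have "ln (2 / P x) = ln 2 - ln (P x)" using Px that(1) by (simp add: ln_div)
      moreover have "ln (2::real) \<ge> 0" by simp
      ultimately show ?thesis using w_le[of x] by linarith
    qed
    have "energy w \<le>
      (\<integral>\<^sup>+x. ennreal (((1 - \<theta>) * P x) powr (- N)) * indicator {x. a / 2 \<le> P x \<and> P x \<le> 2} x \<partial>lborel)"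
    proof (rule nn_integral_mono)
      fix x
      show "ennreal (F (grad w x) powr N) \<le>
          ennreal (((1 - \<theta>) * P x) powr (- N)) * indicator {x. a / 2 \<le> P x \<and> P x \<le> 2} x"
        using ennreal_leI[OF energy_pointwise[of x]] by (simp add: ennreal_mult' ennreal_indicator)
    qed
    also have "\<dots> \<le> ennreal ((1 - \<theta>) powr (- N) * (N * \<kappa> * ln (2 / (a / 2)) + \<kappa>))"
      using a \<theta> by (intro nn_integral_scaled_critical) auto
    also have "ln (2 / (a / 2)) = L + 2 * ln 2"
    proof -
      have "2 / (a / 2) = 2 * 2 / a" by simp
      also have "ln \<dots> = ln (2 * 2) - ln a" using a by (subst ln_div) auto
      also have "ln (2 * 2 :: real) = ln 2 + ln 2" by (rule ln_mult_pos) auto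
      finally show ?thesis using a by simp
    qed
    also have "ennreal ((1 - \<theta>) powr (- N) * (N * \<kappa> * (L + 2 * ln 2) + \<kappa>)) \<le> ennreal (X + 1)"
      using \<theta>X by (intro ennreal_leI) (simp add: X_def)
    also have "X + 1 = N * \<kappa> * L + (2 * ln 2 * N * \<kappa> + \<kappa> + 1)" by (simp add: X_def algebra_simps)
    finally show "energy w \<le> ennreal (N * \<kappa> * L + (2 * ln 2 * N * \<kappa> + \<kappa> + 1))" .
  qed (rule test)
qed

text \<open>From ln s \<le> q s powr (1/q), the q-th power of ln (2 / P) is at most a multiple of 1
  / P, integrable near the origin because N \<ge> 2. The constant serves all Moser functions at
  once.\<close>

lemma nn_integral_log_weight:
  assumes "q > 0"
  obtains D where "D > 0"
    "\<And>w. (\<And>x. 0 \<le> w x) \<Longrightarrow> (\<And>x. P x > 2 \<Longrightarrow> w x = 0) \<Longrightarrow>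
      (\<And>x. x \<noteq> 0 \<Longrightarrow> P x \<le> 2 \<Longrightarrow> w x \<le> ln (2 / P x)) \<Longrightarrow>
      (\<integral>\<^sup>+x. ennreal (w x powr q) \<partial>lborel) \<le> ennreal D"
proof (rule that)
  let ?D = "q powr q * 2 * (\<kappa> * N / (N - 1) * 2 powr (N - 1))"
  show "?D > 0" using assms kappa_pos N_ge_2 by simp
  fix w assume w: "\<And>x. 0 \<le> w x" "\<And>x. P x > 2 \<Longrightarrow> w x = 0"
    "\<And>x. x \<noteq> 0 \<Longrightarrow> P x \<le> 2 \<Longrightarrow> w x \<le> ln (2 / P x)"
  have "(\<integral>\<^sup>+x. ennreal (w x powr q) \<partial>lborel) \<le>
    (\<integral>\<^sup>+x. ennreal (q powr q * 2) * (ennreal (P x powr (- 1)) * indicator {x. P x \<le> 2} x) \<partial>lborel)"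
  proof (intro nn_integral_mono_AE eventually_mono[OF AE_lborel_singleton[of 0]])
    fix x :: "real^'n" assume "x \<noteq> 0"
    then have Px: "P x > 0" by (rule polar_pos)
    show "ennreal (w x powr q) \<le> ennreal (q powr q * 2) * (ennreal (P x powr (- 1)) * indicator {x. P x \<le> 2} x)"
    proof (cases "P x \<le> 2")
      case True
      define s where "s = 2 / P x"
      have s: "s > 0" using Px by (simp add: s_def)
      have "ln (s powr (1 / q)) \<le> s powr (1 / q) - 1" using s by (intro ln_le_minus_one) simp
      then have "ln s \<le> q * s powr (1 / q)" using s assms by (simp add: ln_powr field_simps)
      then have "w x \<le> q * s powr (1 / q)" using w(3)[OF \<open>x \<noteq> 0\<close> True] by (simp add: s_def)
      then have "w x powr q \<le> (q * s powr (1 / q)) powr q" using w assms by (intro powr_mono2) auto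
      also have "\<dots> = q powr q * s" using assms s by (simp add: powr_mult powr_powr)
      also have "\<dots> = q powr q * 2 * P x powr (- 1)" using Px by (simp add: s_def powr_minus_divide)
      finally have "ennreal (w x powr q) \<le> ennreal (q powr q * 2 * P x powr (- 1))" by (rule ennreal_leI)
      then show ?thesis using True by (subst (asm) ennreal_mult') auto
    qed (use w assms in simp)
  qed
  also have "\<dots> = ennreal (q powr q * 2) * (\<integral>\<^sup>+x. ennreal (P x powr (- 1)) * indicator {x. P x \<le> 2} x \<partial>lborel)"
    by (rule nn_integral_cmult) measurable
  also have "\<dots> \<le> ennreal (q powr q * 2) * ennreal (\<kappa> * N / (N - 1) * 2 powr (N - 1))"
    using N_ge_2 by (intro mult_left_mono nn_integral_polar_powr_ball) auto
  also have "\<dots> = ennreal ?D" by (rule ennreal_mult'[symmetric]) simp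
  finally show "(\<integral>\<^sup>+x. ennreal (w x powr q) \<partial>lborel) \<le> ennreal ?D" .
qed

section \<open>Divergence along the normalised Moser functions\<close>

lemma Phi_ge_half_exp:
  assumes "0 \<le> \<beta>" "\<beta> < N" "q > 0"
  obtains t0 where "t0 \<ge> 0" "\<And>t. t \<ge> t0 \<Longrightarrow> exp t / 2 \<le> Phi N q \<beta> t"
proof -
  have N: "N > 1" using N_ge_2 by simp
  obtain j where j: "\<And>t. t \<ge> 0 \<Longrightarrow> Phi N q \<beta> t = exp t - (\<Sum>i<j. t ^ i / fact i)"
    using Phi_eq_exp_tail[OF N assms(3,1,2)] by metis
  have "((\<lambda>t::real. \<Sum>i<j. (t ^ i / exp t) / fact i) \<longlongrightarrow> (\<Sum>i<j. 0 / fact i)) at_top"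
    by (intro tendsto_intros tendsto_power_div_exp_0) auto
  then have "\<forall>\<^sub>F t::real in at_top. (\<Sum>i<j. (t ^ i / exp t) / fact i) < 1 / 2"
    by (rule order_tendstoD(2)) simp
  then obtain t1 where t1: "\<And>t::real. t \<ge> t1 \<Longrightarrow> (\<Sum>i<j. (t ^ i / exp t) / fact i) < 1 / 2"
    unfolding eventually_at_top_linorder by blast
  show ?thesis
  proof (rule that[of "max 0 t1"])
    fix t assume t: "t \<ge> max 0 t1"
    have "(\<Sum>i<j. t ^ i / fact i) = exp t * (\<Sum>i<j. (t ^ i / exp t) / fact i)"
      by (simp add: sum_distrib_left)
    also have "\<dots> \<le> exp t * (1 / 2)" using t1[of t] t by (intro mult_left_mono) auto
    finally show "exp t / 2 \<le> Phi N q \<beta> t" using j[of t] t by simp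
  qed simp
qed

lemma ATMSC_infinite:
  assumes "0 \<le> \<beta>" "\<beta> < N" "q > 0" "\<Lambda> \<ge> crit"
  shows "ATMSC F q \<Lambda> \<beta> = \<infinity>"
proof -
  have N: "N > 1" "N > 0" using N_ge_2 by auto
  define \<gamma> where "\<gamma> = 1 - \<beta> / N"
  have \<gamma>: "\<gamma> > 0" using assms N by (simp add: \<gamma>_def)
  have \<gamma>N: "\<gamma> * N = N - \<beta>" using N by (simp add: \<gamma>_def field_simps)
  obtain D where D: "D > 0"
    and Dle: "\<And>w. (\<And>x. 0 \<le> w x) \<Longrightarrow> (\<And>x. P x > 2 \<Longrightarrow> w x = 0) \<Longrightarrow>
      (\<And>x. x \<noteq> 0 \<Longrightarrow> P x \<le> 2 \<Longrightarrow> w x \<le> ln (2 / P x)) \<Longrightarrow>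
      (\<integral>\<^sup>+x. ennreal (w x powr q) \<partial>lborel) \<le> ennreal D"
    using nn_integral_log_weight[OF \<open>q > 0\<close>] by blast
  obtain t0 where t0: "t0 \<ge> 0" "\<And>t. t \<ge> t0 \<Longrightarrow> exp t / 2 \<le> Phi N q \<beta> t"
    using Phi_ge_half_exp[OF assms(1-3)] by blast
  define C where "C = 2 * ln 2 * N * \<kappa> + \<kappa> + 1"
  have C: "C > 0" using N kappa_pos by (simp add: C_def add_pos_pos)
  \<comment> \<open>Lower bound for the integral over P \<le> exp (-L) / 2: the growth exp ((N -
    \<beta>) L) of the integrand cancels exactly against the decay of the radius to the power N -
    \<beta>, so L drops out.\<close>
  define c1 where "c1 = exp (- \<gamma> * C / \<kappa>) / 2 * \<kappa> * (1 / 2) powr (N - \<beta>)"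
  have c1: "c1 > 0" using kappa_pos by (simp add: c1_def)
  have step: "ennreal (c1 * ((N * \<kappa> * L + C) powr (q / N) / D) powr \<gamma>) \<le> ATMSC F q \<Lambda> \<beta>"
    if L: "L > 0" "(N - \<beta>) * L - \<gamma> * C / \<kappa> \<ge> t0" for L
  proof -
    obtain w where w: "test_function w" "\<And>x. 0 \<le> w x" "\<And>x. P x \<le> exp (- L) / 2 \<Longrightarrow> w x = L"
      "\<And>x. P x > 2 \<Longrightarrow> w x = 0" "\<And>x. x \<noteq> 0 \<Longrightarrow> P x \<le> 2 \<Longrightarrow> w x \<le> ln (2 / P x)"
      and w_energy: "energy w \<le> ennreal (N * \<kappa> * L + C)"
      using moser_function[OF L(1)] unfolding C_def by blast
    note [measurable] = test_function_measurable[OF w(1)]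
    define E where "E = N * \<kappa> * L + C"
    have E: "E > 0" using N kappa_pos L C by (simp add: E_def add_pos_pos)
    define c where "c = E powr (1 / N)"
    have c: "c > 0" "c powr N = E" using E N by (auto simp: c_def powr_powr)
    define u where "u x = (1 / c) * w x" for x
    have u: "test_function u" unfolding u_def[abs_def] by (rule test_function_cmult[OF w(1)])
    note [measurable] = test_function_measurable[OF u]
    have u0: "0 \<le> u x" for x using w(2) c by (simp add: u_def)
    have grad_u: "grad u x = (1 / c) *\<^sub>R grad w x" for x
      unfolding u_def[abs_def] by (rule grad_cmult[OF test_function_differentiable[OF w(1)]])
    have D_grad: "has_D_gradient q u (grad u)"
      unfolding has_D_gradient_def N_eq[symmetric]
      using test_function_Lp[OF u] u assms N
      by (auto intro!: exI[of _ "\<lambda>_. u"] simp: Lp_norm_def)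
    have "energy u = (\<integral>\<^sup>+x. ennreal (1 / E) * ennreal (F (grad w x) powr N) \<partial>lborel)"
      using c E by (intro nn_integral_cong) (simp add: grad_u F_scaleR powr_divide flip: ennreal_mult')
    also have "\<dots> = ennreal (1 / E) * energy w"
      by (rule nn_integral_cmult) measurable
    also have "\<dots> \<le> ennreal (1 / E) * ennreal E"
      using w_energy by (intro mult_left_mono) (auto simp: E_def)
    also have "\<dots> = ennreal 1" using E by (simp flip: ennreal_mult')
    finally have "ennreal (LINT x|lebesgue. norm (F (grad u x)) powr N) \<le> ennreal 1"
      using nn_integral_Lp[OF F_Lp[OF test_function_Lp(2)[OF u], of N]] N
      by (simp add: nn_integral_completion)
    then have "(LINT x|lebesgue. norm (F (grad u x)) powr N) \<le> 1"
      by (subst (asm) ennreal_le_iff) auto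
    then have Fle: "Lp_norm N (\<lambda>x. F (grad u x)) \<le> 1"
      unfolding Lp_norm_def
      using powr_mono2[of "1 / N" "LINT x|lebesgue. norm (F (grad u x)) powr N" 1] N by simp
    define d where "d = exp (- L) / 2"
    have d: "d > 0" by (simp add: d_def)
    have vol: "emeasure lborel {x. P x \<le> d} = ennreal (\<kappa> * d powr N)"
      by (rule emeasure_polar_ball_powr[OF d])
    have nz: "\<not> (AE x in lebesgue. u x = 0)"
    proof
      assume "AE x in lebesgue. u x = 0"
      then have "AE x in lborel. u x = 0" by (simp add: AE_completion_iff)
      then have "emeasure lborel {x. u x \<noteq> 0} = 0" by (subst (asm) AE_iff_measurable[OF _ refl]) auto
      moreover have "emeasure lborel {x. P x \<le> d} \<le> emeasure lborel {x. u x \<noteq> 0}"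
        using w(3) c L(1) by (intro emeasure_mono) (auto simp: u_def d_def)
      ultimately show False using vol kappa_pos d by simp
    qed
    define I where "I = (LINT x|lebesgue. norm (u x) powr q)"
    have uq: "u \<in> Lp q" using assms by (intro test_function_Lp[OF u]) auto
    have I: "I > 0" unfolding I_def by (rule Lp_integral_pos[OF uq nz])
    have "ennreal I = (\<integral>\<^sup>+x. ennreal (norm (u x) powr q) \<partial>lborel)"
      unfolding I_def nn_integral_Lp[OF uq, symmetric] by (rule nn_integral_completion)
    also have "\<dots> = (\<integral>\<^sup>+x. ennreal (c powr (- q)) * ennreal (w x powr q) \<partial>lborel)"
      using c w(2) by (intro nn_integral_cong) (simp add: u_def powr_divide powr_minus_divide flip: ennreal_mult')
    also have "\<dots> = ennreal (c powr (- q)) * (\<integral>\<^sup>+x. ennreal (w x powr q) \<partial>lborel)"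
      by (rule nn_integral_cmult) measurable
    also have "\<dots> \<le> ennreal (c powr (- q)) * ennreal D"
      using Dle[OF w(2,4,5)] by (intro mult_left_mono) auto
    also have "\<dots> = ennreal (c powr (- q) * D)" by (simp add: ennreal_mult')
    finally have I_le: "I \<le> c powr (- q) * D" using D by (subst (asm) ennreal_le_iff) auto
    have norm_u: "Lp_norm q u powr (q * \<gamma>) = I powr \<gamma>"
      using Lp_norm_powr[OF \<open>q > 0\<close>, of u] by (simp add: I_def powr_powr[symmetric])
    define p where "p = N / (N - 1)"
    define e where "e = 1 / (N - 1)"
    have e: "0 < e" "e \<le> 1" "p = 1 + e" using N_ge_2 by (auto simp: e_def p_def field_simps)
    have exponent: "\<Lambda> * \<gamma> * (L / c) powr p \<ge> (N - \<beta>) * L - \<gamma> * C / \<kappa>"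
    proof -
      have cp: "c powr p = E powr e"
        using N by (simp add: c_def powr_powr p_def e_def)
      \<comment> \<open>The share of the normalising energy E carried by its leading term; the rest
        is C / E.\<close>
      define y where "y = N * \<kappa> * L / E"
      have y: "0 < y" "y \<le> 1" using N kappa_pos L E C by (auto simp: y_def E_def)
      have "N * L - C / \<kappa> \<le> N * L * y"
      proof -
        have "1 - y = C / E" using E by (simp add: y_def E_def field_simps)
        also have "\<dots> \<le> C / (N * \<kappa> * L)"
          using N kappa_pos L C E by (intro divide_left_mono mult_pos_pos) (auto simp: E_def)
        finally have "N * L * (1 - y) \<le> N * L * (C / (N * \<kappa> * L))"
          using N L by (intro mult_left_mono) auto
        also have "\<dots> = C / \<kappa>" using N L by simp
        finally show ?thesis by (simp add: algebra_simps)
      qed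
      \<comment> \<open>Here e = 1/(N-1) \<le> 1 and y \<le> 1, so passing to y powr e can only
        increase the value. Normalisation therefore lowers the exponent by no more than a
        constant.\<close>
      also have "N * L * y \<le> N * L * y powr e"
        using N L y e powr_mono'[of e 1 y] by (intro mult_left_mono) auto
      also have "\<dots> = crit * (L / c) powr p"
      proof -
        have "y powr e = (N * \<kappa>) powr e * L powr e / E powr e"
          using N kappa_pos L E by (simp add: y_def powr_mult powr_divide)
        moreover have "L powr p = L * L powr e" using L by (simp add: e(3) powr_add)
        moreover have "(L / c) powr p = L powr p / E powr e" using L c by (simp add: powr_divide cp)
        ultimately show ?thesis by (simp add: crit_def e_def)
      qed
      also have "\<dots> \<le> \<Lambda> * (L / c) powr p" using assms by (intro mult_right_mono) auto
      finally have "\<gamma> * (N * L - C / \<kappa>) \<le> \<gamma> * (\<Lambda> * (L / c) powr p)" using \<gamma> by (intro mult_left_mono) auto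
      moreover have "\<gamma> * (N * L - C / \<kappa>) = (N - \<beta>) * L - \<gamma> * C / \<kappa>"
        unfolding \<gamma>N[symmetric] by (simp add: algebra_simps)
      moreover have "\<gamma> * (\<Lambda> * (L / c) powr p) = \<Lambda> * \<gamma> * (L / c) powr p" by simp
      ultimately show ?thesis by linarith
    qed
    define T where "T = \<Lambda> * \<gamma> * (L / c) powr p"
    define h where "h = exp T / 2 * d powr (- \<beta>)"
    have "exp T / 2 \<le> Phi N q \<beta> T" using exponent L(2) t0 by (simp add: T_def)
    have c1_le: "c1 \<le> h * (\<kappa> * d powr N)"
    proof -
      have "exp ((N - \<beta>) * L - \<gamma> * C / \<kappa>) / 2 * (d powr (N - \<beta>) * \<kappa>) \<le> exp T / 2 * (d powr (N - \<beta>) * \<kappa>)"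
        using exponent kappa_pos by (intro mult_right_mono divide_right_mono) (auto simp: T_def)
      also have "\<dots> = h * (\<kappa> * d powr N)" using d by (simp add: h_def powr_diff powr_minus_divide)
      also have "exp ((N - \<beta>) * L - \<gamma> * C / \<kappa>) / 2 * (d powr (N - \<beta>) * \<kappa>) = c1"
      proof -
        have "d powr (N - \<beta>) = exp (- ((N - \<beta>) * L)) * (1 / 2) powr (N - \<beta>)"
          by (simp add: d_def powr_divide exp_powr_real mult_ac)
        moreover have "exp ((N - \<beta>) * L - \<gamma> * C / \<kappa>) = exp ((N - \<beta>) * L) * exp (- \<gamma> * C / \<kappa>)"
          by (simp flip: exp_add)
        moreover have "exp ((N - \<beta>) * L) * exp (- ((N - \<beta>) * L)) = 1" by (simp flip: exp_add)
        ultimately show ?thesis by (simp add: c1_def mult_ac)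
      qed
      finally show ?thesis .
    qed
    have "ennreal c1 \<le> ennreal (h * (\<kappa> * d powr N))" by (rule ennreal_leI[OF c1_le])
    also have "\<dots> = ennreal h * emeasure lborel {x. P x \<le> d}"
      unfolding vol by (rule ennreal_mult') (simp add: h_def)
    also have "\<dots> = (\<integral>\<^sup>+x. ennreal h * indicator {x. P x \<le> d} x \<partial>lborel)"
      by (rule nn_integral_cmult_indicator[symmetric]) measurable
    also have "\<dots> \<le> (\<integral>\<^sup>+x. ennreal (Phi N q \<beta> (\<Lambda> * \<gamma> * \<bar>u x\<bar> powr p) / P x powr \<beta>) \<partial>lborel)"
    proof (intro nn_integral_mono_AE eventually_mono[OF AE_lborel_singleton[of 0]])
      fix x :: "real^'n" assume "x \<noteq> 0"
      then have Px: "P x > 0" by (rule polar_pos)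
      show "ennreal h * indicator {x. P x \<le> d} x \<le> ennreal (Phi N q \<beta> (\<Lambda> * \<gamma> * \<bar>u x\<bar> powr p) / P x powr \<beta>)"
      proof (cases "P x \<le> d")
        case True
        then have "u x = L / c" using w(3) by (simp add: u_def d_def)
        then have T: "\<Lambda> * \<gamma> * \<bar>u x\<bar> powr p = T" using L c by (simp add: T_def)
        have "d powr (- \<beta>) \<le> P x powr (- \<beta>)" using True Px assms by (intro powr_mono2') auto
        then have "h \<le> Phi N q \<beta> T * P x powr (- \<beta>)"
          unfolding h_def using \<open>exp T / 2 \<le> Phi N q \<beta> T\<close> 
          by (intro mult_mono) (auto intro: order_trans[OF _ \<open>exp T / 2 \<le> Phi N q \<beta> T\<close>])
        then show ?thesis using True by (simp add: T powr_minus_divide ennreal_leI)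
      qed simp
    qed
    finally have int_ge: "ennreal c1 \<le> (\<integral>\<^sup>+x. ennreal (Phi N q \<beta> (\<Lambda> * \<gamma> * \<bar>u x\<bar> powr p) / P x powr \<beta>) \<partial>lebesgue)"
      by (simp add: nn_integral_completion)
    have "(E powr (q / N) / D) powr \<gamma> \<le> 1 / I powr \<gamma>"
    proof -
      have "E powr (q / N) = c powr q" using E N by (simp add: c_def powr_powr)
      then have "I \<le> D / E powr (q / N)" using I_le by (simp add: powr_minus_divide)
      then have "I powr \<gamma> \<le> (D / E powr (q / N)) powr \<gamma>" using I \<gamma> by (intro powr_mono2) auto
      then have "1 / (D / E powr (q / N)) powr \<gamma> \<le> 1 / I powr \<gamma>"
        using I D E by (intro divide_left_mono) auto
      then show ?thesis using D E by (simp add: powr_divide)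
    qed
    then have "c1 * (E powr (q / N) / D) powr \<gamma> \<le> 1 / I powr \<gamma> * c1"
      using mult_left_mono[of "(E powr (q / N) / D) powr \<gamma>" "1 / I powr \<gamma>" c1] c1
      by (simp add: mult.commute)
    then have "ennreal (c1 * (E powr (q / N) / D) powr \<gamma>) \<le> ennreal (1 / Lp_norm q u powr (q * \<gamma>)) * ennreal c1"
      using c1 by (simp add: norm_u ennreal_leI flip: ennreal_mult')
    also have "\<dots> \<le> ennreal (1 / Lp_norm q u powr (q * \<gamma>)) *
        (\<integral>\<^sup>+x. ennreal (Phi N q \<beta> (\<Lambda> * \<gamma> * \<bar>u x\<bar> powr p) / P x powr \<beta>) \<partial>lebesgue)"
      by (intro mult_left_mono int_ge) simp
    also have "\<dots> \<le> ATMSC F q \<Lambda> \<beta>"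
      unfolding ATMSC_def Let_def N_eq[symmetric] \<gamma>_def[symmetric] p_def
      using D_grad Fle nz by (intro SUP_upper) (auto simp: D_space_def)
    finally show ?thesis by (simp add: E_def)
  qed
  have large: "ennreal K \<le> ATMSC F q \<Lambda> \<beta>" if "K > 0" for K
  proof -
    \<comment> \<open>The energy level at which the lower bound reaches K. The choice of L secures
      both this level and the threshold t0 beyond which \<open>Phi\<close> is at least half the
      exponential.\<close>
    define Y where "Y = (D * (K / c1) powr (1 / \<gamma>)) powr (N / q)"
    define L where "L = max (max 1 ((t0 + \<gamma> * C / \<kappa>) / (N - \<beta>))) (Y / (N * \<kappa>))"
    have L: "L > 0" by (simp add: L_def)
    have "(t0 + \<gamma> * C / \<kappa>) / (N - \<beta>) \<le> L" by (simp add: L_def)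
    then have t: "(N - \<beta>) * L - \<gamma> * C / \<kappa> \<ge> t0" using assms by (simp add: field_simps)
    have "Y / (N * \<kappa>) \<le> L" by (simp add: L_def)
    then have "Y \<le> N * \<kappa> * L + C" using N kappa_pos C by (simp add: field_simps)
    then have "Y powr (q / N) \<le> (N * \<kappa> * L + C) powr (q / N)"
      using assms N by (intro powr_mono2) (auto simp: Y_def)
    moreover have "Y powr (q / N) = D * (K / c1) powr (1 / \<gamma>)"
      using assms N D by (simp add: Y_def powr_powr)
    ultimately have "(K / c1) powr (1 / \<gamma>) \<le> (N * \<kappa> * L + C) powr (q / N) / D"
      using D by (simp add: field_simps)
    then have "((K / c1) powr (1 / \<gamma>)) powr \<gamma> \<le> ((N * \<kappa> * L + C) powr (q / N) / D) powr \<gamma>"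
      using \<gamma> by (intro powr_mono2) auto
    then have "K / c1 \<le> ((N * \<kappa> * L + C) powr (q / N) / D) powr \<gamma>"
      using \<gamma> that c1 by (simp add: powr_powr)
    then have "K \<le> c1 * ((N * \<kappa> * L + C) powr (q / N) / D) powr \<gamma>"
      using c1 by (simp add: field_simps)
    then have "ennreal K \<le> ennreal (c1 * ((N * \<kappa> * L + C) powr (q / N) / D) powr \<gamma>)" by (rule ennreal_leI)
    also have "\<dots> \<le> ATMSC F q \<Lambda> \<beta>" by (rule step[OF L t])
    finally show ?thesis .
  qed
  show ?thesis
  proof (cases "ATMSC F q \<Lambda> \<beta>")
    case (real r)
    have "ennreal (r + 1) \<le> ennreal r" using large[of "r + 1"] real by simp
    then show ?thesis using real by (simp add: ennreal_le_iff)
  qed simp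
qed

end

theorem corollary1p2:
  fixes F :: "real^'n \<Rightarrow> real" and q \<Lambda> \<beta> :: real
  assumes "CARD('n) \<ge> 2"
    and "0 \<le> \<beta>" and "\<beta> < real CARD('n)"
    and "q \<ge> 1"
    and "0 \<le> \<Lambda>"
    and "anisotropic_norm F"
  shows "(\<Lambda> < lambda_crit F \<longrightarrow> ATMSC F q \<Lambda> \<beta> < \<infinity>) \<and>
         (\<Lambda> \<ge> lambda_crit F \<longrightarrow> ATMSC F q \<Lambda> \<beta> = \<infinity>)"
proof -
  interpret anisotropic F "real CARD('n)"
    using assms by unfold_locales auto
  show ?thesis
    unfolding crit_eq
    using ATMSC_finite[of \<beta> q \<Lambda>] ATMSC_infinite[of \<beta> q \<Lambda>] assms by auto
qed

end
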